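(* Let $M$ be a $(2n+1)$-dimensional smooth manifold with a contact structure $\xi$. The space $\mathrm{Vect}(M)$ is split into a direct sum of two $\mathrm{CVect}(M)$-modules: $$\mathrm{Vect}(M)\cong \mathrm{CVect}(M)\oplus \mathrm{TVect}(M),$$ where $\mathrm{CVect}(M)$ acts on all three spaces by the Lie bracket.
   Context: A contact structure $\xi$ on a $(2n+1)$-dimensional smooth manifold $M$ ($n\ge 1$) is a codimension 1 distribution which is completely non-integrable: locally $\xi=\ker\alpha$ for a real 1-form $\alpha$ (a contact form, defined up to multiplication by a nonvanishing function) with $\alpha\wedge(d\alpha)^n\neq 0$ everywhere. $\mathrm{Vect}(M)$ is the Lie algebra of all smooth vector fields on $M$ with complex coefficients. $\mathrm{CVect}(M)\subset\mathrm{Vect}(M)$ is the Lie subalgebra of contact vector fields, i.e. of (complex) vector fields $X$ preserving $\xi$: for every (local) contact form $\alpha$ one has $L_X\alpha=f_X\alpha$ for some smooth (complex-valued) function $f_X$. $\mathrm{TVect}(M)\subset\mathrm{Vect}(M)$ is the space of (complex) vector fields tangent to $\xi$, i.e. those $X$ with $\alpha(X)=0$ for every local contact form $\alpha$. *)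

theory Defs
  imports "HOL-Analysis.Analysis" "HOL-Library.Function_Algebras"
begin

section \<open>Smooth functions on open subsets of Euclidean space\<close>

primrec Ck_on :: "nat \<Rightarrow> ('e::euclidean_space \<Rightarrow> 'b::real_normed_vector) \<Rightarrow> 'e set \<Rightarrow> bool" where
  "Ck_on 0 f S \<longleftrightarrow> continuous_on S f"
| "Ck_on (Suc k) f S \<longleftrightarrow>
     (\<forall>x\<in>S. f differentiable (at x)) \<and> (\<forall>v. Ck_on k (\<lambda>x. frechet_derivative f (at x) v) S)"

text \<open>Only used for open \<open>S\<close>.\<close>

definition smooth_on :: "('e::euclidean_space \<Rightarrow> 'b::real_normed_vector) \<Rightarrow> 'e set \<Rightarrow> bool" where
  "smooth_on f S \<longleftrightarrow> (\<forall>k. Ck_on k f S)"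

section \<open>Smooth manifolds\<close>

text \<open>
  The underlying topological space is a whole type \<open>'a\<close> (Hausdorff and second countable by its
  sort), the model space is \<open>real^'m\<close>, and the smooth structure is given by an atlas, which need
  not be maximal.
\<close>

type_synonym ('a, 'm) chart = "'a set \<times> ('a \<Rightarrow> real^'m)"

definition is_chart :: "('a::topological_space, 'm::finite) chart \<Rightarrow> bool" where
  "is_chart c \<longleftrightarrow> open (fst c) \<and> open (snd c ` fst c) \<and>
     homeomorphism (fst c) (snd c ` fst c) (snd c) (inv_into (fst c) (snd c))"

definition in_chart :: "('a, 'm::finite) chart \<Rightarrow> ('a \<Rightarrow> 'b) \<Rightarrow> real^'m \<Rightarrow> 'b" where
  "in_chart c f = f \<circ> inv_into (fst c) (snd c)"

definition smooth_atlas ::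
  "('a::{t2_space, second_countable_topology}, 'm::finite) chart set \<Rightarrow> bool" where
  "smooth_atlas A \<longleftrightarrow> (\<forall>c\<in>A. is_chart c) \<and> (\<Union>c\<in>A. fst c) = UNIV \<and>
     (\<forall>c\<in>A. \<forall>c'\<in>A. smooth_on (in_chart c (snd c')) (snd c ` (fst c \<inter> fst c')))"

definition charts_at :: "('a, 'm::finite) chart set \<Rightarrow> 'a \<Rightarrow> ('a, 'm) chart set" where
  "charts_at A p = {c \<in> A. p \<in> fst c}"

definition smooth_fun_on ::
  "('a, 'm::finite) chart set \<Rightarrow> 'a set \<Rightarrow> ('a \<Rightarrow> 'b::real_normed_vector) \<Rightarrow> bool" where
  "smooth_fun_on A U f \<longleftrightarrow> (\<forall>c\<in>A. smooth_on (in_chart c f) (snd c ` (fst c \<inter> U)))"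

text \<open>\<open>pd c i f p\<close> is the partial derivative of \<open>f\<close> at \<open>p\<close> with respect to the
  \<open>i\<close>-th coordinate of the chart \<open>c\<close>.\<close>

definition pd :: "('a, 'm::finite) chart \<Rightarrow> 'm \<Rightarrow> ('a \<Rightarrow> 'b::real_normed_vector) \<Rightarrow> 'a \<Rightarrow> 'b" where
  "pd c i f p = frechet_derivative (in_chart c f) (at (snd c p)) (axis i 1)"

section \<open>Tangent vectors, vector fields and 1-forms\<close>

text \<open>
  A tangent vector at \<open>p\<close> is the family of its components in all charts around \<open>p\<close>, related by
  the Jacobian matrices of the coordinate changes. For \<open>'k = real\<close> this is the tangent space
  at \<open>p\<close>, for \<open>'k = complex\<close> its complexification. The value 0 at all other charts makes equality
  of families the same as equality of tangent vectors.
\<close>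

definition tangent_space ::
  "('a, 'm::finite) chart set \<Rightarrow> 'a \<Rightarrow> (('a, 'm) chart \<Rightarrow> 'k::real_normed_field^'m) set" where
  "tangent_space A p = {v.
     (\<forall>c. c \<notin> charts_at A p \<longrightarrow> v c = 0) \<and>
     (\<forall>c\<in>charts_at A p. \<forall>c'\<in>charts_at A p. \<forall>i.
        v c' $ i = (\<Sum>j\<in>UNIV. of_real (pd c j (\<lambda>q. snd c' q $ i) p) * v c $ j))}"

definition Vect ::
  "('a, 'm::finite) chart set \<Rightarrow> ('a \<Rightarrow> ('a, 'm) chart \<Rightarrow> complex^'m) set" where
  "Vect A = {X. (\<forall>p. X p \<in> tangent_space A p) \<and> (\<forall>c\<in>A. smooth_fun_on A (fst c) (\<lambda>p. X p c))}"

text \<open>Real smooth 1-forms on an open set \<open>U\<close>, again given by components; the values outside \<open>U\<close>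
  and at charts not containing the point are irrelevant.\<close>

definition one_form_on ::
  "('a, 'm::finite) chart set \<Rightarrow> 'a set \<Rightarrow> ('a \<Rightarrow> ('a, 'm) chart \<Rightarrow> real^'m) \<Rightarrow> bool" where
  "one_form_on A U \<alpha> \<longleftrightarrow>
     (\<forall>p\<in>U. \<forall>c\<in>charts_at A p. \<forall>c'\<in>charts_at A p. \<forall>j.
        \<alpha> p c $ j = (\<Sum>i\<in>UNIV. pd c j (\<lambda>q. snd c' q $ i) p * \<alpha> p c' $ i)) \<and>
     (\<forall>c\<in>A. smooth_fun_on A (fst c \<inter> U) (\<lambda>p. \<alpha> p c))"

text \<open>\<open>\<alpha>(v) = 0\<close> for a real covector \<open>\<alpha>\<close> and a real or complex tangent vector \<open>v\<close> at \<open>p\<close>.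
  The sum does not depend on the chart.\<close>

definition annihilates :: "('a, 'm::finite) chart set \<Rightarrow> 'a \<Rightarrow>
    (('a, 'm) chart \<Rightarrow> real^'m) \<Rightarrow> (('a, 'm) chart \<Rightarrow> 'k::real_normed_field^'m) \<Rightarrow> bool" where
  "annihilates A p \<alpha> v \<longleftrightarrow>
     (\<forall>c\<in>charts_at A p. (\<Sum>i\<in>UNIV. of_real (\<alpha> c $ i) * v c $ i) = 0)"

definition vf_scale ::
  "complex \<Rightarrow> ('a \<Rightarrow> 'c \<Rightarrow> complex^'m::finite) \<Rightarrow> ('a \<Rightarrow> 'c \<Rightarrow> complex^'m)" where
  "vf_scale a X = (\<lambda>p c. a *s X p c)"

definition lie_bracket ::
  "('a \<Rightarrow> ('a, 'm::finite) chart \<Rightarrow> complex^'m) \<Rightarrow> ('a \<Rightarrow> ('a, 'm) chart \<Rightarrow> complex^'m)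
     \<Rightarrow> ('a \<Rightarrow> ('a, 'm) chart \<Rightarrow> complex^'m)" where
  "lie_bracket X Y = (\<lambda>p c. \<chi> i. \<Sum>j\<in>UNIV.
     X p c $ j * pd c j (\<lambda>q. Y q c $ i) p - Y p c $ j * pd c j (\<lambda>q. X q c $ i) p)"

definition lie_derivative ::
  "('a \<Rightarrow> ('a, 'm::finite) chart \<Rightarrow> complex^'m) \<Rightarrow> ('a \<Rightarrow> ('a, 'm) chart \<Rightarrow> real^'m)
     \<Rightarrow> ('a \<Rightarrow> ('a, 'm) chart \<Rightarrow> complex^'m)" where
  "lie_derivative X \<alpha> = (\<lambda>p c. \<chi> j. \<Sum>i\<in>UNIV.
     X p c $ i * of_real (pd c i (\<lambda>q. \<alpha> q c $ j) p)
       + of_real (\<alpha> p c $ i) * pd c j (\<lambda>q. X q c $ i) p)"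

section \<open>Exterior algebra\<close>

text \<open>A \<open>k\<close>-form on \<open>'v\<close> is encoded as a function of a sequence of vectors, of which only the
  entries with index below \<open>k\<close> matter. \<open>wedge k l\<close> is the product of a \<open>k\<close>-form
  and an \<open>l\<close>-form.\<close>

definition wedge :: "nat \<Rightarrow> nat \<Rightarrow> ((nat \<Rightarrow> 'v) \<Rightarrow> real) \<Rightarrow> ((nat \<Rightarrow> 'v) \<Rightarrow> real)
    \<Rightarrow> (nat \<Rightarrow> 'v) \<Rightarrow> real" where
  "wedge k l \<omega> \<eta> v =
     (\<Sum>\<sigma> | \<sigma> permutes {..<k + l}.
        of_int (sign \<sigma>) * \<omega> (\<lambda>i. v (\<sigma> i)) * \<eta> (\<lambda>i. v (\<sigma> (k + i)))) / (fact k * fact l)"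

text \<open>The \<open>n\<close>-th exterior power of a 2-form.\<close>

primrec wedge_power2 :: "nat \<Rightarrow> ((nat \<Rightarrow> 'v) \<Rightarrow> real) \<Rightarrow> (nat \<Rightarrow> 'v) \<Rightarrow> real" where
  "wedge_power2 0 \<omega> = (\<lambda>v. 1)"
| "wedge_power2 (Suc n) \<omega> = wedge 2 (2 * n) \<omega> (wedge_power2 n \<omega>)"

text \<open>The forms \<open>\<alpha>\<close> and \<open>d\<alpha>\<close> at \<open>p\<close>, evaluated on vectors written in the chart \<open>c\<close>.\<close>

definition form_at ::
  "('a \<Rightarrow> ('a, 'm::finite) chart \<Rightarrow> real^'m) \<Rightarrow> 'a \<Rightarrow> ('a, 'm) chart
     \<Rightarrow> (nat \<Rightarrow> real^'m) \<Rightarrow> real" where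
  "form_at \<alpha> p c v = (\<Sum>i\<in>UNIV. \<alpha> p c $ i * v 0 $ i)"

definition ext_deriv_at ::
  "('a \<Rightarrow> ('a, 'm::finite) chart \<Rightarrow> real^'m) \<Rightarrow> 'a \<Rightarrow> ('a, 'm) chart
     \<Rightarrow> (nat \<Rightarrow> real^'m) \<Rightarrow> real" where
  "ext_deriv_at \<alpha> p c v = (\<Sum>i\<in>UNIV. \<Sum>j\<in>UNIV.
     (pd c i (\<lambda>q. \<alpha> q c $ j) p - pd c j (\<lambda>q. \<alpha> q c $ i) p) * v 0 $ i * v 1 $ j)"

section \<open>Contact structures\<close>

text \<open>\<open>\<xi> p\<close> is a set of real tangent vectors at \<open>p\<close>. That it is a hyperplane follows from
  \<open>\<xi> p = ker \<alpha>\<close>, because the last condition forces \<open>\<alpha> \<noteq> 0\<close> at \<open>p\<close>.\<close>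

definition contact_form_on :: "('a::topological_space, 'm::finite) chart set \<Rightarrow> nat \<Rightarrow>
    ('a \<Rightarrow> (('a, 'm) chart \<Rightarrow> real^'m) set) \<Rightarrow> 'a set \<Rightarrow>
    ('a \<Rightarrow> ('a, 'm) chart \<Rightarrow> real^'m) \<Rightarrow> bool" where
  "contact_form_on A n \<xi> U \<alpha> \<longleftrightarrow> open U \<and> one_form_on A U \<alpha> \<and>
     (\<forall>p\<in>U. \<xi> p = {v \<in> tangent_space A p. annihilates A p (\<alpha> p) v}) \<and>
     (\<forall>p\<in>U. \<forall>c\<in>charts_at A p. \<exists>v.
        wedge 1 (2 * n) (form_at \<alpha> p c) (wedge_power2 n (ext_deriv_at \<alpha> p c)) v \<noteq> 0)"

definition contact_structure :: "('a::topological_space, 'm::finite) chart set \<Rightarrow> nat \<Rightarrow>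
    ('a \<Rightarrow> (('a, 'm) chart \<Rightarrow> real^'m) set) \<Rightarrow> bool" where
  "contact_structure A n \<xi> \<longleftrightarrow> (\<forall>p. \<exists>U \<alpha>. p \<in> U \<and> contact_form_on A n \<xi> U \<alpha>)"

definition CVect :: "('a::topological_space, 'm::finite) chart set \<Rightarrow> nat \<Rightarrow>
    ('a \<Rightarrow> (('a, 'm) chart \<Rightarrow> real^'m) set) \<Rightarrow> ('a \<Rightarrow> ('a, 'm) chart \<Rightarrow> complex^'m) set" where
  "CVect A n \<xi> = {X \<in> Vect A. \<forall>U \<alpha>. contact_form_on A n \<xi> U \<alpha> \<longrightarrow>
     (\<exists>f::'a \<Rightarrow> complex. smooth_fun_on A U f \<and>
        (\<forall>p\<in>U. \<forall>c\<in>charts_at A p.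
           lie_derivative X \<alpha> p c = f p *s (\<chi> i. of_real (\<alpha> p c $ i))))}"

definition TVect :: "('a::topological_space, 'm::finite) chart set \<Rightarrow> nat \<Rightarrow>
    ('a \<Rightarrow> (('a, 'm) chart \<Rightarrow> real^'m) set) \<Rightarrow> ('a \<Rightarrow> ('a, 'm) chart \<Rightarrow> complex^'m) set" where
  "TVect A n \<xi> = {X \<in> Vect A. \<forall>U \<alpha>. contact_form_on A n \<xi> U \<alpha> \<longrightarrow>
     (\<forall>p\<in>U. annihilates A p (\<alpha> p) (X p))}"

section \<open>Lie algebras and their modules, with explicit carriers\<close>

locale lie_algebra_on = vector_space scaleL
  for scaleL :: "'k::field \<Rightarrow> 'g::ab_group_add \<Rightarrow> 'g" +
  fixes L :: "'g set" and br :: "'g \<Rightarrow> 'g \<Rightarrow> 'g"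
  assumes subspace_L: "subspace L"
    and br_closed: "x \<in> L \<Longrightarrow> y \<in> L \<Longrightarrow> br x y \<in> L"
    and br_add_left: "x \<in> L \<Longrightarrow> y \<in> L \<Longrightarrow> z \<in> L \<Longrightarrow> br (x + y) z = br x z + br y z"
    and br_add_right: "x \<in> L \<Longrightarrow> y \<in> L \<Longrightarrow> z \<in> L \<Longrightarrow> br x (y + z) = br x y + br x z"
    and br_scale_left: "x \<in> L \<Longrightarrow> y \<in> L \<Longrightarrow> br (scaleL a x) y = scaleL a (br x y)"
    and br_scale_right: "x \<in> L \<Longrightarrow> y \<in> L \<Longrightarrow> br x (scaleL a y) = scaleL a (br x y)"
    and br_self: "x \<in> L \<Longrightarrow> br x x = 0"
    and jacobi: "x \<in> L \<Longrightarrow> y \<in> L \<Longrightarrow> z \<in> L \<Longrightarrow>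
                   br x (br y z) + br y (br z x) + br z (br x y) = 0"

locale lie_module_on = lie_algebra_on scaleL L br + V: vector_space scaleV
  for scaleL :: "'k::field \<Rightarrow> 'g::ab_group_add \<Rightarrow> 'g" and L br
    and scaleV :: "'k \<Rightarrow> 'v::ab_group_add \<Rightarrow> 'v" +
  fixes V :: "'v set" and act :: "'g \<Rightarrow> 'v \<Rightarrow> 'v"
  assumes subspace_V: "V.subspace V"
    and act_closed: "x \<in> L \<Longrightarrow> v \<in> V \<Longrightarrow> act x v \<in> V"
    and act_add_left: "x \<in> L \<Longrightarrow> y \<in> L \<Longrightarrow> v \<in> V \<Longrightarrow> act (x + y) v = act x v + act y v"
    and act_add_right: "x \<in> L \<Longrightarrow> v \<in> V \<Longrightarrow> w \<in> V \<Longrightarrow> act x (v + w) = act x v + act x w"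
    and act_scale_left: "x \<in> L \<Longrightarrow> v \<in> V \<Longrightarrow> act (scaleL a x) v = scaleV a (act x v)"
    and act_scale_right: "x \<in> L \<Longrightarrow> v \<in> V \<Longrightarrow> act x (scaleV a v) = scaleV a (act x v)"
    and act_br: "x \<in> L \<Longrightarrow> y \<in> L \<Longrightarrow> v \<in> V \<Longrightarrow>
                   act (br x y) v = act x (act y v) - act y (act x v)"

locale lie_module_iso_on =
  V: lie_module_on scaleL L br scaleV V actV + W: lie_module_on scaleL L br scaleW W actW
  for scaleL :: "'k::field \<Rightarrow> 'g::ab_group_add \<Rightarrow> 'g" and L br
    and scaleV :: "'k \<Rightarrow> 'v::ab_group_add \<Rightarrow> 'v" and V actV
    and scaleW :: "'k \<Rightarrow> 'w::ab_group_add \<Rightarrow> 'w" and W actW +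
  fixes h :: "'v \<Rightarrow> 'w"
  assumes bij: "bij_betw h V W"
    and hom_add: "v \<in> V \<Longrightarrow> w \<in> V \<Longrightarrow> h (v + w) = h v + h w"
    and hom_scale: "v \<in> V \<Longrightarrow> h (scaleV a v) = scaleW a (h v)"
    and hom_act: "x \<in> L \<Longrightarrow> v \<in> V \<Longrightarrow> h (actV x v) = actW x (h v)"

text \<open>Componentwise scalar multiplication and action on the direct sum of two modules, whose
  carrier is the product of the two carriers.\<close>

definition sum_map :: "('s \<Rightarrow> 'v \<Rightarrow> 'v) \<Rightarrow> ('s \<Rightarrow> 'w \<Rightarrow> 'w) \<Rightarrow> 's \<Rightarrow> 'v \<times> 'w \<Rightarrow> 'v \<times> 'w" where
  "sum_map f g s = map_prod (f s) (g s)"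

end

theory Submission
  imports Defs
begin

text \<open>
  If \<open>t\<close> is tangent to \<open>\<xi>\<close>, then \<open>L_t \<alpha> = i_t d\<alpha>\<close>, so \<open>X - t\<close> is contact iff \<open>L_X \<alpha> - i_t d\<alpha>\<close> is a
  multiple of \<open>\<alpha>\<close>. Together with \<open>\<alpha>(t) = 0\<close> this is, at every point, a linear system for \<open>t\<close>, with
  exactly one solution since \<open>d\<alpha>\<close> is nondegenerate on \<open>ker \<alpha>\<close>. The condition is invariant under
  changes of chart and under \<open>\<alpha> \<mapsto> u\<alpha>\<close>, so the pointwise solutions form a global field, smooth by
  Cramer's rule. A field \<open>X\<close> in \<open>CVect \<inter> TVect\<close> has the two solutions \<open>t = 0\<close> and \<open>t = X\<close>, hence
  vanishes. That \<open>TVect\<close> is a \<open>CVect\<close>-module follows from \<open>X(\<alpha>(Y)) = (L_X \<alpha>)(Y) + \<alpha>([X,Y])\<close>.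
\<close>

section \<open>Calculus of smooth functions\<close>

text \<open>The tangent component depends on first derivatives of \<open>X\<close>, through L_X
  \<alpha>. So this splits spaces of fields and not the tangent bundle: \<xi> gets no chosen
  complement. A Reeb field would span one, but it changes with \<alpha>, and \<alpha> may exist only
  locally. Leaving the multiplier f in L_X \<alpha> - i_t d\<alpha> = f \<alpha> unspecified makes
  the condition depend on \<xi> alone, and uniqueness makes local solutions agree on overlaps.
  Complete non-integrability is given as a nonzero top form, so nondegeneracy of d\<alpha> on ker
  \<alpha> has to be extracted by evaluating that form on a basis adapted to a putative kernel
  vector. Moreover \<alpha> is real and the fields are complex, which is bridged by real and
  imaginary parts. Vectors are families of components, so the bracket, L_X and d must be shown to
  respect coordinate changes. This differentiates Jacobians, and the resulting second derivatives
  fit together only by their symmetry; hence the proof that partial derivatives commute.\<close>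

lemma Ck_on_cong:
  assumes "open S" "\<And>x. x \<in> S \<Longrightarrow> f x = g x" "Ck_on k f S"
  shows "Ck_on k g S"
  using assms(2,3)
proof (induction k arbitrary: f g)
  case 0
  then show ?case by (simp cong: continuous_on_cong)
next
  case (Suc k)
  \<comment> \<open>Openness of \<open>S\<close> enters here: \<open>f\<close> and \<open>g\<close>
    agree near \<open>x\<close>, so they share the derivative.\<close>
  have d: "(g has_derivative frechet_derivative f (at x)) (at x)" if "x \<in> S" for x
  proof (rule has_derivative_transform_within_open[of f _ x UNIV S])
    show "(f has_derivative frechet_derivative f (at x)) (at x)"
      using Suc.prems that by (simp add: frechet_derivative_works)
  qed (use assms(1) that Suc.prems in auto)
  have e: "frechet_derivative f (at x) = frechet_derivative g (at x)" if "x \<in> S" for x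
    using frechet_derivative_at[OF d[OF that]] .
  show ?case
    unfolding Ck_on.simps
  proof (intro conjI ballI allI)
    fix v show "Ck_on k (\<lambda>x. frechet_derivative g (at x) v) S"
      by (rule Suc.IH[of "\<lambda>x. frechet_derivative f (at x) v"]) (use e Suc.prems in auto)
  qed (use d in \<open>auto simp: differentiable_def\<close>)
qed

text \<open>Admits any explicit derivative formula in place of \<open>frechet_derivative\<close>, so
  the usual differentiation rules can drive the inductions on \<open>k\<close>.\<close>

lemma Ck_on_SucI:
  assumes "open S" "\<And>x. x \<in> S \<Longrightarrow> (f has_derivative f' x) (at x)"
    and "\<And>v. Ck_on k (\<lambda>x. f' x v) S"
  shows "Ck_on (Suc k) f S"
proof -
  have "f' x = frechet_derivative f (at x)" if "x \<in> S" for x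
    using frechet_derivative_at[OF assms(2)[OF that]] .
  then have "Ck_on k (\<lambda>x. frechet_derivative f (at x) v) S" for v
    using Ck_on_cong[OF assms(1) _ assms(3)[of v]] by simp
  then show ?thesis
    using assms(2) by (auto simp: differentiable_def)
qed

lemma Ck_on_SucD:
  assumes "Ck_on (Suc k) f S"
  shows "\<And>x. x \<in> S \<Longrightarrow> (f has_derivative frechet_derivative f (at x)) (at x)"
    and "Ck_on k (\<lambda>x. frechet_derivative f (at x) v) S"
  using assms by (auto simp: frechet_derivative_works)

lemma Ck_on_Suc_imp: "Ck_on (Suc k) f S \<Longrightarrow> Ck_on k f S"
proof (induction k arbitrary: f)
  case 0
  then show ?case
    by (auto intro!: differentiable_imp_continuous_on simp: differentiable_on_def differentiable_at_withinI)
next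
  case (Suc k)
  show ?case
    unfolding Ck_on.simps(2)[of k]
    using Suc.prems Suc.IH Ck_on_SucD(2)[OF Suc.prems] by (auto simp only: Ck_on.simps(2)[of "Suc k"])
qed

lemma Ck_on_subset: "Ck_on k f S \<Longrightarrow> T \<subseteq> S \<Longrightarrow> Ck_on k f T"
  by (induction k arbitrary: f) (auto intro: continuous_on_subset)

lemma Ck_on_Union:
  assumes "\<And>S. S \<in> \<S> \<Longrightarrow> open S" "\<And>S. S \<in> \<S> \<Longrightarrow> Ck_on k f S"
  shows "Ck_on k f (\<Union>\<S>)"
  using assms(2)
  by (induction k arbitrary: f) (auto intro: continuous_on_open_Union assms(1))

lemma Ck_on_const: "Ck_on k (\<lambda>x. c) S"
  by (induction k arbitrary: c) auto

lemma Ck_on_bounded_linear: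
  assumes "bounded_linear h" "open S" "Ck_on k f S"
  shows "Ck_on k (\<lambda>x. h (f x)) S"
  using assms(3)
proof (induction k arbitrary: f)
  case 0
  then show ?case using assms(1) by (auto intro: bounded_linear.continuous_on)
next
  case (Suc k)
  show ?case
    by (rule Ck_on_SucI[where f' = "\<lambda>x v. h (frechet_derivative f (at x) v)"])
      (use Ck_on_SucD[OF Suc.prems] Suc.IH assms in \<open>auto intro: bounded_linear.has_derivative\<close>)
qed

lemma Ck_on_add:
  assumes "open S" "Ck_on k f S" "Ck_on k g S"
  shows "Ck_on k (\<lambda>x. f x + g x) S"
  using assms(2,3)
proof (induction k arbitrary: f g)
  case 0
  then show ?case by (auto intro: continuous_on_add)
next
  case (Suc k)
  show ?case
    by (rule Ck_on_SucI[where f' = "\<lambda>x v. frechet_derivative f (at x) v + frechet_derivative g (at x) v"])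
      (use Ck_on_SucD[OF Suc.prems(1)] Ck_on_SucD[OF Suc.prems(2)] Suc.IH assms(1)
        in \<open>auto intro: has_derivative_add\<close>)
qed

lemma Ck_on_sum:
  assumes "open S" "\<And>i. i \<in> I \<Longrightarrow> Ck_on k (f i) S"
  shows "Ck_on k (\<lambda>x. \<Sum>i\<in>I. f i x) S"
  using assms(2)
  by (induction I rule: infinite_finite_induct) (auto intro: Ck_on_const Ck_on_add assms(1))

text \<open>The product rule yields two terms of the same bilinear shape, each with one factor
  differentiated; hence the induction runs over all \<open>f\<close> and \<open>g\<close>.\<close>

lemma Ck_on_bounded_bilinear:
  assumes "bounded_bilinear b" "open S" "Ck_on k f S" "Ck_on k g S"
  shows "Ck_on k (\<lambda>x. b (f x) (g x)) S"
  using assms(3,4)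
proof (induction k arbitrary: f g)
  case 0
  then show ?case using assms(1) by (auto intro: bounded_bilinear.continuous_on)
next
  case (Suc k)
  note f = Ck_on_SucD[OF Suc.prems(1)] and g = Ck_on_SucD[OF Suc.prems(2)]
  show ?case
  proof (rule Ck_on_SucI[OF assms(2)])
    show "((\<lambda>x. b (f x) (g x)) has_derivative (\<lambda>v. b (f x) (frechet_derivative g (at x) v)
       + b (frechet_derivative f (at x) v) (g x))) (at x)" if "x \<in> S" for x
      using bounded_bilinear.FDERIV[OF assms(1) f(1)[OF that] g(1)[OF that]] .
    show "Ck_on k (\<lambda>x. b (f x) (frechet_derivative g (at x) v)
       + b (frechet_derivative f (at x) v) (g x)) S" for v
      by (intro Ck_on_add[OF assms(2)] Suc.IH f(2) g(2) Ck_on_Suc_imp[OF Suc.prems(1)]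
          Ck_on_Suc_imp[OF Suc.prems(2)])
  qed
qed

text \<open>The derivative of 1/f is a product containing 1/f again, which the induction hypothesis
  supplies at the lower order.\<close>

lemma Ck_on_inverse:
  fixes f :: "'e::euclidean_space \<Rightarrow> 'b::real_normed_field"
  assumes "open S" "\<And>x. x \<in> S \<Longrightarrow> f x \<noteq> 0" "Ck_on k f S"
  shows "Ck_on k (\<lambda>x. inverse (f x)) S"
  using assms(3)
proof (induction k)
  case 0
  then show ?case using assms(2) by (auto intro!: continuous_on_inverse)
next
  case (Suc k)
  note f = Ck_on_SucD[OF Suc.prems]
  note mult = Ck_on_bounded_bilinear[OF bounded_bilinear_mult assms(1)]
  have "Ck_on k (\<lambda>x. - (inverse (f x) * frechet_derivative f (at x) v * inverse (f x))) S" for v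
    by (intro Ck_on_bounded_linear[OF bounded_linear_minus[OF bounded_linear_ident] assms(1)] mult
        Suc.IH f(2) Ck_on_Suc_imp[OF Suc.prems])
  then show ?case
    using Ck_on_SucI[OF assms(1) Deriv.has_derivative_inverse[OF assms(2) f(1)]] by blast
qed

text \<open>In the chain rule the derivative of \<open>g\<close> is applied to a direction that
  moves with \<open>x\<close>. Expanding this direction in a basis leaves derivatives of
  \<open>g\<close> in fixed directions, composed with \<open>f\<close>, and these are covered by the
  induction over \<open>g\<close>.\<close>

lemma Ck_on_compose:
  fixes f :: "'e::euclidean_space \<Rightarrow> 'f::euclidean_space"
  assumes "open S" "open T" "f ` S \<subseteq> T" "Ck_on k f S" "Ck_on k g T"
  shows "Ck_on k (\<lambda>x. g (f x)) S"
  using assms(4,5)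
proof (induction k arbitrary: g)
  case 0
  then show ?case
    using continuous_on_compose2[of T g S f] assms(3) by simp
next
  case (Suc k)
  note f = Ck_on_SucD[OF Suc.prems(1)] and g = Ck_on_SucD[OF Suc.prems(2)]
  define f' where "f' x = frechet_derivative f (at x)" for x
  define g' where "g' y = frechet_derivative g (at y)" for y
  have lin: "linear (g' (f x))" if "x \<in> S" for x
    using g(1)[of "f x"] that assms(3)
    unfolding g'_def by (auto intro: has_derivative_linear)
  have g'_exp: "g' (f x) w = (\<Sum>b\<in>Basis. (w \<bullet> b) *\<^sub>R g' (f x) b)" if "x \<in> S" for x w
  proof -
    have "g' (f x) w = g' (f x) (\<Sum>b\<in>Basis. (w \<bullet> b) *\<^sub>R b)"
      by (simp only: euclidean_representation)
    also have "\<dots> = (\<Sum>b\<in>Basis. (w \<bullet> b) *\<^sub>R g' (f x) b)"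
      by (simp only: linear_sum[OF lin[OF that]] linear_cmul[OF lin[OF that]])
    finally show ?thesis .
  qed
  show ?case
  proof (rule Ck_on_SucI[OF assms(1)])
    fix x assume x: "x \<in> S"
    have "(g \<circ> f has_derivative g' (f x) \<circ> f' x) (at x)"
      using diff_chain_at[OF f(1)[OF x], of g "g' (f x)"] g(1)[of "f x"] x assms(3)
      by (auto simp: g'_def f'_def)
    then show "((\<lambda>x. g (f x)) has_derivative (\<lambda>v. \<Sum>b\<in>Basis. (f' x v \<bullet> b) *\<^sub>R g' (f x) b)) (at x)"
      unfolding o_def g'_exp[OF x, of "f' x v" for v] .
  next
    fix v
    have "Ck_on k (\<lambda>x. g' (f x) b) S" for b
      using Suc.IH[OF Ck_on_Suc_imp[OF Suc.prems(1)] g(2)] unfolding g'_def .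
    moreover have "Ck_on k (\<lambda>x. f' x v \<bullet> b) S" for b
      using Ck_on_bounded_linear[OF bounded_linear_inner_left assms(1) f(2)] unfolding f'_def .
    ultimately show "Ck_on k (\<lambda>x. \<Sum>b\<in>Basis. (f' x v \<bullet> b) *\<^sub>R g' (f x) b) S"
      by (intro Ck_on_sum[OF assms(1)] Ck_on_bounded_bilinear[OF bounded_bilinear_scaleR assms(1)])
  qed
qed

section \<open>Smooth functions and the symmetry of second derivatives\<close>

lemma smooth_on_frechet_derivative:
  "smooth_on f S \<Longrightarrow> smooth_on (\<lambda>x. frechet_derivative f (at x) v) S"
  unfolding smooth_on_def using Ck_on_SucD(2) by blast

lemma smooth_on_has_derivative:
  "smooth_on f S \<Longrightarrow> x \<in> S \<Longrightarrow> (f has_derivative frechet_derivative f (at x)) (at x)"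
  unfolding smooth_on_def using Ck_on_SucD(1) by blast

text \<open>The left-hand side is symmetric in \<open>u\<close> and \<open>v\<close>, so letting \<open>h\<close> tend to 0 shows that
  second derivatives commute.\<close>

lemma second_difference_mvt:
  fixes f :: "'e::euclidean_space \<Rightarrow> real"
  assumes S: "\<And>s t. 0 \<le> s \<Longrightarrow> s \<le> h \<Longrightarrow> 0 \<le> t \<Longrightarrow> t \<le> h \<Longrightarrow> x + s *\<^sub>R u + t *\<^sub>R v \<in> S"
    and "smooth_on f S" "0 < h"
  defines "D \<equiv> \<lambda>g w y. frechet_derivative g (at y) w"
  shows "\<exists>s t. 0 < s \<and> s < h \<and> 0 < t \<and> t < h \<and>
    f (x + h *\<^sub>R u + h *\<^sub>R v) - f (x + h *\<^sub>R u) - f (x + h *\<^sub>R v) + f x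
      = h * h * D (D f u) v (x + s *\<^sub>R u + t *\<^sub>R v)"
proof -
  have smD: "smooth_on (D f u) S"
    unfolding D_def by (rule smooth_on_frechet_derivative[OF assms(2)])
  have along: "((\<lambda>r. g (y + r *\<^sub>R w)) has_real_derivative D g w (y + r *\<^sub>R w)) (at r)"
    if "smooth_on g S" "y + r *\<^sub>R w \<in> S" for g :: "'e \<Rightarrow> real" and y w r
  proof -
    have g: "(g has_derivative (\<lambda>w'. D g w' (y + r *\<^sub>R w))) (at (y + r *\<^sub>R w))"
      using smooth_on_has_derivative[OF that] unfolding D_def .
    have "((\<lambda>r. y + r *\<^sub>R w) has_derivative (\<lambda>r. r *\<^sub>R w)) (at r)"
      by (auto intro!: derivative_eq_intros)
    from diff_chain_at[OF this g]
    have "((\<lambda>r. g (y + r *\<^sub>R w)) has_derivative (\<lambda>s. D g (s *\<^sub>R w) (y + r *\<^sub>R w))) (at r)"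
      by (simp add: o_def)
    moreover have "D g (s *\<^sub>R w) (y + r *\<^sub>R w) = D g w (y + r *\<^sub>R w) * s" for s
      using linear_cmul[OF has_derivative_linear[OF g], of s w] by simp
    ultimately show ?thesis
      by (simp add: has_field_derivative_def)
  qed
  \<comment> \<open>The second difference equals \<open>F h - F 0\<close>. The mean value theorem in
    direction \<open>u\<close> turns it into a difference of first derivatives, and a second
    application in direction \<open>v\<close> finishes.\<close>
  define F where "F s = f (x + s *\<^sub>R u + h *\<^sub>R v) - f (x + s *\<^sub>R u)" for s
  have F': "(F has_real_derivative
      D f u (x + s *\<^sub>R u + h *\<^sub>R v) - D f u (x + s *\<^sub>R u)) (at s)" if "0 \<le> s" "s \<le> h" for s
  proof -
    have "((\<lambda>s. f (x + h *\<^sub>R v + s *\<^sub>R u)) has_real_derivative D f u (x + h *\<^sub>R v + s *\<^sub>R u)) (at s)"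
      by (rule along[OF assms(2)]) (use S[OF that, of h] \<open>0 < h\<close> in \<open>auto simp: add_ac\<close>)
    moreover have "((\<lambda>s. f (x + s *\<^sub>R u)) has_real_derivative D f u (x + s *\<^sub>R u)) (at s)"
      by (rule along[OF assms(2)]) (use S[OF that, of 0] \<open>0 < h\<close> in auto)
    ultimately show ?thesis
      unfolding F_def by (intro DERIV_diff) (simp_all add: add_ac)
  qed
  obtain s where s: "0 < s" "s < h" and Fs: "F h - F 0
      = (h - 0) * (D f u (x + s *\<^sub>R u + h *\<^sub>R v) - D f u (x + s *\<^sub>R u))"
    using MVT2[OF \<open>0 < h\<close> F'] by auto
  have G': "((\<lambda>t. D f u (x + s *\<^sub>R u + t *\<^sub>R v)) has_real_derivative
      D (D f u) v (x + s *\<^sub>R u + t *\<^sub>R v)) (at t)" if "0 \<le> t" "t \<le> h" for t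
    by (rule along[OF smD]) (use S[OF _ _ that] s in auto)
  obtain t where t: "0 < t" "t < h" and
    "D f u (x + s *\<^sub>R u + h *\<^sub>R v) - D f u (x + s *\<^sub>R u + 0 *\<^sub>R v)
      = (h - 0) * D (D f u) v (x + s *\<^sub>R u + t *\<^sub>R v)"
    using MVT2[OF \<open>0 < h\<close> G'] by auto
  then have "F h - F 0 = h * h * D (D f u) v (x + s *\<^sub>R u + t *\<^sub>R v)"
    using Fs by simp
  then show ?thesis
    using s t unfolding F_def by (intro exI[of _ s] exI[of _ t]) (simp add: algebra_simps)
qed

lemma frechet_derivative_commute_real:
  fixes f :: "'e::euclidean_space \<Rightarrow> real"
  assumes "open S" "x \<in> S" "smooth_on f S"
  shows "frechet_derivative (\<lambda>y. frechet_derivative f (at y) u) (at x) v =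
         frechet_derivative (\<lambda>y. frechet_derivative f (at y) v) (at x) u"
proof (rule ccontr)
  define D where "D = (\<lambda>(g::'e \<Rightarrow> real) w y. frechet_derivative g (at y) w)"
  define P where "P = D (D f u) v"
  define Q where "Q = D (D f v) u"
  assume "\<not> ?thesis"
  then have ne: "P x \<noteq> Q x" by (simp add: P_def Q_def D_def)
  have "smooth_on P S" "smooth_on Q S"
    unfolding P_def Q_def D_def by (intro smooth_on_frechet_derivative assms(3))+
  then have "isCont P x" "isCont Q x"
    using assms(1,2) unfolding smooth_on_def
    by (metis Ck_on.simps(1) continuous_on_eq_continuous_at)+
  \<comment> \<open>Half the distance, so that the \<open>e\<close>-balls around \<open>P x\<close>
    and \<open>Q x\<close> are disjoint.\<close>
  define e where "e = \<bar>P x - Q x\<bar> / 2"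
  have "e > 0" using ne by (simp add: e_def)
  obtain d1 where d1: "d1 > 0" "ball x d1 \<subseteq> S"
    using assms(1,2) openE by blast
  obtain d2 where d2: "d2 > 0" "\<And>y. dist y x < d2 \<Longrightarrow> dist (P y) (P x) < e"
    using \<open>isCont P x\<close> \<open>e > 0\<close> unfolding continuous_at_eps_delta by (metis dist_commute)
  obtain d3 where d3: "d3 > 0" "\<And>y. dist y x < d3 \<Longrightarrow> dist (Q y) (Q x) < e"
    using \<open>isCont Q x\<close> \<open>e > 0\<close> unfolding continuous_at_eps_delta by (metis dist_commute)
  define d where "d = Min {d1, d2, d3}"
  \<comment> \<open>Small enough to keep the parallelogram with sides \<open>h *\<^sub>R u\<close>
    and \<open>h *\<^sub>R v\<close> within distance \<open>d\<close> of \<open>x\<close>; the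
    summand 1 covers \<open>u = v = 0\<close>.\<close>
  define h where "h = d / (norm u + norm v + 1)"
  have "d > 0" using d1 d2 d3 by (simp add: d_def)
  have pos: "norm u + norm v + 1 > 0" by (simp add: add_nonneg_pos)
  have "h > 0" using \<open>d > 0\<close> pos by (simp add: h_def)
  \<comment> \<open>Stated for \<open>u'\<close> and \<open>v'\<close> so that it serves both orders
    of differentiation.\<close>
  have close: "dist (x + s *\<^sub>R u' + t *\<^sub>R v') x < d"
    if "0 \<le> s" "s \<le> h" "0 \<le> t" "t \<le> h" "norm u' + norm v' = norm u + norm v" for s t u' v'
  proof -
    have "norm (s *\<^sub>R u' + t *\<^sub>R v') \<le> s * norm u' + t * norm v'"
      using norm_triangle_ineq[of "s *\<^sub>R u'" "t *\<^sub>R v'"] that by simp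
    also have "\<dots> \<le> h * norm u' + h * norm v'"
      using that by (intro add_mono mult_right_mono) auto
    also have "\<dots> = h * (norm u + norm v)"
      using that(5) by (simp add: distrib_left flip: that(5))
    also have "\<dots> < h * (norm u + norm v + 1)" using \<open>h > 0\<close> by simp
    also have "\<dots> = d" using pos by (simp add: h_def)
    finally show ?thesis by (simp add: dist_norm add.assoc)
  qed
  have inS: "y \<in> S" if "dist y x < d" for y
    using d1 that by (auto simp: d_def dist_commute)
  obtain s t where st: "0 < s" "s < h" "0 < t" "t < h" and
    eq1: "f (x + h *\<^sub>R u + h *\<^sub>R v) - f (x + h *\<^sub>R u) - f (x + h *\<^sub>R v) + f x
      = h * h * P (x + s *\<^sub>R u + t *\<^sub>R v)"
    using second_difference_mvt[OF inS[OF close] assms(3) \<open>h > 0\<close>, of u v]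
    unfolding P_def D_def by auto
  obtain s' t' where st': "0 < s'" "s' < h" "0 < t'" "t' < h" and
    eq2: "f (x + h *\<^sub>R v + h *\<^sub>R u) - f (x + h *\<^sub>R v) - f (x + h *\<^sub>R u) + f x
      = h * h * Q (x + s' *\<^sub>R v + t' *\<^sub>R u)"
    using second_difference_mvt[OF inS[OF close] assms(3) \<open>h > 0\<close>, of v u]
    unfolding Q_def D_def by (auto simp: add_ac)
  have "h * h * P (x + s *\<^sub>R u + t *\<^sub>R v) = h * h * Q (x + s' *\<^sub>R v + t' *\<^sub>R u)"
    using eq1 eq2 arg_cong[OF add.commute[of "h *\<^sub>R u" "h *\<^sub>R v"], of "\<lambda>w. f (x + w)"]
    by (simp only: add.assoc)
  then have "P (x + s *\<^sub>R u + t *\<^sub>R v) = Q (x + s' *\<^sub>R v + t' *\<^sub>R u)"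
    using \<open>h > 0\<close> by simp
  moreover have "dist (P (x + s *\<^sub>R u + t *\<^sub>R v)) (P x) < e"
    using close[of s t u v] st by (intro d2) (auto simp: d_def)
  moreover have "dist (Q (x + s' *\<^sub>R v + t' *\<^sub>R u)) (Q x) < e"
    using close[of s' t' v u] st' by (intro d3) (auto simp: d_def)
  ultimately show False
    unfolding e_def dist_real_def by argo
qed

section \<open>Germs of smooth functions on a manifold\<close>

text \<open>The neighbourhood is hidden in the definition, so that calculations with sums, products
  and quotients need not track domains.\<close>

definition smooth_at ::
  "('a::topological_space, 'm::finite) chart set \<Rightarrow> 'a \<Rightarrow> ('a \<Rightarrow> 'b::real_normed_vector) \<Rightarrow> bool" where
  "smooth_at A p f \<longleftrightarrow> (\<exists>U. open U \<and> p \<in> U \<and> smooth_fun_on A U f)"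

text \<open>Complex-valued, so that the rules for derivatives of complex functions, such as
  \<open>pd_chain\<close>, apply to coordinates.\<close>

definition coord :: "('a, 'm::finite) chart \<Rightarrow> 'm \<Rightarrow> 'a \<Rightarrow> complex" where
  "coord c i q = of_real (snd c q $ i)"

locale atlas =
  fixes A :: "('a::{t2_space, second_countable_topology}, 'm::finite) chart set"
  assumes atlas: "smooth_atlas A"
begin

lemma chart:
  assumes "c \<in> A"
  shows open_chart: "open (fst c)"
    and inv_chart: "\<And>q. q \<in> fst c \<Longrightarrow> inv_into (fst c) (snd c) (snd c q) = q"
    and chart_continuous: "continuous_on (fst c) (snd c)"
    and open_chart_image: "\<And>U. open U \<Longrightarrow> open (snd c ` (fst c \<inter> U))"
proof -
  have h: "homeomorphism (fst c) (snd c ` fst c) (snd c) (inv_into (fst c) (snd c))"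
    and o: "open (fst c)" "open (snd c ` fst c)"
    using atlas assms by (auto simp: smooth_atlas_def is_chart_def)
  show "open (fst c)" by fact
  show "\<And>q. q \<in> fst c \<Longrightarrow> inv_into (fst c) (snd c) (snd c q) = q"
    using h by (simp add: homeomorphism_def)
  show "continuous_on (fst c) (snd c)" using h by (simp add: homeomorphism_def)
  show "open (snd c ` (fst c \<inter> U))" if "open U" for U
  proof -
    have "openin (top_of_set (snd c ` fst c)) (snd c ` (fst c \<inter> U))"
      using homeomorphism_imp_open_map[OF h] that by (simp add: openin_open_Int)
    then show ?thesis using o(2) openin_open_eq by blast
  qed
qed

lemma open_subchart_image: "c \<in> A \<Longrightarrow> open U \<Longrightarrow> U \<subseteq> fst c \<Longrightarrow> open (snd c ` U)"
  using open_chart_image[of c U] by (simp add: Int_absorb1)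

lemma charts_atD: "c \<in> charts_at A p \<Longrightarrow> c \<in> A" "c \<in> charts_at A p \<Longrightarrow> p \<in> fst c"
  by (auto simp: charts_at_def)

lemma ex_chart: "\<exists>c. c \<in> charts_at A p"
proof -
  have "p \<in> (\<Union>c\<in>A. fst c)" using atlas by (simp add: smooth_atlas_def)
  then show ?thesis unfolding charts_at_def by blast
qed

lemma eventually_charts_at: "c \<in> charts_at A p \<Longrightarrow> \<forall>\<^sub>F q in nhds p. c \<in> charts_at A q"
  unfolding eventually_nhds
  by (rule exI[of _ "fst c"]) (auto simp: charts_at_def open_chart)

lemma in_chart_apply: "c \<in> A \<Longrightarrow> q \<in> fst c \<Longrightarrow> in_chart c f (snd c q) = f q"
  by (simp add: in_chart_def inv_chart)

lemma smooth_transition: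
  "c \<in> A \<Longrightarrow> c' \<in> A \<Longrightarrow> smooth_on (in_chart c (snd c')) (snd c ` (fst c \<inter> fst c'))"
  using atlas by (auto simp: smooth_atlas_def)

lemma smooth_on_subset: "smooth_on f S \<Longrightarrow> T \<subseteq> S \<Longrightarrow> smooth_on f T"
  using Ck_on_subset unfolding smooth_on_def by blast

text \<open>One chart suffices, because the expression in any other chart is a composition with a
  smooth coordinate change.\<close>

lemma smooth_at_chartI:
  assumes c: "c \<in> charts_at A p" and U: "open U" "p \<in> U" "U \<subseteq> fst c"
    and f: "smooth_on (in_chart c f) (snd c ` U)"
  shows "smooth_at A p f"
  unfolding smooth_at_def smooth_fun_on_def
proof (intro exI[of _ U] conjI ballI U)
  fix c' assume c': "c' \<in> A"
  note cA = charts_atD(1)[OF c]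
  have sub: "smooth_on (in_chart c' (snd c)) (snd c' ` (fst c' \<inter> U))"
    using smooth_transition[OF c' cA] by (rule smooth_on_subset) (use U in auto)
  have oU: "open (snd c ` U)" by (rule open_subchart_image[OF cA U(1,3)])
  have oU': "open (snd c' ` (fst c' \<inter> U))" using open_chart_image[OF c' U(1)] .
  have "Ck_on k (in_chart c' f) (snd c' ` (fst c' \<inter> U))" for k
  proof (rule Ck_on_cong[OF oU'])
    show "in_chart c f (in_chart c' (snd c) y) = in_chart c' f y" if "y \<in> snd c' ` (fst c' \<inter> U)" for y
    proof -
      obtain q where q: "q \<in> fst c'" "q \<in> U" "y = snd c' q" using \<open>y \<in> _\<close> by blast
      then show ?thesis using U(3) by (auto simp: in_chart_apply c' cA subset_iff)
    qed
    show "Ck_on k (\<lambda>y. in_chart c f (in_chart c' (snd c) y)) (snd c' ` (fst c' \<inter> U))"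
    proof (rule Ck_on_compose[OF oU' oU])
      show "in_chart c' (snd c) ` snd c' ` (fst c' \<inter> U) \<subseteq> snd c ` U"
        by (auto simp: in_chart_apply c')
    qed (use sub f in \<open>auto simp: smooth_on_def\<close>)
  qed
  then show "smooth_on (in_chart c' f) (snd c' ` (fst c' \<inter> U))"
    by (simp add: smooth_on_def)
qed

lemma smooth_atD:
  assumes "smooth_at A p f" "c \<in> charts_at A p"
  obtains U where "open U" "p \<in> U" "U \<subseteq> fst c" "open (snd c ` U)" "smooth_on (in_chart c f) (snd c ` U)"
proof -
  obtain U where U: "open U" "p \<in> U" "smooth_fun_on A U f"
    using assms by (auto simp: smooth_at_def)
  note c = charts_atD[OF assms(2)]
  show thesis
    by (rule that[of "fst c \<inter> U"])
      (use U c open_chart[OF c(1)] open_chart_image[OF c(1) U(1)] in \<open>auto simp: smooth_fun_on_def\<close>)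
qed

lemma smooth_fun_on_iff:
  assumes "open U"
  shows "smooth_fun_on A U f \<longleftrightarrow> (\<forall>p\<in>U. smooth_at A p f)"
proof
  show "smooth_fun_on A U f \<Longrightarrow> \<forall>p\<in>U. smooth_at A p f"
    using assms by (auto simp: smooth_at_def)
  assume "\<forall>p\<in>U. smooth_at A p f"
  then obtain W where W: "\<And>p. p \<in> U \<Longrightarrow> open (W p) \<and> p \<in> W p \<and> smooth_fun_on A (W p) f"
    unfolding smooth_at_def by metis
  show "smooth_fun_on A U f"
    unfolding smooth_fun_on_def smooth_on_def
  proof (intro ballI allI)
    fix c k assume c: "c \<in> A"
    have eq: "snd c ` (fst c \<inter> U) = (\<Union>p\<in>U. snd c ` (fst c \<inter> (U \<inter> W p)))"
      using W by auto
    show "Ck_on k (in_chart c f) (snd c ` (fst c \<inter> U))"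
      unfolding eq
    proof (rule Ck_on_Union)
      fix S assume "S \<in> (\<lambda>p. snd c ` (fst c \<inter> (U \<inter> W p))) ` U"
      then obtain p where p: "p \<in> U" "S = snd c ` (fst c \<inter> (U \<inter> W p))" by blast
      show "open S" unfolding p(2) using W[OF p(1)] assms c by (intro open_chart_image) auto
      have "Ck_on k (in_chart c f) (snd c ` (fst c \<inter> W p))"
        using W[OF p(1)] c by (auto simp: smooth_fun_on_def smooth_on_def)
      then show "Ck_on k (in_chart c f) S"
        by (rule Ck_on_subset) (auto simp: p(2))
    qed
  qed
qed

lemma smooth_at_cong:
  assumes "\<forall>\<^sub>F q in nhds p. f q = g q" "smooth_at A p f"
  shows "smooth_at A p g"
proof -
  obtain c where c: "c \<in> charts_at A p" using ex_chart by blast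
  obtain U where U: "open U" "p \<in> U" "U \<subseteq> fst c" "open (snd c ` U)" "smooth_on (in_chart c f) (snd c ` U)"
    by (rule smooth_atD[OF assms(2) c])
  obtain W where W: "open W" "p \<in> W" "\<And>q. q \<in> W \<Longrightarrow> f q = g q"
    using assms(1) unfolding eventually_nhds by blast
  have o: "open (snd c ` (U \<inter> W))"
    by (rule open_subchart_image[OF charts_atD(1)[OF c]]) (use U W in auto)
  show ?thesis
  proof (rule smooth_at_chartI[OF c, of "U \<inter> W"])
    have f: "Ck_on k (in_chart c f) (snd c ` (U \<inter> W))" for k
      by (rule Ck_on_subset[of _ _ "snd c ` U"]) (use U(5) in \<open>auto simp: smooth_on_def\<close>)
    have "Ck_on k (in_chart c g) (snd c ` (U \<inter> W))" for k
      by (rule Ck_on_cong[OF o _ f])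
        (use U W in \<open>auto simp: in_chart_apply[OF charts_atD(1)[OF c]] subset_iff\<close>)
    then show "smooth_on (in_chart c g) (snd c ` (U \<inter> W))" by (simp add: smooth_on_def)
  qed (use U W in auto)
qed

lemma eventually_smooth_at: "smooth_at A p f \<Longrightarrow> \<forall>\<^sub>F q in nhds p. smooth_at A q f"
  unfolding eventually_nhds smooth_at_def by blast

text \<open>Transfers the closure properties of \<open>Ck_on\<close> to germs once for all binary
  operations; unary ones enter with a dummy second argument.\<close>

lemma smooth_at_lift2:
  assumes f: "smooth_at A p f" and g: "smooth_at A p g"
    and op: "\<And>(S::(real^'m) set) k F G. open S \<Longrightarrow> Ck_on k F S \<Longrightarrow> Ck_on k G S \<Longrightarrow> Ck_on k (\<lambda>x. b (F x) (G x)) S"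
  shows "smooth_at A p (\<lambda>q. b (f q) (g q))"
proof -
  obtain U where U: "open U" "p \<in> U" "smooth_fun_on A U f"
    using f by (auto simp: smooth_at_def)
  obtain W where W: "open W" "p \<in> W" "smooth_fun_on A W g"
    using g by (auto simp: smooth_at_def)
  have eq: "in_chart c (\<lambda>q. b (f q) (g q)) = (\<lambda>x. b (in_chart c f x) (in_chart c g x))" for c :: "('a, 'm) chart"
    by (simp add: in_chart_def o_def)
  have "Ck_on k (in_chart c (\<lambda>q. b (f q) (g q))) (snd c ` (fst c \<inter> (U \<inter> W)))" if "c \<in> A" for c k
    unfolding eq
  proof (rule op)
    show "open (snd c ` (fst c \<inter> (U \<inter> W)))" using that U W by (intro open_chart_image) auto
    show "Ck_on k (in_chart c f) (snd c ` (fst c \<inter> (U \<inter> W)))"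
      by (rule Ck_on_subset[of _ _ "snd c ` (fst c \<inter> U)"])
        (use U(3) that in \<open>auto simp: smooth_fun_on_def smooth_on_def\<close>)
    show "Ck_on k (in_chart c g) (snd c ` (fst c \<inter> (U \<inter> W)))"
      by (rule Ck_on_subset[of _ _ "snd c ` (fst c \<inter> W)"])
        (use W(3) that in \<open>auto simp: smooth_fun_on_def smooth_on_def\<close>)
  qed
  then show ?thesis
    unfolding smooth_at_def using U W
    by (intro exI[of _ "U \<inter> W"]) (auto simp: smooth_fun_on_def smooth_on_def)
qed

lemma smooth_at_const: "smooth_at A p (\<lambda>q. a)"
  unfolding smooth_at_def
  by (rule exI[of _ UNIV]) (simp add: smooth_fun_on_def smooth_on_def in_chart_def o_def Ck_on_const)

lemma smooth_at_add: "smooth_at A p f \<Longrightarrow> smooth_at A p g \<Longrightarrow> smooth_at A p (\<lambda>q. f q + g q)"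
  by (rule smooth_at_lift2) (auto intro: Ck_on_add)

lemma smooth_at_bilinear:
  "bounded_bilinear b \<Longrightarrow> smooth_at A p f \<Longrightarrow> smooth_at A p g \<Longrightarrow> smooth_at A p (\<lambda>q. b (f q) (g q))"
  by (rule smooth_at_lift2) (auto intro: Ck_on_bounded_bilinear)

lemma smooth_at_linear:
  "bounded_linear h \<Longrightarrow> smooth_at A p f \<Longrightarrow> smooth_at A p (\<lambda>q. h (f q))"
  by (rule smooth_at_lift2[of p f f "\<lambda>u _. h u"]) (auto intro: Ck_on_bounded_linear)

lemma smooth_at_mult:
  fixes f :: "'a \<Rightarrow> 'b::real_normed_algebra"
  shows "smooth_at A p f \<Longrightarrow> smooth_at A p g \<Longrightarrow> smooth_at A p (\<lambda>q. f q * g q)"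
  by (rule smooth_at_bilinear[OF bounded_bilinear_mult])

lemma smooth_at_uminus: "smooth_at A p f \<Longrightarrow> smooth_at A p (\<lambda>q. - f q)"
  by (rule smooth_at_linear[OF bounded_linear_minus[OF bounded_linear_ident]])

lemma smooth_at_diff: "smooth_at A p f \<Longrightarrow> smooth_at A p g \<Longrightarrow> smooth_at A p (\<lambda>q. f q - g q)"
  using smooth_at_add[of p f "\<lambda>q. - g q"] smooth_at_uminus[of p g] by simp

lemma smooth_at_sum:
  "(\<And>i. i \<in> I \<Longrightarrow> smooth_at A p (f i)) \<Longrightarrow> smooth_at A p (\<lambda>q. \<Sum>i\<in>I. f i q)"
  by (induction I rule: infinite_finite_induct) (auto intro: smooth_at_const smooth_at_add)

lemma smooth_at_prod:
  fixes f :: "'i \<Rightarrow> 'a \<Rightarrow> 'b::real_normed_field"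
  shows "(\<And>i. i \<in> I \<Longrightarrow> smooth_at A p (f i)) \<Longrightarrow> smooth_at A p (\<lambda>q. \<Prod>i\<in>I. f i q)"
  by (induction I rule: infinite_finite_induct) (auto intro: smooth_at_const smooth_at_mult)

text \<open>Only \<open>f p \<noteq> 0\<close> is known, so continuity first has to provide the
  neighbourhood \<open>W\<close> on which \<open>f\<close> has no zero.\<close>

lemma smooth_at_inverse:
  fixes f :: "'a \<Rightarrow> 'b::real_normed_field"
  assumes "smooth_at A p f" "f p \<noteq> 0"
  shows "smooth_at A p (\<lambda>q. inverse (f q))"
proof -
  obtain c where c: "c \<in> charts_at A p" using ex_chart by blast
  note cA = charts_atD(1)[OF c]
  obtain U where U: "open U" "p \<in> U" "U \<subseteq> fst c" "open (snd c ` U)" "smooth_on (in_chart c f) (snd c ` U)"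
    by (rule smooth_atD[OF assms(1) c])
  have "continuous_on U (in_chart c f \<circ> snd c)"
    using U(5) continuous_on_subset[OF chart_continuous[OF cA] U(3)]
    by (intro continuous_on_compose) (auto simp: smooth_on_def intro: Ck_on.simps(1)[THEN iffD1])
  then have "continuous_on U f"
    using U(3) by (auto simp: in_chart_apply[OF cA] subset_iff cong: continuous_on_cong)
  then have oW: "open (U \<inter> f -` (- {0}))"
    using U(1) by (intro continuous_open_preimage) auto
  define W where "W = U \<inter> f -` (- {0})"
  have oW': "open (snd c ` W)"
    by (rule open_subchart_image[OF cA]) (use oW U in \<open>auto simp: W_def\<close>)
  have "smooth_on (in_chart c (\<lambda>q. inverse (f q))) (snd c ` W)"
    unfolding smooth_on_def
  proof
    fix k
    have "Ck_on k (in_chart c f) (snd c ` W)"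
      by (rule Ck_on_subset[of _ _ "snd c ` U"]) (use U(5) in \<open>auto simp: smooth_on_def W_def\<close>)
    then have "Ck_on k (\<lambda>x. inverse (in_chart c f x)) (snd c ` W)"
      by (intro Ck_on_inverse[OF oW']) (use U(3) in \<open>auto simp: W_def in_chart_apply[OF cA] subset_iff\<close>)
    then show "Ck_on k (in_chart c (\<lambda>q. inverse (f q))) (snd c ` W)"
      by (simp add: in_chart_def o_def)
  qed
  then show ?thesis
    by (intro smooth_at_chartI[OF c, of W]) (use U assms oW in \<open>auto simp: W_def\<close>)
qed

lemma smooth_at_divide:
  fixes f :: "'a \<Rightarrow> 'b::real_normed_field"
  shows "smooth_at A p f \<Longrightarrow> smooth_at A p g \<Longrightarrow> g p \<noteq> 0 \<Longrightarrow> smooth_at A p (\<lambda>q. f q / g q)"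
  unfolding divide_inverse by (intro smooth_at_mult smooth_at_inverse)

section \<open>Partial derivatives in a chart\<close>

lemma in_chart_has_derivative:
  assumes "smooth_at A p f" "c \<in> charts_at A p"
  shows "(in_chart c f has_derivative frechet_derivative (in_chart c f) (at (snd c p))) (at (snd c p))"
proof -
  obtain U where "p \<in> U" "smooth_on (in_chart c f) (snd c ` U)"
    by (rule smooth_atD[OF assms])
  then show ?thesis by (intro smooth_on_has_derivative) auto
qed

lemma pd_eqI:
  assumes "c \<in> charts_at A p" "(in_chart c f has_derivative f') (at (snd c p))"
  shows "pd c i f p = f' (axis i 1)"
  unfolding pd_def using frechet_derivative_at[OF assms(2)] by simp

lemma has_derivative_in_chart_cong:
  assumes "\<forall>\<^sub>F q in nhds p. f q = g q" "c \<in> charts_at A p"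
    and "(in_chart c f has_derivative f') (at (snd c p))"
  shows "(in_chart c g has_derivative f') (at (snd c p))"
proof -
  obtain W where W: "open W" "p \<in> W" "\<And>q. q \<in> W \<Longrightarrow> f q = g q"
    using assms(1) unfolding eventually_nhds by blast
  note c = charts_atD[OF assms(2)]
  show ?thesis
    by (rule has_derivative_transform_within_open[OF assms(3) open_chart_image[OF c(1) W(1)]])
      (use W c in \<open>auto simp: in_chart_apply\<close>)
qed

lemma pd_cong:
  assumes "\<forall>\<^sub>F q in nhds p. f q = g q" "c \<in> charts_at A p"
  shows "pd c i f p = pd c i g p"
proof -
  have "\<forall>\<^sub>F q in nhds p. g q = f q" using assms(1) by (simp add: eq_commute)
  then have "(in_chart c f has_derivative f') (at (snd c p)) \<longleftrightarrow>
      (in_chart c g has_derivative f') (at (snd c p))" for f'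
    using has_derivative_in_chart_cong assms by blast
  then show ?thesis by (simp add: pd_def frechet_derivative_def)
qed

lemma pd_const: "pd c i (\<lambda>q. a) p = 0"
  by (simp add: pd_def in_chart_def o_def)

lemma pd_add:
  assumes "smooth_at A p f" "smooth_at A p g" "c \<in> charts_at A p"
  shows "pd c i (\<lambda>q. f q + g q) p = pd c i f p + pd c i g p"
  using pd_eqI[OF assms(3), of "\<lambda>q. f q + g q"]
    has_derivative_add[OF in_chart_has_derivative[OF assms(1,3)] in_chart_has_derivative[OF assms(2,3)]]
  by (simp add: in_chart_def o_def pd_def)

lemma pd_linear:
  assumes "bounded_linear h" "smooth_at A p f" "c \<in> charts_at A p"
  shows "pd c i (\<lambda>q. h (f q)) p = h (pd c i f p)"
  using pd_eqI[OF assms(3), of "\<lambda>q. h (f q)"]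
    bounded_linear.has_derivative[OF assms(1) in_chart_has_derivative[OF assms(2,3)]]
  by (simp add: in_chart_def o_def pd_def)

lemma pd_mult:
  fixes f :: "'a \<Rightarrow> 'b::real_normed_algebra"
  assumes "smooth_at A p f" "smooth_at A p g" "c \<in> charts_at A p"
  shows "pd c i (\<lambda>q. f q * g q) p = f p * pd c i g p + pd c i f p * g p"
  using pd_eqI[OF assms(3), of "\<lambda>q. f q * g q"]
    has_derivative_mult[OF in_chart_has_derivative[OF assms(1,3)] in_chart_has_derivative[OF assms(2,3)]]
    inv_chart[OF charts_atD[OF assms(3)]]
  by (simp add: in_chart_def o_def pd_def)

lemma pd_uminus:
  "smooth_at A p f \<Longrightarrow> c \<in> charts_at A p \<Longrightarrow> pd c i (\<lambda>q. - f q) p = - pd c i f p"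
  by (rule pd_linear[OF bounded_linear_minus[OF bounded_linear_ident]])

lemma pd_diff:
  assumes "smooth_at A p f" "smooth_at A p g" "c \<in> charts_at A p"
  shows "pd c i (\<lambda>q. f q - g q) p = pd c i f p - pd c i g p"
  using pd_add[OF assms(1) smooth_at_uminus[OF assms(2)] assms(3)] pd_uminus[OF assms(2,3)] by simp

lemma pd_sum:
  assumes "\<And>k. k \<in> I \<Longrightarrow> smooth_at A p (f k)" "c \<in> charts_at A p"
  shows "pd c i (\<lambda>q. \<Sum>k\<in>I. f k q) p = (\<Sum>k\<in>I. pd c i (f k) p)"
  using assms(1)
  by (induction I rule: infinite_finite_induct)
    (auto simp: pd_const pd_add smooth_at_sum assms(2))

lemma smooth_at_pd:
  assumes "smooth_at A p f" "c \<in> charts_at A p"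
  shows "smooth_at A p (pd c i f)"
proof -
  note c = charts_atD(1)[OF assms(2)]
  obtain U where U: "open U" "p \<in> U" "U \<subseteq> fst c" "open (snd c ` U)" "smooth_on (in_chart c f) (snd c ` U)"
    by (rule smooth_atD[OF assms])
  have "smooth_on (in_chart c (pd c i f)) (snd c ` U)"
    unfolding smooth_on_def
  proof
    fix k
    have "Ck_on k (\<lambda>x. frechet_derivative (in_chart c f) (at x) (axis i 1)) (snd c ` U)"
      using smooth_on_frechet_derivative[OF U(5)] by (simp add: smooth_on_def)
    then show "Ck_on k (in_chart c (pd c i f)) (snd c ` U)"
      by (rule Ck_on_cong[OF U(4), rotated]) (use U(3) in \<open>auto simp: in_chart_apply[OF c] pd_def subset_iff\<close>)
  qed
  then show ?thesis by (intro smooth_at_chartI[OF assms(2) U(1-3)])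
qed

lemma pd_commute_real:
  fixes f :: "'a \<Rightarrow> real"
  assumes "smooth_at A p f" "c \<in> charts_at A p"
  shows "pd c i (pd c j f) p = pd c j (pd c i f) p"
proof -
  note c = charts_atD(1)[OF assms(2)]
  obtain U where U: "open U" "p \<in> U" "U \<subseteq> fst c" "open (snd c ` U)" "smooth_on (in_chart c f) (snd c ` U)"
    by (rule smooth_atD[OF assms])
  let ?D = "\<lambda>i x. frechet_derivative (in_chart c f) (at x) (axis i 1)"
  have pd2: "pd c i (pd c j f) p = frechet_derivative (?D j) (at (snd c p)) (axis i 1)" for i j
  proof (rule pd_eqI[OF assms(2)])
    have "((?D j) has_derivative frechet_derivative (?D j) (at (snd c p))) (at (snd c p))"
      using smooth_on_has_derivative[OF smooth_on_frechet_derivative[OF U(5)]] U(2) by blast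
    then show "(in_chart c (pd c j f) has_derivative frechet_derivative (?D j) (at (snd c p))) (at (snd c p))"
      by (rule has_derivative_transform_within_open[OF _ U(4)])
        (use U in \<open>auto simp: in_chart_apply[OF c] pd_def subset_iff\<close>)
  qed
  show ?thesis
    unfolding pd2 by (rule frechet_derivative_commute_real[OF U(4) _ U(5)]) (use U(2) in blast)
qed

text \<open>The mean value argument concerns real functions. \<open>Re\<close> and \<open>Im\<close>
  are bounded linear, hence commute with \<open>pd\<close>, and together they determine the complex
  value.\<close>

lemma pd_commute:
  fixes f :: "'a \<Rightarrow> complex"
  assumes "smooth_at A p f" "c \<in> charts_at A p"
  shows "pd c i (pd c j f) p = pd c j (pd c i f) p"
proof -
  have *: "pd c i (pd c j (\<lambda>q. h (f q))) p = h (pd c i (pd c j f) p)" if "bounded_linear h"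
    for h :: "complex \<Rightarrow> real" and i j
  proof -
    have "\<forall>\<^sub>F q in nhds p. pd c j (\<lambda>q. h (f q)) q = h (pd c j f q)"
      using eventually_smooth_at[OF assms(1)] eventually_charts_at[OF assms(2)]
      by eventually_elim (rule pd_linear[OF that])
    then have "pd c i (pd c j (\<lambda>q. h (f q))) p = pd c i (\<lambda>q. h (pd c j f q)) p"
      by (rule pd_cong[OF _ assms(2)])
    also have "\<dots> = h (pd c i (pd c j f) p)"
      by (rule pd_linear[OF that smooth_at_pd[OF assms] assms(2)])
    finally show ?thesis .
  qed
  have "h (pd c i (pd c j f) p) = h (pd c j (pd c i f) p)" if "bounded_linear h" for h :: "complex \<Rightarrow> real"
    using pd_commute_real[OF smooth_at_linear[OF that assms(1)] assms(2), of i j] *[OF that] by simp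
  from this[OF bounded_linear_Re] this[OF bounded_linear_Im] show ?thesis
    by (rule complex_eqI)
qed

lemma smooth_at_chart_map: "c \<in> charts_at A p \<Longrightarrow> smooth_at A p (snd c)"
  unfolding smooth_at_def
  by (rule exI[of _ "fst c"]) (auto simp: charts_at_def open_chart smooth_fun_on_def smooth_transition)

lemma smooth_at_coord: "c \<in> charts_at A p \<Longrightarrow> smooth_at A p (coord c i)"
  unfolding coord_def[abs_def]
  by (intro smooth_at_linear[OF bounded_linear_of_real] smooth_at_linear[OF bounded_linear_vec_nth]
      smooth_at_chart_map)

lemma pd_coord:
  "c \<in> charts_at A p \<Longrightarrow> c' \<in> charts_at A p \<Longrightarrow>
    pd c j (coord c' i) p = of_real (pd c j (\<lambda>q. snd c' q $ i) p)"
  unfolding coord_def[abs_def]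
  by (intro pd_linear[OF bounded_linear_of_real] smooth_at_linear[OF bounded_linear_vec_nth]
      smooth_at_chart_map)

lemma pd_chain:
  fixes f :: "'a \<Rightarrow> complex"
  assumes f: "smooth_at A p f" and c: "c \<in> charts_at A p" and c': "c' \<in> charts_at A p"
  shows "pd c j f p = (\<Sum>i\<in>UNIV. pd c j (coord c' i) p * pd c' i f p)"
proof -
  let ?T = "frechet_derivative (in_chart c (snd c')) (at (snd c p))"
  let ?F = "frechet_derivative (in_chart c' f) (at (snd c' p))"
  note cA = charts_atD[OF c] and cA' = charts_atD[OF c']
  have F: "(in_chart c' f has_derivative ?F) (at (snd c' p))"
    by (rule in_chart_has_derivative[OF f c'])
  have T: "(in_chart c (snd c') has_derivative ?T) (at (snd c p))"
    by (rule in_chart_has_derivative[OF smooth_at_chart_map[OF c'] c])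
  have "(in_chart c' f \<circ> in_chart c (snd c') has_derivative ?F \<circ> ?T) (at (snd c p))"
    using diff_chain_at[OF T, of "in_chart c' f" ?F] F by (simp add: in_chart_apply cA)
  then have "(in_chart c f has_derivative ?F \<circ> ?T) (at (snd c p))"
    by (rule has_derivative_transform_within_open[OF _ open_chart_image[OF cA(1) open_chart[OF cA'(1)]]])
      (use cA cA' in \<open>auto simp: in_chart_apply\<close>)
  then have "pd c j f p = ?F (?T (axis j 1))"
    using pd_eqI[OF c] by fastforce
  also have "\<dots> = ?F (\<Sum>i\<in>UNIV. (?T (axis j 1) $ i) *\<^sub>R axis i 1)"
    by (simp add: basis_expansion flip: scalar_mult_eq_scaleR)
  also have "\<dots> = (\<Sum>i\<in>UNIV. (?T (axis j 1) $ i) *\<^sub>R ?F (axis i 1))"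
    using has_derivative_linear[OF F] by (simp add: linear_sum linear_cmul)
  also have "\<dots> = (\<Sum>i\<in>UNIV. pd c j (coord c' i) p * pd c' i f p)"
    unfolding pd_coord[OF c c'] pd_linear[OF bounded_linear_vec_nth smooth_at_chart_map[OF c'] c]
    by (simp add: scaleR_conv_of_real pd_def)
  finally show ?thesis .
qed

end

section \<open>Nondegeneracy of contact forms\<close>

definition multilinear_form :: "nat \<Rightarrow> ((nat \<Rightarrow> 'v::real_vector) \<Rightarrow> real) \<Rightarrow> bool" where
  "multilinear_form k \<omega> \<longleftrightarrow> (\<forall>v w. (\<forall>i<k. v i = w i) \<longrightarrow> \<omega> v = \<omega> w) \<and>
     (\<forall>v. \<forall>i<k. linear (\<lambda>x. \<omega> (v(i := x))))"

text \<open>For \<open>K = ker \<alpha>\<close> and \<open>z\<close> in the kernel of \<open>d\<alpha>\<close> on \<open>K\<close>, this property passes from \<open>d\<alpha>\<close> to its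
  powers.\<close>

definition kills :: "nat \<Rightarrow> ((nat \<Rightarrow> 'v) \<Rightarrow> real) \<Rightarrow> 'v set \<Rightarrow> 'v \<Rightarrow> bool" where
  "kills k \<omega> K z \<longleftrightarrow> (\<forall>v. (\<forall>i<k. v i \<in> K) \<longrightarrow> (\<exists>i<k. v i = z) \<longrightarrow> \<omega> v = 0)"

lemma multilinear_form_wedge:
  fixes \<omega> \<eta> :: "(nat \<Rightarrow> 'v::real_vector) \<Rightarrow> real"
  assumes "multilinear_form k \<omega>" "multilinear_form l \<eta>"
  shows "multilinear_form (k + l) (wedge k l \<omega> \<eta>)"
proof -
  have loc\<omega>: "\<omega> v = \<omega> w" if "\<And>i. i < k \<Longrightarrow> v i = w i" for v w
    using assms(1) that by (auto simp: multilinear_form_def)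
  have loc\<eta>: "\<eta> v = \<eta> w" if "\<And>i. i < l \<Longrightarrow> v i = w i" for v w
    using assms(2) that by (auto simp: multilinear_form_def)
  have lin\<omega>: "linear (\<lambda>x. \<omega> (v(i := x)))" if "i < k" for v i
    using assms(1) that by (auto simp: multilinear_form_def)
  have lin\<eta>: "linear (\<lambda>x. \<eta> (v(i := x)))" if "i < l" for v i
    using assms(2) that by (auto simp: multilinear_form_def)
  have 1: "wedge k l \<omega> \<eta> v = wedge k l \<omega> \<eta> w" if vw: "\<forall>i<k + l. v i = w i" for v w
  proof -
    have "of_int (sign \<sigma>) * \<omega> (\<lambda>i. v (\<sigma> i)) * \<eta> (\<lambda>i. v (\<sigma> (k + i))) =
        of_int (sign \<sigma>) * \<omega> (\<lambda>i. w (\<sigma> i)) * \<eta> (\<lambda>i. w (\<sigma> (k + i)))"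
      if "\<sigma> permutes {..<k + l}" for \<sigma>
    proof -
      have "\<sigma> i < k + l" if "i < k + l" for i
        using permutes_in_image[OF \<open>\<sigma> permutes _\<close>, of i] that by simp
      then have "\<omega> (\<lambda>i. v (\<sigma> i)) = \<omega> (\<lambda>i. w (\<sigma> i))"
        "\<eta> (\<lambda>i. v (\<sigma> (k + i))) = \<eta> (\<lambda>i. w (\<sigma> (k + i)))"
        using vw by (auto intro!: loc\<omega> loc\<eta>)
      then show ?thesis by simp
    qed
    then show ?thesis
      unfolding wedge_def by (intro arg_cong2[of _ _ _ _ "(/)"] sum.cong) auto
  qed
  have 2: "linear (\<lambda>x. wedge k l \<omega> \<eta> (v(j := x)))" if j: "j < k + l" for v j
  proof -
    define T where "T \<sigma> x = of_int (sign \<sigma>) * \<omega> (\<lambda>i. (v(j := x)) (\<sigma> i)) * \<eta> (\<lambda>i. (v(j := x)) (\<sigma> (k + i)))"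
      for \<sigma> x
    have T: "linear (T \<sigma>)" if \<sigma>: "\<sigma> permutes {..<k + l}" for \<sigma>
    proof -
      \<comment> \<open>The position at which \<sigma> inserts argument \<open>j\<close>: it belongs
        to \<omega> if \<open>m < k\<close>, and is position \<open>m - k\<close> of \<eta>
        otherwise. The other factor does not depend on \<open>x\<close>.\<close>
      define m where "m = inv \<sigma> j"
      have m: "\<sigma> i = j \<longleftrightarrow> i = m" for i
        using permutes_inverses[OF \<sigma>] unfolding m_def by metis
      have "m < k + l"
        using permutes_in_image[OF permutes_inv[OF \<sigma>], of j] j by (simp add: m_def)
      show ?thesis
      proof (cases "m < k")
        case True
        have "(\<lambda>i. (v(j := x)) (\<sigma> i)) = (\<lambda>i. v (\<sigma> i))(m := x)"
          "(\<lambda>i. (v(j := x)) (\<sigma> (k + i))) = (\<lambda>i. v (\<sigma> (k + i)))" for x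
          using True m by (auto simp: fun_eq_iff)
        then show ?thesis
          using lin\<omega>[OF True, of "\<lambda>i. v (\<sigma> i)"] unfolding T_def linear_iff by (simp add: algebra_simps)
      next
        case False
        then have mk: "m - k < l" using \<open>m < k + l\<close> by simp
        have e: "(\<lambda>i. (v(j := x)) (\<sigma> (k + i))) = (\<lambda>i. v (\<sigma> (k + i)))(m - k := x)" for x
          using False m by (auto simp: fun_eq_iff)
        have "\<omega> (\<lambda>i. (v(j := x)) (\<sigma> i)) = \<omega> (\<lambda>i. v (\<sigma> i))" for x
          by (rule loc\<omega>) (use False m in auto)
        then show ?thesis
          using lin\<eta>[OF mk, of "\<lambda>i. v (\<sigma> (k + i))"] unfolding T_def linear_iff e
          by (simp add: algebra_simps)
      qed
    qed
    have "linear (\<lambda>x. \<Sum>\<sigma> | \<sigma> permutes {..<k + l}. T \<sigma> x)"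
      by (rule linear_compose_sum) (use T in auto)
    then have "linear (\<lambda>x. (\<Sum>\<sigma> | \<sigma> permutes {..<k + l}. T \<sigma> x) / (fact k * fact l))"
      unfolding linear_iff by (simp add: add_divide_distrib)
    then show ?thesis unfolding wedge_def T_def .
  qed
  show ?thesis using 1 2 unfolding multilinear_form_def by blast
qed

text \<open>In every term of the sum over permutations, \<open>z\<close> lands in one of the two
  factors, whose arguments all still lie in \<open>K\<close>.\<close>

lemma kills_wedge:
  assumes "kills k \<omega> K z" "kills l \<eta> K z"
  shows "kills (k + l) (wedge k l \<omega> \<eta>) K z"
  unfolding kills_def
proof (intro allI impI)
  fix v assume v: "\<forall>i<k + l. v i \<in> K" "\<exists>i<k + l. v i = z"
  have "\<omega> (\<lambda>i. v (\<sigma> i)) = 0 \<or> \<eta> (\<lambda>i. v (\<sigma> (k + i))) = 0" if \<sigma>: "\<sigma> permutes {..<k + l}" for \<sigma>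
  proof -
    have im: "\<sigma> i < k + l" if "i < k + l" for i
      using permutes_in_image[OF \<sigma>, of i] that by simp
    obtain j where j: "j < k + l" "v j = z" using v(2) by blast
    define m where "m = inv \<sigma> j"
    have m: "\<sigma> m = j" "m < k + l"
      using permutes_inverses[OF \<sigma>] permutes_in_image[OF permutes_inv[OF \<sigma>], of j] j
      by (auto simp: m_def)
    show ?thesis
    proof (cases "m < k")
      case True
      then have "\<omega> (\<lambda>i. v (\<sigma> i)) = 0"
        using assms(1) v(1) im m j unfolding kills_def by (metis trans_less_add1)
      then show ?thesis ..
    next
      case False
      then have "m - k < l" "v (\<sigma> (k + (m - k))) = z" using m j by auto
      then have "\<eta> (\<lambda>i. v (\<sigma> (k + i))) = 0"
        using assms(2) v(1) im unfolding kills_def by (metis nat_add_left_cancel_less)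
      then show ?thesis ..
    qed
  qed
  then show "wedge k l \<omega> \<eta> v = 0"
    unfolding wedge_def divide_eq_0_iff by (intro disjI1 sum.neutral) auto
qed

text \<open>The induction starts at the constant form 1, for which \<open>kills 0\<close> holds
  vacuously.\<close>

lemma wedge_power2_induct:
  fixes \<omega> :: "(nat \<Rightarrow> 'v::real_vector) \<Rightarrow> real"
  shows multilinear_form_wedge_power2:
      "multilinear_form 2 \<omega> \<Longrightarrow> multilinear_form (2 * n) (wedge_power2 n \<omega>)"
    and kills_wedge_power2: "kills 2 \<omega> K z \<Longrightarrow> kills (2 * n) (wedge_power2 n \<omega>) K z"
proof -
  show "multilinear_form (2 * n) (wedge_power2 n \<omega>)" if "multilinear_form 2 \<omega>"
  proof (induction n)
    case (Suc n)
    then show ?case using multilinear_form_wedge[OF that Suc] by simp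
  qed (simp add: multilinear_form_def)
  show "kills (2 * n) (wedge_power2 n \<omega>) K z" if "kills 2 \<omega> K z"
  proof (induction n)
    case (Suc n)
    then show ?case using kills_wedge[OF that Suc] by simp
  qed (simp add: kills_def)
qed

lemma wedge_permute:
  assumes \<tau>: "\<tau> permutes {..<k + l}"
  shows "wedge k l \<omega> \<eta> (v \<circ> \<tau>) = of_int (sign \<tau>) * wedge k l \<omega> \<eta> v"
proof -
  let ?P = "{\<sigma>. \<sigma> permutes {..<k + l}}"
  define G where "G \<sigma> = \<omega> (\<lambda>i. v (\<sigma> i)) * \<eta> (\<lambda>i. v (\<sigma> (k + i)))" for \<sigma>
  have "(\<Sum>\<sigma>\<in>?P. of_int (sign \<sigma>) * G \<sigma>) = (\<Sum>\<sigma>\<in>?P. of_int (sign (\<tau> \<circ> \<sigma>)) * G (\<tau> \<circ> \<sigma>))"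
    by (rule setum_permutations_compose_left[OF \<tau>])
  also have "\<dots> = (\<Sum>\<sigma>\<in>?P. of_int (sign \<tau>) * (of_int (sign \<sigma>) * G (\<tau> \<circ> \<sigma>)))"
  proof (rule sum.cong)
    fix \<sigma> assume "\<sigma> \<in> ?P"
    then have "sign (\<tau> \<circ> \<sigma>) = sign \<tau> * sign \<sigma>"
      using \<tau> by (intro sign_compose) (auto intro: permutes_imp_permutation[of "{..<k + l}"])
    then show "of_int (sign (\<tau> \<circ> \<sigma>)) * G (\<tau> \<circ> \<sigma>) = of_int (sign \<tau>) * (of_int (sign \<sigma>) * G (\<tau> \<circ> \<sigma>))"
      by simp
  qed simp
  also have "\<dots> = of_int (sign \<tau>) * (\<Sum>\<sigma>\<in>?P. of_int (sign \<sigma>) * G (\<tau> \<circ> \<sigma>))"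
    by (simp add: sum_distrib_left)
  \<comment> \<open>Moves the sign to the other side, its square being 1.\<close>
  finally have "of_int (sign \<tau>) * (\<Sum>\<sigma>\<in>?P. of_int (sign \<sigma>) * G \<sigma>) =
      (\<Sum>\<sigma>\<in>?P. of_int (sign \<sigma>) * G (\<tau> \<circ> \<sigma>))"
    by (simp flip: mult.assoc of_int_mult)
  then show ?thesis
    by (simp add: wedge_def G_def o_def mult.assoc)
qed

text \<open>Exchanging \<open>i\<close> and \<open>j\<close> leaves \<open>v\<close> unchanged but
  reverses the sign of the value.\<close>

lemma wedge_alternating:
  assumes "i < k + l" "j < k + l" "i \<noteq> j" "v i = v j"
  shows "wedge k l \<omega> \<eta> v = 0"
proof -
  have "v \<circ> Transposition.transpose i j = v"
    using assms(4) by (auto simp: fun_eq_iff Transposition.transpose_def)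
  then show ?thesis
    using wedge_permute[OF permutes_swap_id[of i "{..<k + l}" j], of \<omega> \<eta> v] assms
    by (simp add: sign_swap_id)
qed

text \<open>The arguments are released from \<open>B\<close> one at a time: in the induction the
  first \<open>m\<close> are arbitrary, and linearity in position \<open>m\<close> extends the
  vanishing from \<open>B\<close> to its span.\<close>

lemma multilinear_form_zeroI:
  assumes "multilinear_form k \<omega>" "span B = UNIV"
    and B: "\<And>v. (\<And>i. i < k \<Longrightarrow> v i \<in> B) \<Longrightarrow> \<omega> v = 0"
  shows "\<omega> v = 0"
proof -
  have "\<omega> v = 0" if "m \<le> k" "\<And>i. m \<le> i \<Longrightarrow> i < k \<Longrightarrow> v i \<in> B" for m v
    using that
  proof (induction m arbitrary: v)
    case 0
    then show ?case using B by simp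
  next
    case (Suc m)
    have "linear (\<lambda>x. \<omega> (v(m := x)))"
      using assms(1) Suc.prems by (auto simp: multilinear_form_def)
    moreover have "\<omega> (v(m := x)) = 0" if "x \<in> B" for x
      by (rule Suc.IH) (use Suc.prems that in auto)
    moreover have "v m \<in> span B" by (simp add: assms(2))
    ultimately have "\<omega> (v(m := v m)) = 0"
      by (rule linear_eq_0_on_span)
    then show ?case by simp
  qed
  from this[of k] show ?thesis by simp
qed

text \<open>On a basis consisting of \<open>z\<close>, further vectors of \<open>ker a\<close> and one vector \<open>r\<close> outside
  \<open>ker a\<close>, the factor \<open>a\<close> has to absorb \<open>r\<close>, which leaves \<open>z\<close> to the other factor.\<close>

lemma wedge_eq_0_if_kills:
  fixes a z :: "'v::euclidean_space"
  assumes dim: "DIM('v) = k + 1"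
    and \<eta>: "multilinear_form k \<eta>" "kills k \<eta> {w. a \<bullet> w = 0} z"
    and z: "a \<bullet> z = 0" "z \<noteq> 0"
  shows "wedge 1 k (\<lambda>v. a \<bullet> v 0) \<eta> v = 0"
proof (cases "a = 0")
  case True
  then show ?thesis by (simp add: wedge_def)
next
  case False
  let ?K = "{w. a \<bullet> w = 0}"
  have K: "subspace ?K" by (rule subspace_hyperplane)
  have "independent {z}" using z by simp
  then obtain B where B: "{z} \<subseteq> B" "B \<subseteq> ?K" "independent B" "?K \<subseteq> span B"
    using maximal_independent_subset_extend[of "{z}" ?K] z by auto
  have spB: "span B = ?K"
    using B K by (metis span_subspace)
  define r where "r = (1 / (a \<bullet> a)) *\<^sub>R a"
  have r: "a \<bullet> r = 1" using False by (simp add: r_def)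
  have ind: "independent (insert r B)"
    using B(3) spB r by (simp add: independent_insert)
  have sp: "span (insert r B) = UNIV"
  proof -
    have "x \<in> span (insert r B)" for x
    proof -
      have "x - (a \<bullet> x) *\<^sub>R r \<in> span B"
        unfolding spB using r by (simp add: inner_diff_right)
      then show ?thesis unfolding span_insert by blast
    qed
    then show ?thesis by blast
  qed
  have card: "card (insert r B) = 1 + k"
    using basis_card_eq_dim[of "insert r B" UNIV] ind sp dim by simp
  have form1: "multilinear_form 1 (\<lambda>v. a \<bullet> v 0)"
    by (auto simp: multilinear_form_def linear_iff inner_add_right)
  show ?thesis
  proof (rule multilinear_form_zeroI[OF multilinear_form_wedge[OF form1 \<eta>(1)] sp])
    fix v :: "nat \<Rightarrow> 'v" assume v: "\<And>i. i < 1 + k \<Longrightarrow> v i \<in> insert r B"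
    show "wedge 1 k (\<lambda>v. a \<bullet> v 0) \<eta> v = 0"
    \<comment> \<open>A repeated basis vector is handled by alternation. Otherwise \<open>v\<close>
      has as many distinct entries as the basis has elements, so it lists the whole basis and
      \<open>z\<close> occurs.\<close>
    proof (cases "inj_on v {..<1 + k}")
      case False
      then show ?thesis unfolding inj_on_def using wedge_alternating[of _ 1 k _ v] by blast
    next
      case True
      have im: "v ` {..<1 + k} = insert r B"
        by (rule card_subset_eq)
          (use v card card_image[OF True] independent_imp_finite[OF ind] in auto)
      have "a \<bullet> v (\<sigma> 0) = 0 \<or> \<eta> (\<lambda>i. v (\<sigma> (1 + i))) = 0" if \<sigma>: "\<sigma> permutes {..<1 + k}" for \<sigma>
      proof (cases "v (\<sigma> 0) \<in> B")
        case True
        then show ?thesis using B(2) by blast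
      next
        case nB: False
        have s: "\<sigma> i < 1 + k" if "i < 1 + k" for i
          using permutes_in_image[OF \<sigma>, of i] that by simp
        have r0: "v (\<sigma> 0) = r" using v[OF s[of 0]] nB by simp
        have inK: "v (\<sigma> (1 + i)) \<in> ?K" if "i < k" for i
        proof -
          have "\<sigma> (1 + i) \<noteq> \<sigma> 0"
            using permutes_inj[OF \<sigma>] by (auto dest: injD)
          then have "v (\<sigma> (1 + i)) \<noteq> r"
            using inj_onD[OF True, of "\<sigma> (1 + i)" "\<sigma> 0"] s[of "1 + i"] s[of 0] r0 that by auto
          then show ?thesis using v[OF s[of "1 + i"]] that B(2) by auto
        qed
        have "z \<in> v ` {..<1 + k}" using im B(1) by simp
        then obtain j where j: "j < 1 + k" "v j = z" by auto
        define m where "m = inv \<sigma> j"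
        have m: "\<sigma> m = j" "m < 1 + k"
          using permutes_inverses[OF \<sigma>] permutes_in_image[OF permutes_inv[OF \<sigma>], of j] j
          by (auto simp: m_def)
        \<comment> \<open>Position 0 holds \<open>r\<close>, which differs from \<open>z\<close>
          since \<open>a\<close> is 1 on \<open>r\<close> and 0 on \<open>z\<close>.\<close>
        have "m \<noteq> 0" using m(1) j(2) r0 z(1) r by (metis zero_neq_one)
        then obtain i where i: "m = 1 + i" by (metis not0_implies_Suc plus_1_eq_Suc)
        then have "\<eta> (\<lambda>i. v (\<sigma> (1 + i))) = 0"
          using \<eta>(2) inK m j unfolding kills_def by (metis nat_add_left_cancel_less)
        then show ?thesis ..
      qed
      then show ?thesis
        unfolding wedge_def divide_eq_0_iff by (intro disjI1 sum.neutral) auto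
    qed
  qed
qed

section \<open>Nondegeneracy of d\<alpha> on ker \<alpha>\<close>

definition dform ::
  "('a \<Rightarrow> ('a, 'm::finite) chart \<Rightarrow> real^'m) \<Rightarrow> 'a \<Rightarrow> ('a, 'm) chart \<Rightarrow> 'm \<Rightarrow> 'm \<Rightarrow> real" where
  "dform \<alpha> p c i j = pd c i (\<lambda>q. \<alpha> q c $ j) p - pd c j (\<lambda>q. \<alpha> q c $ i) p"

lemma form_at_inner: "form_at \<alpha> p c = (\<lambda>v. \<alpha> p c \<bullet> v 0)"
  by (simp add: form_at_def inner_vec_def fun_eq_iff)

lemma contact_form_nonzero:
  assumes "wedge 1 (2 * n) (form_at \<alpha> p c) \<eta> v \<noteq> 0"
  shows "\<alpha> p c \<noteq> 0"
  using assms by (auto simp: form_at_inner wedge_def)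

text \<open>That i_z d\<alpha> is a multiple of \<alpha> expresses d\<alpha>(z, w) = 0 for all w in
  ker \<alpha> without restricting to the kernel. A nonzero such \<open>z\<close> in ker \<alpha>
  would kill every power of d\<alpha> there, and then the top form would vanish on all
  arguments.\<close>

lemma contact_form_nondegenerate:
  fixes \<alpha> :: "'a \<Rightarrow> ('a, 'm::finite) chart \<Rightarrow> real^'m"
  assumes card: "CARD('m) = 2 * n + 1"
    and nz: "wedge 1 (2 * n) (form_at \<alpha> p c) (wedge_power2 n (ext_deriv_at \<alpha> p c)) v \<noteq> 0"
    and z: "(\<Sum>i\<in>UNIV. \<alpha> p c $ i * z $ i) = 0"
      "\<And>j. (\<Sum>i\<in>UNIV. dform \<alpha> p c i j * z $ i) = f * \<alpha> p c $ j"
  shows "z = 0"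
proof (rule ccontr)
  assume z0: "z \<noteq> 0"
  define a where "a = \<alpha> p c"
  let ?\<Omega> = "ext_deriv_at \<alpha> p c"
  have \<Omega>: "?\<Omega> v = (\<Sum>i\<in>UNIV. \<Sum>j\<in>UNIV. dform \<alpha> p c i j * v 0 $ i * v 1 $ j)" for v
    by (simp add: ext_deriv_at_def dform_def)
  have az: "a \<bullet> z = 0" using z(1) by (simp add: a_def inner_vec_def)
  have \<Omega>z: "(\<Sum>i\<in>UNIV. \<Sum>j\<in>UNIV. dform \<alpha> p c i j * z $ i * w $ j) = f * (a \<bullet> w)" for w :: "real^'m"
  proof -
    have "(\<Sum>i\<in>UNIV. \<Sum>j\<in>UNIV. dform \<alpha> p c i j * z $ i * w $ j)
        = (\<Sum>j\<in>UNIV. (\<Sum>i\<in>UNIV. dform \<alpha> p c i j * z $ i) * w $ j)"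
      by (subst sum.swap) (simp add: sum_distrib_right)
    also have "\<dots> = f * (a \<bullet> w)"
      by (simp add: z(2) a_def inner_vec_def sum_distrib_left mult.assoc)
    finally show ?thesis .
  qed
  have \<Omega>z': "(\<Sum>i\<in>UNIV. \<Sum>j\<in>UNIV. dform \<alpha> p c i j * w $ i * z $ j) = - (f * (a \<bullet> w))" for w
  proof -
    have "(\<Sum>i\<in>UNIV. \<Sum>j\<in>UNIV. dform \<alpha> p c i j * w $ i * z $ j)
        = (\<Sum>j\<in>UNIV. \<Sum>i\<in>UNIV. - (dform \<alpha> p c j i * z $ j * w $ i))"
      by (subst sum.swap) (intro sum.cong refl, simp add: dform_def algebra_simps)
    also have "\<dots> = - (f * (a \<bullet> w))"
      by (simp only: sum_negf \<Omega>z)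
    finally show ?thesis .
  qed
  have "multilinear_form 2 ?\<Omega>"
    unfolding multilinear_form_def
  proof (intro conjI allI impI)
    fix v :: "nat \<Rightarrow> real^'m" and i assume "i < (2::nat)"
    then have "i = 0 \<or> i = 1" by auto
    then show "linear (\<lambda>x. ?\<Omega> (v(i := x)))"
      unfolding linear_iff \<Omega>
      by (auto simp: algebra_simps sum.distrib sum_distrib_left)
  qed (auto simp: \<Omega>)
  then have 1: "multilinear_form (2 * n) (wedge_power2 n ?\<Omega>)"
    by (rule multilinear_form_wedge_power2)
  have "kills 2 ?\<Omega> {w. a \<bullet> w = 0} z"
    unfolding kills_def
  proof (intro allI impI)
    fix v :: "nat \<Rightarrow> real^'m" assume K: "\<forall>i<2. v i \<in> {w. a \<bullet> w = 0}" and "\<exists>i<2. v i = z"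
    then have "v 0 = z \<or> v 1 = z" by (metis One_nat_def less_2_cases)
    then show "?\<Omega> v = 0"
      using K \<Omega>z[of "v 1"] \<Omega>z'[of "v 0"] by (auto simp: \<Omega>)
  qed
  then have 2: "kills (2 * n) (wedge_power2 n ?\<Omega>) {w. a \<bullet> w = 0} z"
    by (rule kills_wedge_power2)
  have "wedge 1 (2 * n) (form_at \<alpha> p c) (wedge_power2 n ?\<Omega>) v = 0"
    unfolding form_at_inner a_def[symmetric]
    by (rule wedge_eq_0_if_kills[OF _ 1 2 az z0]) (simp add: card)
  then show False using nz by simp
qed

section \<open>The Lie algebra of vector fields\<close>

text \<open>The derivation X(f), computed in the chart \<open>c\<close>; by
  \<open>along_chart\<close> the chart is immaterial for tangent \<open>X\<close> and smooth
  \<open>f\<close>.\<close>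

definition along ::
  "('a \<Rightarrow> ('a, 'm::finite) chart \<Rightarrow> complex^'m) \<Rightarrow> ('a, 'm) chart \<Rightarrow> ('a \<Rightarrow> complex) \<Rightarrow> 'a \<Rightarrow> complex" where
  "along X c f p = (\<Sum>j\<in>UNIV. X p c $ j * pd c j f p)"

lemma lie_bracket_nth:
  "lie_bracket X Y p c $ i = along X c (\<lambda>q. Y q c $ i) p - along Y c (\<lambda>q. X q c $ i) p"
  by (simp add: lie_bracket_def along_def sum_subtractf)

lemma vf_scale_nth: "vf_scale a X p c $ i = a * X p c $ i"
  by (simp add: vf_scale_def)

lemma vector_space_vf_scale: "vector_space vf_scale"
  by unfold_locales (auto simp: vf_scale_def fun_eq_iff vec_eq_iff algebra_simps)

lemma bounded_linear_axis: "bounded_linear (axis i :: 'b::real_normed_vector \<Rightarrow> 'b^'m::finite)"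
proof (rule bounded_linear_intro[where K = 1])
  show "norm (axis i x :: 'b^'m) \<le> norm x * 1" for x
    using norm_le_componentwise_cart[of "axis i x :: 'b^'m" "axis i x :: 'b^'m"]
    by (simp add: norm_vec_def L2_set_def axis_def if_distrib[of norm] if_distrib[of "\<lambda>x. x ^ 2"] cong: if_cong)
qed (auto simp: axis_def vec_eq_iff)

context atlas
begin

lemma smooth_at_vec:
  fixes f :: "'a \<Rightarrow> 'b::real_normed_vector^'n"
  shows "smooth_at A p f \<longleftrightarrow> (\<forall>i. smooth_at A p (\<lambda>q. f q $ i))"
proof
  show "smooth_at A p f \<Longrightarrow> \<forall>i. smooth_at A p (\<lambda>q. f q $ i)"
    using smooth_at_linear[OF bounded_linear_vec_nth] by blast
  assume "\<forall>i. smooth_at A p (\<lambda>q. f q $ i)"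
  then have "smooth_at A p (\<lambda>q. \<Sum>i\<in>UNIV. axis i (f q $ i))"
    by (intro smooth_at_sum smooth_at_linear[OF bounded_linear_axis]) auto
  moreover have "(\<Sum>i\<in>UNIV. axis i (f q $ i)) = f q" for q
    by (simp add: vec_eq_iff axis_def)
  ultimately show "smooth_at A p f" by simp
qed

lemma Vect_iff:
  "X \<in> Vect A \<longleftrightarrow> (\<forall>p. X p \<in> tangent_space A p) \<and>
     (\<forall>p. \<forall>c\<in>charts_at A p. \<forall>i. smooth_at A p (\<lambda>q. X q c $ i))"
proof -
  have "smooth_fun_on A (fst c) (\<lambda>p. X p c) \<longleftrightarrow> (\<forall>p\<in>fst c. \<forall>i. smooth_at A p (\<lambda>q. X q c $ i))"
    if "c \<in> A" for c
    using smooth_fun_on_iff[OF open_chart[OF that], of "\<lambda>p. X p c"] by (simp add: smooth_at_vec)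
  then show ?thesis
    unfolding Vect_def charts_at_def by blast
qed

lemma Vect_smooth: "X \<in> Vect A \<Longrightarrow> c \<in> charts_at A p \<Longrightarrow> smooth_at A p (\<lambda>q. X q c $ i)"
  by (simp add: Vect_iff)

lemma Vect_off_chart: "X \<in> Vect A \<Longrightarrow> c \<notin> charts_at A p \<Longrightarrow> X p c = 0"
  unfolding Vect_iff tangent_space_def by blast

lemma Vect_eqI:
  assumes "X \<in> Vect A" "Y \<in> Vect A" "\<And>p c i. c \<in> charts_at A p \<Longrightarrow> X p c $ i = Y p c $ i"
  shows "X = Y"
proof (intro ext)
  fix p c show "X p c = Y p c"
    using assms by (cases "c \<in> charts_at A p") (auto simp: vec_eq_iff Vect_off_chart)
qed

section \<open>Vector fields as derivations\<close>

lemma tangent_space_iff: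
  fixes v :: "('a, 'm) chart \<Rightarrow> complex^'m"
  shows "v \<in> tangent_space A p \<longleftrightarrow> (\<forall>c. c \<notin> charts_at A p \<longrightarrow> v c = 0) \<and>
    (\<forall>c\<in>charts_at A p. \<forall>c'\<in>charts_at A p. \<forall>i. v c' $ i = (\<Sum>j\<in>UNIV. pd c j (coord c' i) p * v c $ j))"
  unfolding tangent_space_def by (simp add: pd_coord)

text \<open>Jacobian entries are derivatives of coordinates, so the transformation law says that the
  components of \<open>X\<close> in \<open>c'\<close> are \<open>X\<close> applied to the
  coordinates of \<open>c'\<close>. In this form it can be checked by calculating with
  derivations.\<close>

lemma tangent_along:
  assumes "X p \<in> tangent_space A p" "c \<in> charts_at A p" "c' \<in> charts_at A p"
  shows "X p c' $ i = along X c (coord c' i) p"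
  using assms by (simp add: tangent_space_iff along_def mult.commute)

lemma along_const: "along X c (\<lambda>q. a) p = 0"
  by (simp add: along_def pd_const)

lemma along_plus_field: "along (X + Y) c f p = along X c f p + along Y c f p"
  by (simp add: along_def distrib_right sum.distrib)

lemma along_scale_field: "along (vf_scale a X) c f p = a * along X c f p"
  by (simp add: along_def vf_scale_nth sum_distrib_left mult.assoc)

lemma along_cong:
  "\<forall>\<^sub>F q in nhds p. f q = g q \<Longrightarrow> c \<in> charts_at A p \<Longrightarrow> along X c f p = along X c g p"
  unfolding along_def by (intro sum.cong refl arg_cong2[of _ _ _ _ "(*)"] pd_cong)

lemma along_add:
  "smooth_at A p f \<Longrightarrow> smooth_at A p g \<Longrightarrow> c \<in> charts_at A p \<Longrightarrow>
    along X c (\<lambda>q. f q + g q) p = along X c f p + along X c g p"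
  by (simp add: along_def pd_add distrib_left sum.distrib)

lemma along_diff:
  "smooth_at A p f \<Longrightarrow> smooth_at A p g \<Longrightarrow> c \<in> charts_at A p \<Longrightarrow>
    along X c (\<lambda>q. f q - g q) p = along X c f p - along X c g p"
  by (simp add: along_def pd_diff right_diff_distrib sum_subtractf)

lemma along_mult:
  "smooth_at A p f \<Longrightarrow> smooth_at A p g \<Longrightarrow> c \<in> charts_at A p \<Longrightarrow>
    along X c (\<lambda>q. f q * g q) p = along X c f p * g p + f p * along X c g p"
  by (simp add: along_def pd_mult distrib_left sum.distrib sum_distrib_left sum_distrib_right mult_ac)

lemma along_cmult:
  "smooth_at A p g \<Longrightarrow> c \<in> charts_at A p \<Longrightarrow> along X c (\<lambda>q. a * g q) p = a * along X c g p"
  by (simp add: along_mult smooth_at_const along_const)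

lemma along_sum:
  assumes "\<And>k. k \<in> I \<Longrightarrow> smooth_at A p (f k)" "c \<in> charts_at A p"
  shows "along X c (\<lambda>q. \<Sum>k\<in>I. f k q) p = (\<Sum>k\<in>I. along X c (f k) p)"
  using assms(1)
  by (induction I rule: infinite_finite_induct)
    (auto simp: along_const along_add smooth_at_sum assms(2))

lemma smooth_at_along:
  assumes "X \<in> Vect A" "smooth_at A p f" "c \<in> charts_at A p"
  shows "smooth_at A p (along X c f)"
  unfolding along_def[abs_def]
  by (intro smooth_at_sum smooth_at_mult Vect_smooth smooth_at_pd assms)

lemma along_chart:
  assumes "X p \<in> tangent_space A p" "smooth_at A p f" "c \<in> charts_at A p" "c' \<in> charts_at A p"
  shows "along X c f p = along X c' f p"
proof -
  have "along X c f p = (\<Sum>j\<in>UNIV. \<Sum>i\<in>UNIV. pd c j (coord c' i) p * X p c $ j * pd c' i f p)"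
    unfolding along_def by (subst pd_chain[OF assms(2-4)]) (simp add: sum_distrib_left mult_ac)
  also have "\<dots> = (\<Sum>i\<in>UNIV. \<Sum>j\<in>UNIV. pd c j (coord c' i) p * X p c $ j * pd c' i f p)"
    by (rule sum.swap)
  also have "\<dots> = along X c' f p"
    unfolding along_def tangent_along[of X, OF assms(1,3,4)] by (simp add: sum_distrib_left sum_distrib_right along_def mult_ac)
  finally show ?thesis .
qed

lemma along_along:
  assumes "Y \<in> Vect A" "smooth_at A p f" "c \<in> charts_at A p"
  shows "along X c (along Y c f) p = (\<Sum>j\<in>UNIV. along X c (\<lambda>q. Y q c $ j) p * pd c j f p)
    + (\<Sum>j\<in>UNIV. \<Sum>k\<in>UNIV. Y p c $ j * X p c $ k * pd c k (pd c j f) p)"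
proof -
  have s: "smooth_at A p (\<lambda>q. Y q c $ j)" "smooth_at A p (pd c j f)" for j
    using assms by (auto intro: Vect_smooth smooth_at_pd)
  have "along X c (along Y c f) p = (\<Sum>j\<in>UNIV. along X c (\<lambda>q. Y q c $ j * pd c j f q) p)"
    unfolding along_def[of Y, abs_def]
    by (rule along_sum) (intro smooth_at_mult s assms)+
  also have "\<dots> = (\<Sum>j\<in>UNIV. along X c (\<lambda>q. Y q c $ j) p * pd c j f p + Y p c $ j * along X c (pd c j f) p)"
    by (intro sum.cong refl along_mult s assms)
  finally show ?thesis
    by (simp add: sum.distrib along_def sum_distrib_left mult.assoc)
qed

text \<open>The second-order parts of X(Y f) and Y(X f) agree since partial derivatives commute; the
  first-order parts give the bracket.\<close>

lemma along_bracket: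
  assumes "X \<in> Vect A" "Y \<in> Vect A" "smooth_at A p f" "c \<in> charts_at A p"
  shows "along (lie_bracket X Y) c f p = along X c (along Y c f) p - along Y c (along X c f) p"
proof -
  have "(\<Sum>j\<in>UNIV. \<Sum>k\<in>UNIV. Y p c $ j * X p c $ k * pd c k (pd c j f) p) =
    (\<Sum>k\<in>UNIV. \<Sum>j\<in>UNIV. Y p c $ j * X p c $ k * pd c k (pd c j f) p)"
    by (rule sum.swap)
  also have "\<dots> = (\<Sum>k\<in>UNIV. \<Sum>j\<in>UNIV. X p c $ k * Y p c $ j * pd c j (pd c k f) p)"
    by (intro sum.cong refl) (simp add: pd_commute[OF assms(3,4)] mult.commute)
  finally show ?thesis
    unfolding along_along[OF assms(2-4)] along_along[OF assms(1,3,4)]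
    by (simp add: along_def[of "lie_bracket X Y"] lie_bracket_nth left_diff_distrib sum_subtractf)
qed

lemma Vect_tangent: "X \<in> Vect A \<Longrightarrow> X p \<in> tangent_space A p"
  by (simp add: Vect_iff)

lemma Vect_along:
  "X \<in> Vect A \<Longrightarrow> c \<in> charts_at A p \<Longrightarrow> c' \<in> charts_at A p \<Longrightarrow> X p c' $ i = along X c (coord c' i) p"
  using tangent_along[of X p c c' i] Vect_tangent[of X p] by blast

lemma VectI:
  assumes "\<And>p c. c \<notin> charts_at A p \<Longrightarrow> X p c = 0"
    and "\<And>p c c' i. c \<in> charts_at A p \<Longrightarrow> c' \<in> charts_at A p \<Longrightarrow> X p c' $ i = along X c (coord c' i) p"
    and "\<And>p c i. c \<in> charts_at A p \<Longrightarrow> smooth_at A p (\<lambda>q. X q c $ i)"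
  shows "X \<in> Vect A"
  unfolding Vect_iff tangent_space_iff
proof (intro conjI allI impI ballI)
  show "X p c' $ i = (\<Sum>j\<in>UNIV. pd c j (coord c' i) p * X p c $ j)"
    if "c \<in> charts_at A p" "c' \<in> charts_at A p" for p c c' i
    unfolding assms(2)[OF that] by (simp add: along_def mult.commute)
qed (use assms(1,3) in auto)

text \<open>With components read as derivatives of coordinates, the transformation law of the
  bracket is \<open>along_bracket\<close> applied to a coordinate of \<open>c'\<close>.\<close>

lemma Vect_bracket:
  assumes X: "X \<in> Vect A" and Y: "Y \<in> Vect A"
  shows "lie_bracket X Y \<in> Vect A"
proof (rule VectI)
  show "lie_bracket X Y p c = 0" if "c \<notin> charts_at A p" for p c
    using Vect_off_chart[OF X that] Vect_off_chart[OF Y that]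
    by (simp add: vec_eq_iff lie_bracket_nth along_def)
  show "lie_bracket X Y p c' $ i = along (lie_bracket X Y) c (coord c' i) p"
    if c: "c \<in> charts_at A p" and c': "c' \<in> charts_at A p" for p c c' i
  proof -
    \<comment> \<open>Near \<open>p\<close> the component of \<open>W\<close> in \<open>c'\<close>
      is the function W(x) for a coordinate x of \<open>c'\<close>; deriving it along
      \<open>Z\<close> may then be done in the chart \<open>c\<close>.\<close>
    have eq: "along Z c' (\<lambda>q. W q c' $ i) p = along Z c (along W c (coord c' i)) p"
      if Z: "Z \<in> Vect A" and W: "W \<in> Vect A" for Z W
    proof -
      have "\<forall>\<^sub>F q in nhds p. W q c' $ i = along W c (coord c' i) q"
        using eventually_charts_at[OF c] eventually_charts_at[OF c']
        by eventually_elim (rule Vect_along[OF W])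
      then have "along Z c (\<lambda>q. W q c' $ i) p = along Z c (along W c (coord c' i)) p"
        by (rule along_cong[OF _ c])
      then show ?thesis
        using along_chart[of Z, OF Vect_tangent[OF Z] Vect_smooth[OF W c'] c c'] by simp
    qed
    show ?thesis
      unfolding lie_bracket_nth[of X Y p c'] eq[OF X Y] eq[OF Y X]
      by (simp add: along_bracket[OF X Y smooth_at_coord[OF c'] c])
  qed
  show "smooth_at A p (\<lambda>q. lie_bracket X Y q c $ i)" if "c \<in> charts_at A p" for p c i
    unfolding lie_bracket_nth using that
    by (intro smooth_at_diff smooth_at_along X Y Vect_smooth)
qed

lemma Vect_plus:
  assumes "X \<in> Vect A" "Y \<in> Vect A"
  shows "X + Y \<in> Vect A"
proof (rule VectI)
  show "(X + Y) p c' $ i = along (X + Y) c (coord c' i) p"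
    if "c \<in> charts_at A p" "c' \<in> charts_at A p" for p c c' i
    using Vect_along[OF assms(1) that] Vect_along[OF assms(2) that]
    by (simp add: along_plus_field)
  show "smooth_at A p (\<lambda>q. (X + Y) q c $ i)" if "c \<in> charts_at A p" for p c i
    using smooth_at_add[OF Vect_smooth Vect_smooth] assms that by simp
qed (simp add: Vect_off_chart assms)

lemma Vect_scale:
  assumes "X \<in> Vect A"
  shows "vf_scale a X \<in> Vect A"
proof (rule VectI)
  show "vf_scale a X p c' $ i = along (vf_scale a X) c (coord c' i) p"
    if "c \<in> charts_at A p" "c' \<in> charts_at A p" for p c c' i
    using Vect_along[OF assms that] by (simp add: along_scale_field vf_scale_nth)
  show "smooth_at A p (\<lambda>q. vf_scale a X q c $ i)" if "c \<in> charts_at A p" for p c i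
    using smooth_at_mult[OF smooth_at_const Vect_smooth] assms that by (simp add: vf_scale_nth)
qed (simp add: Vect_off_chart assms vf_scale_def)

lemma Vect_zero: "0 \<in> Vect A"
  by (rule VectI) (auto simp: along_def smooth_at_const)

lemma Vect_minus:
  assumes "X \<in> Vect A" "Y \<in> Vect A"
  shows "X - Y \<in> Vect A"
proof -
  have "X - Y = X + vf_scale (-1) Y" by (simp add: vf_scale_def fun_eq_iff vec_eq_iff)
  then show ?thesis using assms by (simp only: Vect_plus Vect_scale)
qed

lemma bracket_add_left:
  assumes "X \<in> Vect A" "Y \<in> Vect A" "Z \<in> Vect A"
  shows "lie_bracket (X + Y) Z = lie_bracket X Z + lie_bracket Y Z"
  by (rule Vect_eqI)
    (auto intro: Vect_bracket Vect_plus assms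
      simp: lie_bracket_nth along_plus_field along_add Vect_smooth assms)

lemma bracket_scale_left:
  assumes "X \<in> Vect A" "Y \<in> Vect A"
  shows "lie_bracket (vf_scale a X) Y = vf_scale a (lie_bracket X Y)"
  by (rule Vect_eqI)
    (auto intro: Vect_bracket Vect_scale assms
      simp: lie_bracket_nth vf_scale_nth along_scale_field along_cmult Vect_smooth assms right_diff_distrib)

lemma bracket_anti: "lie_bracket X Y = - lie_bracket Y X"
  by (simp add: fun_eq_iff vec_eq_iff lie_bracket_nth)

lemma bracket_add_right:
  assumes "X \<in> Vect A" "Y \<in> Vect A" "Z \<in> Vect A"
  shows "lie_bracket X (Y + Z) = lie_bracket X Y + lie_bracket X Z"
  using bracket_add_left[OF assms(2,3,1)] bracket_anti[of X] by simp

lemma bracket_scale_right: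
  assumes "X \<in> Vect A" "Y \<in> Vect A"
  shows "lie_bracket X (vf_scale a Y) = vf_scale a (lie_bracket X Y)"
  by (rule Vect_eqI)
    (auto intro: Vect_bracket Vect_scale assms
      simp: lie_bracket_nth vf_scale_nth along_scale_field along_cmult Vect_smooth assms right_diff_distrib)

text \<open>Each double bracket contributes four iterated derivatives of component functions, and
  the twelve terms cancel in pairs.\<close>

lemma bracket_jacobi:
  assumes X: "X \<in> Vect A" and Y: "Y \<in> Vect A" and Z: "Z \<in> Vect A"
  shows "lie_bracket X (lie_bracket Y Z) + lie_bracket Y (lie_bracket Z X)
    + lie_bracket Z (lie_bracket X Y) = 0"
proof (rule Vect_eqI)
  fix p c i assume c: "c \<in> charts_at A p"
  have outer: "lie_bracket U (lie_bracket V W) p c $ i =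
    along U c (along V c (\<lambda>q. W q c $ i)) p - along U c (along W c (\<lambda>q. V q c $ i)) p
    - (along V c (along W c (\<lambda>q. U q c $ i)) p - along W c (along V c (\<lambda>q. U q c $ i)) p)"
    if "U \<in> Vect A" "V \<in> Vect A" "W \<in> Vect A" for U V W
    unfolding lie_bracket_nth[of U "lie_bracket V W"] along_bracket[OF that(2,3) Vect_smooth[OF that(1) c] c]
    unfolding lie_bracket_nth[of V W]
    by (simp add: along_diff[OF smooth_at_along smooth_at_along c] that Vect_smooth c)
  show "(lie_bracket X (lie_bracket Y Z) + lie_bracket Y (lie_bracket Z X)
    + lie_bracket Z (lie_bracket X Y)) p c $ i = 0 p c $ i"
    by (simp add: outer X Y Z)
qed (intro Vect_plus Vect_bracket Vect_zero X Y Z)+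

lemma bracket_self: "lie_bracket X X = 0"
  by (simp add: fun_eq_iff vec_eq_iff lie_bracket_nth)

text \<open>The Jacobi identity in the shape of the module axiom \<open>act_br\<close>.\<close>

lemma bracket_bracket:
  assumes X: "X \<in> Vect A" and Y: "Y \<in> Vect A" and Z: "Z \<in> Vect A"
  shows "lie_bracket (lie_bracket X Y) Z = lie_bracket X (lie_bracket Y Z) - lie_bracket Y (lie_bracket X Z)"
proof -
  have neg: "vf_scale (- 1) W = - W" for W :: "'a \<Rightarrow> ('a, 'm) chart \<Rightarrow> complex^'m"
    by (simp add: vf_scale_def fun_eq_iff vec_eq_iff)
  have "lie_bracket Y (lie_bracket Z X) = - lie_bracket Y (lie_bracket X Z)"
    using bracket_scale_right[OF Y Vect_bracket[OF X Z], of "-1"]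
    unfolding neg bracket_anti[of Z X] .
  then show ?thesis
    using bracket_jacobi[OF X Y Z] unfolding bracket_anti[of Z "lie_bracket X Y"]
    by (simp flip: diff_conv_add_uminus)
qed

end

section \<open>Lie derivatives of covector fields\<close>

text \<open>The function \<open>a j\<close> is the \<open>j\<close>-th component in the chart \<open>c\<close> of a complex covector field, which makes
  it possible to iterate Lie derivatives (\<open>lie_derivative\<close> only accepts real forms). \<open>curl\<close> is its
  exterior derivative.\<close>

definition Lder ::
  "('a, 'm::finite) chart \<Rightarrow> ('a \<Rightarrow> ('a, 'm) chart \<Rightarrow> complex^'m) \<Rightarrow> ('m \<Rightarrow> 'a \<Rightarrow> complex) \<Rightarrow> 'm \<Rightarrow> 'a \<Rightarrow> complex" where
  "Lder c X a j p = along X c (a j) p + (\<Sum>i\<in>UNIV. a i p * pd c j (\<lambda>q. X q c $ i) p)"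

definition form_comp ::
  "('a \<Rightarrow> ('a, 'm::finite) chart \<Rightarrow> real^'m) \<Rightarrow> ('a, 'm) chart \<Rightarrow> 'm \<Rightarrow> 'a \<Rightarrow> complex" where
  "form_comp \<alpha> c j q = of_real (\<alpha> q c $ j)"

definition curl :: "('a, 'm::finite) chart \<Rightarrow> ('m \<Rightarrow> 'a \<Rightarrow> complex) \<Rightarrow> 'm \<Rightarrow> 'm \<Rightarrow> 'a \<Rightarrow> complex" where
  "curl c a i j p = pd c i (a j) p - pd c j (a i) p"

context atlas
begin

lemma smooth_at_Lder:
  assumes "X \<in> Vect A" "\<And>j. smooth_at A p (a j)" "c \<in> charts_at A p"
  shows "smooth_at A p (Lder c X a j)"
  unfolding Lder_def[abs_def]
  by (intro smooth_at_add smooth_at_sum smooth_at_mult smooth_at_along smooth_at_pd Vect_smooth assms)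

lemma Lder_cong:
  assumes "\<And>j. \<forall>\<^sub>F q in nhds p. a j q = b j q" "c \<in> charts_at A p"
  shows "Lder c X a j p = Lder c X b j p"
  using along_cong[OF assms] eventually_nhds_x_imp_x[OF assms(1)] by (simp add: Lder_def)

lemma Lder_mult:
  assumes "smooth_at A p u" "\<And>j. smooth_at A p (a j)" "c \<in> charts_at A p"
  shows "Lder c X (\<lambda>j q. u q * a j q) j p = along X c u p * a j p + u p * Lder c X a j p"
  using along_mult[OF assms(1,2,3)]
  by (simp add: Lder_def distrib_left sum_distrib_left mult.assoc)

lemma Lder_plus_field:
  assumes "X \<in> Vect A" "Y \<in> Vect A" "c \<in> charts_at A p"
  shows "Lder c (X + Y) a j p = Lder c X a j p + Lder c Y a j p"
  using assms by (simp add: Lder_def along_plus_field pd_add Vect_smooth distrib_left sum.distrib)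

lemma Lder_scale_field:
  assumes "X \<in> Vect A" "c \<in> charts_at A p"
  shows "Lder c (vf_scale s X) a j p = s * Lder c X a j p"
  using assms
  by (simp add: Lder_def along_scale_field vf_scale_nth pd_mult pd_const Vect_smooth smooth_at_const
      distrib_left sum_distrib_left mult_ac)

text \<open>Leibniz rule for the contraction a(Y): the derivatives of the components of
  \<open>X\<close> occurring in L_X a and in [X,Y] cancel.\<close>

lemma along_pairing:
  assumes "Y \<in> Vect A" "\<And>j. smooth_at A p (a j)" "c \<in> charts_at A p"
  shows "along X c (\<lambda>q. \<Sum>i\<in>UNIV. a i q * Y q c $ i) p =
    (\<Sum>i\<in>UNIV. Lder c X a i p * Y p c $ i) + (\<Sum>i\<in>UNIV. a i p * lie_bracket X Y p c $ i)"
proof -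
  have "along X c (\<lambda>q. \<Sum>i\<in>UNIV. a i q * Y q c $ i) p =
      (\<Sum>i\<in>UNIV. along X c (a i) p * Y p c $ i + a i p * along X c (\<lambda>q. Y q c $ i) p)"
    by (subst along_sum) (simp_all add: along_mult smooth_at_mult Vect_smooth assms)
  moreover have "(\<Sum>i\<in>UNIV. (\<Sum>k\<in>UNIV. a k p * pd c i (\<lambda>q. X q c $ k) p) * Y p c $ i) =
      (\<Sum>k\<in>UNIV. a k p * along Y c (\<lambda>q. X q c $ k) p)"
    unfolding sum_distrib_right along_def sum_distrib_left
    by (subst sum.swap) (simp add: mult_ac)
  ultimately show ?thesis
    by (simp add: Lder_def lie_bracket_nth distrib_right right_diff_distrib sum.distrib sum_subtractf)
qed

lemma pd_along:
  assumes "Y \<in> Vect A" "smooth_at A p f" "c \<in> charts_at A p"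
  shows "pd c j (along Y c f) p = along Y c (pd c j f) p + (\<Sum>k\<in>UNIV. pd c j (\<lambda>q. Y q c $ k) p * pd c k f p)"
proof -
  have s: "smooth_at A p (\<lambda>q. Y q c $ k)" "smooth_at A p (pd c k f)" for k
    using assms by (auto intro: Vect_smooth smooth_at_pd)
  have "pd c j (along Y c f) p = (\<Sum>k\<in>UNIV. pd c j (\<lambda>q. Y q c $ k * pd c k f q) p)"
    unfolding along_def[abs_def]
    by (rule pd_sum) (intro smooth_at_mult s assms)+
  also have "\<dots> = (\<Sum>k\<in>UNIV. Y p c $ k * pd c k (pd c j f) p + pd c j (\<lambda>q. Y q c $ k) p * pd c k f p)"
    by (intro sum.cong refl) (simp add: pd_mult s assms pd_commute[OF assms(2,3), of j])
  finally show ?thesis by (simp add: along_def sum.distrib)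
qed

text \<open>Arranged for antisymmetrising in \<open>X\<close> and \<open>Y\<close>. The third sum is
  symmetric. The last one is zero: its first inner sum stems from contracting L_Y a with the
  derivatives of \<open>X\<close>, its second from moving \<open>pd c j\<close> in front of
  \<open>along X c\<close>. The first two terms remain and add up to the Lie derivative along
  [X,Y].\<close>

lemma Lder_Lder:
  assumes X: "X \<in> Vect A" and Y: "Y \<in> Vect A" and a: "\<And>j. smooth_at A p (a j)" and c: "c \<in> charts_at A p"
  shows "Lder c X (Lder c Y a) j p = along X c (along Y c (a j)) p
    + (\<Sum>i\<in>UNIV. a i p * pd c j (along X c (\<lambda>q. Y q c $ i)) p)
    + (\<Sum>i\<in>UNIV. along X c (a i) p * pd c j (\<lambda>q. Y q c $ i) p + along Y c (a i) p * pd c j (\<lambda>q. X q c $ i) p)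
    + (\<Sum>i\<in>UNIV. a i p * ((\<Sum>k\<in>UNIV. pd c k (\<lambda>q. Y q c $ i) p * pd c j (\<lambda>q. X q c $ k) p)
        - (\<Sum>k\<in>UNIV. pd c j (\<lambda>q. X q c $ k) p * pd c k (\<lambda>q. Y q c $ i) p)))"
proof -
  have sY: "smooth_at A p (pd c j (\<lambda>q. Y q c $ i))" for i
    by (intro smooth_at_pd Vect_smooth Y c)
  have "along X c (Lder c Y a j) p = along X c (along Y c (a j)) p +
      along X c (\<lambda>q. \<Sum>i\<in>UNIV. a i q * pd c j (\<lambda>q. Y q c $ i) q) p"
    unfolding Lder_def[abs_def]
    by (rule along_add) (intro smooth_at_along smooth_at_sum smooth_at_mult sY Y a c)+
  also have "along X c (\<lambda>q. \<Sum>i\<in>UNIV. a i q * pd c j (\<lambda>q. Y q c $ i) q) p =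
      (\<Sum>i\<in>UNIV. along X c (a i) p * pd c j (\<lambda>q. Y q c $ i) p + a i p * along X c (pd c j (\<lambda>q. Y q c $ i)) p)"
    by (subst along_sum) (simp_all add: along_mult smooth_at_mult sY a c)
  finally have 1: "along X c (Lder c Y a j) p = along X c (along Y c (a j)) p +
      (\<Sum>i\<in>UNIV. along X c (a i) p * pd c j (\<lambda>q. Y q c $ i) p + a i p * along X c (pd c j (\<lambda>q. Y q c $ i)) p)" .
  have 2: "(\<Sum>k\<in>UNIV. (\<Sum>i\<in>UNIV. a i p * pd c k (\<lambda>q. Y q c $ i) p) * pd c j (\<lambda>q. X q c $ k) p) =
      (\<Sum>i\<in>UNIV. a i p * (\<Sum>k\<in>UNIV. pd c k (\<lambda>q. Y q c $ i) p * pd c j (\<lambda>q. X q c $ k) p))"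
    unfolding sum_distrib_right sum_distrib_left by (subst sum.swap) (simp add: mult.assoc)
  show ?thesis
    unfolding Lder_def[of c X] 1 pd_along[OF X Vect_smooth[OF Y c] c]
    unfolding Lder_def[of c Y]
    by (simp add: distrib_right distrib_left right_diff_distrib sum.distrib sum_subtractf 2)
qed

lemma Lder_bracket:
  assumes X: "X \<in> Vect A" and Y: "Y \<in> Vect A" and a: "\<And>j. smooth_at A p (a j)" and c: "c \<in> charts_at A p"
  shows "Lder c (lie_bracket X Y) a j p = Lder c X (Lder c Y a) j p - Lder c Y (Lder c X a) j p"
proof -
  have "pd c j (\<lambda>q. lie_bracket X Y q c $ i) p =
      pd c j (along X c (\<lambda>q. Y q c $ i)) p - pd c j (along Y c (\<lambda>q. X q c $ i)) p" for i
    unfolding lie_bracket_nth by (intro pd_diff smooth_at_along Vect_smooth X Y c)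
  then show ?thesis
    unfolding Lder_Lder[OF X Y a c] Lder_Lder[OF Y X a c]
    by (simp add: Lder_def along_bracket[OF X Y a c] right_diff_distrib sum_subtractf sum.distrib mult.commute)
qed

section \<open>Change of chart for covector fields\<close>

text \<open>\<open>a\<close> and \<open>b\<close> are the components of one covector field in the charts \<open>c\<close> and \<open>c'\<close>.\<close>

definition covariant where
  "covariant c c' a b q \<longleftrightarrow> (\<forall>j. a j q = (\<Sum>i\<in>UNIV. pd c j (coord c' i) q * b i q))"

text \<open>The first sum is the obstruction to tensorial behaviour. It is symmetric in
  \<open>j\<close> and \<open>k\<close>, so it drops out of \<open>curl\<close>.\<close>

lemma pd_covariant:
  assumes cov: "\<forall>\<^sub>F q in nhds p. covariant c c' a b q" and b: "\<And>j. smooth_at A p (b j)"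
    and c: "c \<in> charts_at A p" and c': "c' \<in> charts_at A p"
  shows "pd c k (a j) p = (\<Sum>i\<in>UNIV. pd c k (pd c j (coord c' i)) p * b i p) +
    (\<Sum>i\<in>UNIV. pd c j (coord c' i) p * pd c k (b i) p)"
proof -
  have s: "smooth_at A p (pd c j (coord c' i))" for i by (intro smooth_at_pd smooth_at_coord c c')
  have "pd c k (a j) p = pd c k (\<lambda>q. \<Sum>i\<in>UNIV. pd c j (coord c' i) q * b i q) p"
    by (rule pd_cong[OF _ c]) (use cov in \<open>auto simp: covariant_def elim!: eventually_mono\<close>)
  also have "\<dots> = (\<Sum>i\<in>UNIV. pd c j (coord c' i) p * pd c k (b i) p + pd c k (pd c j (coord c' i)) p * b i p)"
    by (subst pd_sum) (simp_all add: pd_mult smooth_at_mult s b c)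
  finally show ?thesis by (simp add: sum.distrib add.commute)
qed

text \<open>Differentiating the law for \<open>a\<close> along \<open>X\<close> produces derivatives
  of the Jacobian. Together with the derivatives of the components of \<open>X\<close> in
  \<open>c\<close> they form, by \<open>pdX\<close>, the derivatives of its components in
  \<open>c'\<close>.\<close>

lemma Lder_covariant:
  assumes X: "X \<in> Vect A"
    and cov: "\<forall>\<^sub>F q in nhds p. covariant c c' a b q" and b: "\<And>j. smooth_at A p (b j)"
    and c: "c \<in> charts_at A p" and c': "c' \<in> charts_at A p"
  shows "covariant c c' (Lder c X a) (Lder c' X b) p"
  unfolding covariant_def
proof
  fix j
  let ?J = "\<lambda>i j. pd c j (coord c' i) p"
  have cov_p: "a k p = (\<Sum>i\<in>UNIV. ?J i k * b i p)" for k
    using eventually_nhds_x_imp_x[OF cov] by (simp add: covariant_def)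
  have sc: "smooth_at A p (coord c' i)" for i by (rule smooth_at_coord[OF c'])
  have ev: "\<forall>\<^sub>F q in nhds p. X q c' $ i = along X c (coord c' i) q" for i
    using eventually_charts_at[OF c] eventually_charts_at[OF c']
    by eventually_elim (rule Vect_along[OF X])
  \<comment> \<open>Both sides are the \<open>j\<close>-th derivative in \<open>c\<close> of one
    function, the component of \<open>X\<close> in \<open>c'\<close>: on the left by the chain rule,
    on the right by writing that component as \<open>X\<close> applied to a coordinate.\<close>
  have pdX: "(\<Sum>l\<in>UNIV. ?J l j * pd c' l (\<lambda>q. X q c' $ i) p) =
      along X c (pd c j (coord c' i)) p + (\<Sum>k\<in>UNIV. pd c j (\<lambda>q. X q c $ k) p * ?J i k)" for i
    using pd_chain[OF Vect_smooth[OF X c'] c c', of j i] pd_cong[OF ev c, of j]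
      pd_along[OF X sc c] by simp
  have "along X c (a j) p = along X c (\<lambda>q. \<Sum>i\<in>UNIV. pd c j (coord c' i) q * b i q) p"
    by (rule along_cong[OF _ c]) (use cov in \<open>auto simp: covariant_def elim!: eventually_mono\<close>)
  also have "\<dots> = (\<Sum>i\<in>UNIV. along X c (pd c j (coord c' i)) p * b i p + ?J i j * along X c (b i) p)"
    by (subst along_sum) (simp_all add: along_mult smooth_at_mult smooth_at_pd sc b c)
  also have "\<dots> = (\<Sum>i\<in>UNIV. along X c (pd c j (coord c' i)) p * b i p + ?J i j * along X c' (b i) p)"
    using along_chart[of X p "b _" c c', OF Vect_tangent[OF X] b c c'] by simp
  finally have 1: "along X c (a j) p =
      (\<Sum>i\<in>UNIV. along X c (pd c j (coord c' i)) p * b i p + ?J i j * along X c' (b i) p)" .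
  have 2: "(\<Sum>k\<in>UNIV. a k p * pd c j (\<lambda>q. X q c $ k) p) =
      (\<Sum>i\<in>UNIV. b i p * (\<Sum>k\<in>UNIV. pd c j (\<lambda>q. X q c $ k) p * ?J i k))"
    unfolding cov_p sum_distrib_right sum_distrib_left by (subst sum.swap) (simp add: mult_ac)
  have 3: "(\<Sum>l\<in>UNIV. ?J l j * (\<Sum>i\<in>UNIV. b i p * pd c' l (\<lambda>q. X q c' $ i) p)) =
      (\<Sum>i\<in>UNIV. b i p * (\<Sum>l\<in>UNIV. ?J l j * pd c' l (\<lambda>q. X q c' $ i) p))"
    unfolding sum_distrib_left by (subst sum.swap) (simp add: mult_ac)
  show "Lder c X a j p = (\<Sum>l\<in>UNIV. ?J l j * Lder c' X b l p)"
    unfolding Lder_def distrib_left sum.distrib 3 pdX 1 2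
    by (simp add: sum.distrib mult.commute)
qed

lemma curl_covariant:
  assumes X: "v \<in> tangent_space A p"
    and cov: "\<forall>\<^sub>F q in nhds p. covariant c c' a b q" and b: "\<And>j. smooth_at A p (b j)"
    and c: "c \<in> charts_at A p" and c': "c' \<in> charts_at A p"
  shows "covariant c c' (\<lambda>j p. \<Sum>i\<in>UNIV. curl c a i j p * v c $ i) (\<lambda>j p. \<Sum>i\<in>UNIV. curl c' b i j p * v c' $ i) p"
  unfolding covariant_def
proof
  fix j
  let ?J = "\<lambda>i j. pd c j (coord c' i) p"
  have v: "v c' $ k = (\<Sum>i\<in>UNIV. ?J k i * v c $ i)" for k
    using X c c' by (simp add: tangent_space_iff)
  have pdb: "pd c k (b l) p = (\<Sum>i\<in>UNIV. ?J i k * pd c' i (b l) p)" for k l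
    by (rule pd_chain[OF b c c'])
  have "curl c a i j p = (\<Sum>l\<in>UNIV. ?J l j * pd c i (b l) p) - (\<Sum>l\<in>UNIV. ?J l i * pd c j (b l) p)" for i
    unfolding curl_def pd_covariant[OF cov b c c'] pd_commute[OF smooth_at_coord[OF c'] c, of i j] by simp
  also have "\<dots> i = (\<Sum>l\<in>UNIV. \<Sum>k\<in>UNIV. ?J l j * ?J k i * pd c' k (b l) p)
      - (\<Sum>k\<in>UNIV. \<Sum>l\<in>UNIV. ?J k i * ?J l j * pd c' l (b k) p)" for i
    by (simp add: pdb sum_distrib_left mult.assoc)
  also have "\<dots> i = (\<Sum>l\<in>UNIV. \<Sum>k\<in>UNIV. ?J l j * ?J k i * curl c' b k l p)" for i
    by (subst (2) sum.swap) (simp add: curl_def right_diff_distrib sum_subtractf mult_ac)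
  finally have crl: "curl c a i j p = (\<Sum>l\<in>UNIV. \<Sum>k\<in>UNIV. ?J l j * ?J k i * curl c' b k l p)" for i .
  have "(\<Sum>i\<in>UNIV. curl c a i j p * v c $ i) =
      (\<Sum>i\<in>UNIV. \<Sum>l\<in>UNIV. \<Sum>k\<in>UNIV. ?J l j * ?J k i * curl c' b k l p * v c $ i)"
    by (simp add: crl sum_distrib_right)
  also have "\<dots> = (\<Sum>l\<in>UNIV. \<Sum>i\<in>UNIV. \<Sum>k\<in>UNIV. ?J l j * ?J k i * curl c' b k l p * v c $ i)"
    by (rule sum.swap)
  also have "\<dots> = (\<Sum>l\<in>UNIV. \<Sum>k\<in>UNIV. \<Sum>i\<in>UNIV. ?J l j * ?J k i * curl c' b k l p * v c $ i)"
    by (intro sum.cong refl sum.swap)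
  also have "\<dots> = (\<Sum>l\<in>UNIV. ?J l j * (\<Sum>k\<in>UNIV. curl c' b k l p * v c' $ k))"
    by (simp add: v sum_distrib_left mult_ac)
  finally show "(\<Sum>i\<in>UNIV. curl c a i j p * v c $ i) =
    (\<Sum>l\<in>UNIV. ?J l j * (\<Sum>k\<in>UNIV. curl c' b k l p * v c' $ k))" .
qed

text \<open>Cartan's formula L_Y a = i_Y da + d(a(Y)), where the last term vanishes. As a(Y) is
  differentiated, it has to vanish near \<open>p\<close> and not just at \<open>p\<close>.\<close>

lemma Lder_tangent:
  assumes Y: "Y \<in> Vect A" and a: "\<And>j. smooth_at A p (a j)" and c: "c \<in> charts_at A p"
    and z: "\<forall>\<^sub>F q in nhds p. (\<Sum>i\<in>UNIV. a i q * Y q c $ i) = 0"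
  shows "Lder c Y a j p = (\<Sum>i\<in>UNIV. curl c a i j p * Y p c $ i)"
proof -
  have "0 = pd c j (\<lambda>q. \<Sum>i\<in>UNIV. a i q * Y q c $ i) p"
    using pd_cong[OF z c, of j] by (simp add: pd_const)
  also have "\<dots> = (\<Sum>i\<in>UNIV. a i p * pd c j (\<lambda>q. Y q c $ i) p + pd c j (a i) p * Y p c $ i)"
    by (subst pd_sum) (simp_all add: pd_mult smooth_at_mult Vect_smooth Y a c)
  finally have "(\<Sum>i\<in>UNIV. a i p * pd c j (\<lambda>q. Y q c $ i) p) = - (\<Sum>i\<in>UNIV. pd c j (a i) p * Y p c $ i)"
    by (simp add: sum.distrib eq_neg_iff_add_eq_0)
  then show ?thesis
    by (simp add: Lder_def along_def curl_def left_diff_distrib right_diff_distrib sum_subtractf mult.commute)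
qed

lemma curl_mult:
  assumes "smooth_at A p u" "\<And>j. smooth_at A p (a j)" "c \<in> charts_at A p"
  shows "curl c (\<lambda>j q. u q * a j q) i j p = u p * curl c a i j p + pd c i u p * a j p - pd c j u p * a i p"
  using assms by (simp add: curl_def pd_mult right_diff_distrib)

end

section \<open>Linear algebra of the splitting\<close>

definition cramer_solution :: "'k::field^'m::finite^'m \<Rightarrow> 'k^'m \<Rightarrow> 'k^'m" where
  "cramer_solution M d = (\<chi> k. det (\<chi> i j. if j = k then d $ i else M $ i $ j) / det M)"

lemma cramer_solution: "det M \<noteq> 0 \<Longrightarrow> M *v cramer_solution M d = d"
  using cramer[of M "cramer_solution M d" d] by (simp add: cramer_solution_def)

text \<open>If \<open>\<Omega> = d\<alpha>\<close> is nondegenerate on \<open>ker a\<close>, then \<open>\<Omega> + a \<otimes> a\<close> is nondegenerate on the whole space: pairing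
  a vector \<open>z\<close> of its kernel with \<open>z\<close> gives \<open>a(z)\<^sup>2 = 0\<close>. Its inverse maps \<open>a\<close> to the Reeb vector \<open>R\<close>
  (\<open>a(R) = 1\<close>, \<open>i_R \<Omega> = 0\<close>). The solution of \<open>i_t \<Omega> + a(t) a = b - b(R) a\<close> has \<open>a(t) = 0\<close>, as one
  sees by pairing with \<open>R\<close>.\<close>

definition augmented :: "('m \<Rightarrow> 'm \<Rightarrow> 'k::field) \<Rightarrow> ('m \<Rightarrow> 'k) \<Rightarrow> 'k^'m::finite^'m" where
  "augmented \<Omega> a = (\<chi> j i. \<Omega> i j + a j * a i)"

definition reeb :: "('m \<Rightarrow> 'm \<Rightarrow> 'k::field) \<Rightarrow> ('m \<Rightarrow> 'k) \<Rightarrow> 'k^'m::finite" where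
  "reeb \<Omega> a = cramer_solution (augmented \<Omega> a) (\<chi> j. a j)"

definition tangent_solution ::
  "('m \<Rightarrow> 'm \<Rightarrow> 'k::field) \<Rightarrow> ('m \<Rightarrow> 'k) \<Rightarrow> ('m \<Rightarrow> 'k) \<Rightarrow> 'k^'m::finite" where
  "tangent_solution \<Omega> a b =
     cramer_solution (augmented \<Omega> a) (\<chi> j. b j - (\<Sum>k\<in>UNIV. b k * reeb \<Omega> a $ k) * a j)"

lemma tangent_solution:
  fixes \<Omega> :: "'m::finite \<Rightarrow> 'm \<Rightarrow> 'k::field_char_0"
  assumes anti: "\<And>i j. \<Omega> i j = - \<Omega> j i"
    and nondeg: "\<forall>z f. (\<Sum>i\<in>UNIV. a i * z $ i) = 0 \<longrightarrow>
      (\<forall>j. (\<Sum>i\<in>UNIV. \<Omega> i j * z $ i) = f * a j) \<longrightarrow> z = (0 :: 'k^'m)"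
    and a: "a k \<noteq> 0"
  shows "det (augmented \<Omega> a) \<noteq> 0"
    and "(\<Sum>i\<in>UNIV. a i * tangent_solution \<Omega> a b $ i) = 0"
    and "\<exists>f. \<forall>j. b j - (\<Sum>i\<in>UNIV. \<Omega> i j * tangent_solution \<Omega> a b $ i) = f * a j"
proof -
  have aug: "(augmented \<Omega> a *v z) $ j = (\<Sum>i\<in>UNIV. \<Omega> i j * z $ i) + a j * (\<Sum>i\<in>UNIV. a i * z $ i)" for z j
    by (simp add: augmented_def matrix_vector_mult_def distrib_right sum.distrib sum_distrib_left mult.assoc)
  have swap: "(\<Sum>j\<in>UNIV. w $ j * (\<Sum>i\<in>UNIV. \<Omega> i j * z $ i)) = - (\<Sum>i\<in>UNIV. z $ i * (\<Sum>j\<in>UNIV. \<Omega> j i * w $ j))" for w z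
  proof -
    have "(\<Sum>j\<in>UNIV. w $ j * (\<Sum>i\<in>UNIV. \<Omega> i j * z $ i)) = (\<Sum>i\<in>UNIV. \<Sum>j\<in>UNIV. w $ j * (\<Omega> i j * z $ i))"
      unfolding sum_distrib_left by (rule sum.swap)
    also have "\<dots> = (\<Sum>i\<in>UNIV. \<Sum>j\<in>UNIV. - (z $ i * (\<Omega> j i * w $ j)))"
    proof (intro sum.cong refl)
      fix i j show "w $ j * (\<Omega> i j * z $ i) = - (z $ i * (\<Omega> j i * w $ j))"
        by (subst anti) simp
    qed
    finally show ?thesis by (simp add: sum_negf sum_distrib_left)
  qed
  have self: "(\<Sum>j\<in>UNIV. z $ j * (\<Sum>i\<in>UNIV. \<Omega> i j * z $ i)) = 0" for z
  proof -
    have "x = 0" if "x = - x" for x :: 'k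
    proof -
      have "2 * x = 0" using that by (metis mult_2 add.right_inverse)
      then show ?thesis by simp
    qed
    then show ?thesis using swap[of z z] by blast
  qed
  have pair: "(\<Sum>j\<in>UNIV. w $ j * (augmented \<Omega> a *v z) $ j) =
      (\<Sum>j\<in>UNIV. w $ j * (\<Sum>i\<in>UNIV. \<Omega> i j * z $ i)) + (\<Sum>i\<in>UNIV. a i * w $ i) * (\<Sum>i\<in>UNIV. a i * z $ i)" for w z
    by (simp add: aug distrib_left sum.distrib sum_distrib_right mult_ac)
  have ker: "z = 0" if z: "augmented \<Omega> a *v z = 0" for z
  proof -
    have az: "(\<Sum>i\<in>UNIV. a i * z $ i) = 0"
      using pair[of z z] by (simp add: z self)
    then have "(\<Sum>i\<in>UNIV. \<Omega> i j * z $ i) = 0 * a j" for j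
      using aug[of z j] by (simp add: z)
    with az show ?thesis using nondeg by blast
  qed
  have "\<exists>B. B ** augmented \<Omega> a = mat 1"
    unfolding matrix_left_invertible_ker using ker by blast
  then show det: "det (augmented \<Omega> a) \<noteq> 0"
    by (simp only: invertible_det_nz[symmetric] invertible_left_inverse)
  let ?R = "reeb \<Omega> a" and ?T = "tangent_solution \<Omega> a b"
  have R: "augmented \<Omega> a *v ?R = (\<chi> j. a j)"
    unfolding reeb_def by (rule cramer_solution[OF det])
  \<comment> \<open>\<open>s\<close> is a(R). Pairing the equation for \<open>R\<close> with
    \<open>R\<close> gives s = s\<cdot>s because \<Omega>(R,R) = 0. If s were 0, then
    \<open>R\<close> would lie in ker a with i_R \<Omega> = a, hence be 0 by nondegeneracy, although
    its image a is nonzero.\<close>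
  define s where "s = (\<Sum>i\<in>UNIV. a i * ?R $ i)"
  have "s = s * s"
    using pair[of ?R ?R] unfolding R self by (simp add: s_def mult.commute)
  have \<Omega>R: "(\<Sum>i\<in>UNIV. \<Omega> i j * ?R $ i) = (1 - s) * a j" for j
    using aug[of ?R j] unfolding R by (simp add: s_def algebra_simps)
  have "s \<noteq> 0"
  proof
    assume "s = 0"
    then have "?R = 0" using \<Omega>R nondeg[rule_format, of ?R 1] by (simp add: s_def)
    then have "(\<chi> j. a j) = (0 :: 'k^'m)" using R by (simp only: matrix_vector_mult_0_right)
    then show False using a by (auto simp: vec_eq_iff)
  qed
  then have s: "s = 1" using \<open>s = s * s\<close> by simp
  define t where "t = (\<Sum>k\<in>UNIV. b k * ?R $ k)"
  have T: "augmented \<Omega> a *v ?T = (\<chi> j. b j - t * a j)"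
    unfolding tangent_solution_def t_def by (rule cramer_solution[OF det])
  \<comment> \<open>The subtracted multiple b(R) a is chosen to make the right-hand side pair to
    zero with \<open>R\<close>. On the left \<Omega> contributes nothing because i_R \<Omega> = 0,
    which leaves a(R) a(T) = a(T).\<close>
  have "(\<Sum>j\<in>UNIV. ?R $ j * (b j - t * a j)) = (\<Sum>j\<in>UNIV. b j * ?R $ j) - t * (\<Sum>j\<in>UNIV. a j * ?R $ j)"
    by (simp add: right_diff_distrib sum_subtractf sum_distrib_left mult_ac)
  also have "\<dots> = 0" using s by (simp add: t_def s_def)
  finally have "(\<Sum>j\<in>UNIV. ?R $ j * (augmented \<Omega> a *v ?T) $ j) = 0"
    by (simp add: T)
  then show aT: "(\<Sum>i\<in>UNIV. a i * ?T $ i) = 0"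
    unfolding pair swap[of ?R] \<Omega>R using s by (simp add: s_def)
  have "b j - (\<Sum>i\<in>UNIV. \<Omega> i j * ?T $ i) = t * a j" for j
    using aug[of ?T j] unfolding T aT by (simp add: algebra_simps)
  then show "\<exists>f. \<forall>j. b j - (\<Sum>i\<in>UNIV. \<Omega> i j * ?T $ i) = f * a j" by blast
qed

text \<open>Tangent vectors are families over all charts, so a column of components in
  \<open>c\<close> has to be carried to the other charts by Jacobians.\<close>

definition extend_vector where
  "extend_vector A p c w = (\<lambda>c'. if c' \<in> charts_at A p
     then (\<chi> i. \<Sum>j\<in>UNIV. of_real (pd c j (\<lambda>q. snd c' q $ i) p) * w $ j) else 0)"

context atlas
begin

text \<open>The cocycle identity that makes \<open>extend_vector\<close> a tangent vector. It is
  stated over the reals, to serve real and complex vectors alike, and read off from the complex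
  chain rule.\<close>

lemma jacobian_trans:
  assumes "c \<in> charts_at A p" "c' \<in> charts_at A p" "c'' \<in> charts_at A p"
  shows "pd c j (\<lambda>q. snd c'' q $ i) p =
    (\<Sum>k\<in>UNIV. pd c j (\<lambda>q. snd c' q $ k) p * pd c' k (\<lambda>q. snd c'' q $ i) p)"
proof -
  have "complex_of_real (pd c j (\<lambda>q. snd c'' q $ i) p) =
    of_real (\<Sum>k\<in>UNIV. pd c j (\<lambda>q. snd c' q $ k) p * pd c' k (\<lambda>q. snd c'' q $ i) p)"
    using pd_chain[OF smooth_at_coord[OF assms(3)] assms(1,2)] by (simp add: pd_coord assms)
  then show ?thesis by (simp only: of_real_eq_iff)
qed

lemma jacobian_self:
  assumes "c \<in> charts_at A p"
  shows "pd c j (\<lambda>q. snd c q $ i) p = (if i = j then 1 else 0)"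
proof -
  note c = charts_atD[OF assms]
  have "((\<lambda>y. y $ i) has_derivative (\<lambda>y. y $ i)) (at (snd c p))"
    by (rule bounded_linear_imp_has_derivative[OF bounded_linear_vec_nth])
  then have "(in_chart c (\<lambda>q. snd c q $ i) has_derivative (\<lambda>y. y $ i)) (at (snd c p))"
    by (rule has_derivative_transform_within_open[OF _ open_chart_image[OF c(1) open_chart[OF c(1)]]])
      (use c in \<open>auto simp: in_chart_apply\<close>)
  from pd_eqI[OF assms this] show ?thesis by (simp add: axis_def)
qed

lemma extend_vector:
  fixes w :: "'k::real_normed_field^'m"
  assumes c: "c \<in> charts_at A p"
  shows "extend_vector A p c w \<in> tangent_space A p" "extend_vector A p c w c = w"
proof -
  let ?J = "\<lambda>c c' i j. of_real (pd c j (\<lambda>q. snd c' q $ i) p) :: 'k"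
  show "extend_vector A p c w c = w"
    using c by (simp add: extend_vector_def jacobian_self vec_eq_iff if_distrib[of of_real]
        if_distrib[of "\<lambda>x. x * _"] cong: if_cong)
  have tr: "(\<Sum>j\<in>UNIV. ?J c c'' i j * w $ j) = (\<Sum>k\<in>UNIV. ?J c' c'' i k * (\<Sum>j\<in>UNIV. ?J c c' k j * w $ j))"
    if "c' \<in> charts_at A p" "c'' \<in> charts_at A p" for c' c'' i
    unfolding jacobian_trans[OF c that] sum_distrib_left
    by (subst sum.swap) (simp add: sum_distrib_left sum_distrib_right mult_ac)
  show "extend_vector A p c w \<in> tangent_space A p"
    unfolding tangent_space_def mem_Collect_eq
  proof (intro conjI allI impI ballI)
    show "extend_vector A p c w c'' $ i = (\<Sum>j\<in>UNIV. ?J c' c'' i j * extend_vector A p c w c' $ j)"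
      if "c' \<in> charts_at A p" "c'' \<in> charts_at A p" for c' c'' i
      using tr[OF that, of i] that by (simp add: extend_vector_def)
  qed (simp add: extend_vector_def)
qed

lemma smooth_at_det:
  fixes M :: "'a \<Rightarrow> complex^'n^'n"
  assumes "\<And>i j. smooth_at A p (\<lambda>q. M q $ i $ j)"
  shows "smooth_at A p (\<lambda>q. det (M q))"
  unfolding det_def by (intro smooth_at_sum smooth_at_mult smooth_at_const smooth_at_prod assms)

lemma smooth_at_cramer_solution:
  fixes M :: "'a \<Rightarrow> complex^'n^'n"
  assumes M: "\<And>i j. smooth_at A p (\<lambda>q. M q $ i $ j)" and d: "\<And>i. smooth_at A p (\<lambda>q. d q $ i)"
    and "det (M p) \<noteq> 0"
  shows "smooth_at A p (\<lambda>q. cramer_solution (M q) (d q) $ k)"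
proof -
  have "smooth_at A p (\<lambda>q. if j = k then d q $ i else M q $ i $ j)" for i j
    using M d by (cases "j = k") auto
  then show ?thesis
    unfolding cramer_solution_def using assms(3)
    by (simp add: smooth_at_divide smooth_at_det M)
qed

lemma smooth_at_tangent_solution:
  fixes \<Omega> :: "'n::finite \<Rightarrow> 'n \<Rightarrow> 'a \<Rightarrow> complex"
  assumes \<Omega>: "\<And>i j. smooth_at A p (\<Omega> i j)" and a: "\<And>j. smooth_at A p (a j)" and b: "\<And>j. smooth_at A p (b j)"
    and "det (augmented (\<lambda>i j. \<Omega> i j p) (\<lambda>j. a j p)) \<noteq> 0"
  shows "smooth_at A p (\<lambda>q. tangent_solution (\<lambda>i j. \<Omega> i j q) (\<lambda>j. a j q) (\<lambda>j. b j q) $ k)"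
proof -
  have M: "smooth_at A p (\<lambda>q. augmented (\<lambda>i j. \<Omega> i j q) (\<lambda>j. a j q) $ i $ j)" for i j
    unfolding augmented_def by (simp add: smooth_at_add smooth_at_mult \<Omega> a)
  have "smooth_at A p (\<lambda>q. reeb (\<lambda>i j. \<Omega> i j q) (\<lambda>j. a j q) $ k)" for k
    unfolding reeb_def by (rule smooth_at_cramer_solution) (use assms(4) in \<open>simp_all add: M a\<close>)
  then show ?thesis
    unfolding tangent_solution_def
    by (intro smooth_at_cramer_solution)
      (use assms(4) in \<open>simp_all add: M a b smooth_at_diff smooth_at_mult smooth_at_sum\<close>)
qed

end

section \<open>The splitting\<close>

text \<open>\<open>t\<close> is the component of \<open>X\<close> at \<open>p\<close> tangent to \<open>\<xi>\<close>: \<open>\<alpha>(t) = 0\<close> and \<open>L_X \<alpha> - i_t d\<alpha> = f \<alpha>\<close>. In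
  particular \<open>X\<close> is contact iff this holds with \<open>t = 0\<close> everywhere.\<close>

definition splits ::
  "('a \<Rightarrow> ('a, 'm::finite) chart \<Rightarrow> real^'m) \<Rightarrow> ('a, 'm) chart \<Rightarrow> ('a \<Rightarrow> ('a, 'm) chart \<Rightarrow> complex^'m) \<Rightarrow>
    'a \<Rightarrow> (('a, 'm) chart \<Rightarrow> complex^'m) \<Rightarrow> complex \<Rightarrow> bool" where
  "splits \<alpha> c X p t f \<longleftrightarrow> (\<Sum>i\<in>UNIV. form_comp \<alpha> c i p * t c $ i) = 0 \<and>
     (\<forall>j. Lder c X (form_comp \<alpha> c) j p - (\<Sum>i\<in>UNIV. curl c (form_comp \<alpha> c) i j p * t c $ i) = f * form_comp \<alpha> c j p)"

locale contact = atlas A for A :: "('a::{t2_space, second_countable_topology}, 'm::finite) chart set" +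
  fixes n :: nat and \<xi> :: "'a \<Rightarrow> (('a, 'm) chart \<Rightarrow> real^'m) set"
  assumes card: "CARD('m) = 2 * n + 1" and contact: "contact_structure A n \<xi>"
begin

abbreviation cform where "cform \<equiv> contact_form_on A n \<xi>"

lemma ex_cform: obtains U \<alpha> c where "cform U \<alpha>" "p \<in> U" "c \<in> charts_at A p"
  using contact ex_chart unfolding contact_structure_def by blast

lemma eventually_in_U: "cform U \<alpha> \<Longrightarrow> p \<in> U \<Longrightarrow> \<forall>\<^sub>F q in nhds p. q \<in> U"
  unfolding contact_form_on_def by (auto simp: eventually_nhds)

lemma cform_smooth:
  assumes "cform U \<alpha>" "p \<in> U" "c \<in> charts_at A p"
  shows "smooth_at A p (\<lambda>q. \<alpha> q c $ j)"
proof -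
  note c = charts_atD[OF assms(3)]
  have "smooth_fun_on A (fst c \<inter> U) (\<lambda>p. \<alpha> p c)" "open (fst c \<inter> U)"
    using assms(1) c open_chart[OF c(1)] by (simp_all add: contact_form_on_def one_form_on_def open_Int)
  then have "smooth_at A p (\<lambda>q. \<alpha> q c)"
    using assms(2) c by (auto simp: smooth_at_def)
  then show ?thesis by (simp add: smooth_at_vec)
qed

lemma comp_smooth: "cform U \<alpha> \<Longrightarrow> p \<in> U \<Longrightarrow> c \<in> charts_at A p \<Longrightarrow> smooth_at A p (form_comp \<alpha> c j)"
  unfolding form_comp_def[abs_def] by (intro smooth_at_linear[OF bounded_linear_of_real] cform_smooth)

lemma pd_comp:
  "cform U \<alpha> \<Longrightarrow> p \<in> U \<Longrightarrow> c \<in> charts_at A p \<Longrightarrow>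
    pd c i (form_comp \<alpha> c j) p = of_real (pd c i (\<lambda>q. \<alpha> q c $ j) p)"
  unfolding form_comp_def[abs_def] by (intro pd_linear[OF bounded_linear_of_real] cform_smooth)

lemma lie_derivative_nth:
  "cform U \<alpha> \<Longrightarrow> p \<in> U \<Longrightarrow> c \<in> charts_at A p \<Longrightarrow>
    lie_derivative X \<alpha> p c $ j = Lder c X (form_comp \<alpha> c) j p"
  by (simp add: lie_derivative_def Lder_def along_def pd_comp sum.distrib) (simp add: form_comp_def)

lemma cform_covariant_at:
  assumes "cform U \<alpha>" "p \<in> U" "c \<in> charts_at A p" "c' \<in> charts_at A p"
  shows "\<alpha> p c $ j = (\<Sum>i\<in>UNIV. pd c j (\<lambda>q. snd c' q $ i) p * \<alpha> p c' $ i)"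
  using assms unfolding contact_form_on_def one_form_on_def by blast

lemma comp_covariant_at:
  assumes "cform U \<alpha>" "p \<in> U" "c \<in> charts_at A p" "c' \<in> charts_at A p"
  shows "covariant c c' (form_comp \<alpha> c) (form_comp \<alpha> c') p"
  unfolding covariant_def form_comp_def cform_covariant_at[OF assms] by (simp add: pd_coord assms)

lemma comp_covariant:
  assumes "cform U \<alpha>" "p \<in> U" "c \<in> charts_at A p" "c' \<in> charts_at A p"
  shows "\<forall>\<^sub>F q in nhds p. covariant c c' (form_comp \<alpha> c) (form_comp \<alpha> c') q"
  using eventually_in_U[OF assms(1,2)] eventually_charts_at[OF assms(3)] eventually_charts_at[OF assms(4)]
  by eventually_elim (rule comp_covariant_at[OF assms(1)])

text \<open>Jacobians cancel in the pairing of a covector with a vector. The scalars are kept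
  general because \<xi> consists of real vectors and the fields are complex.\<close>

lemma annihilates_iff:
  fixes v :: "('a, 'm) chart \<Rightarrow> 'k::real_normed_field^'m"
  assumes \<alpha>: "cform U \<alpha>" "p \<in> U" and c: "c \<in> charts_at A p" and v: "v \<in> tangent_space A p"
  shows "annihilates A p (\<alpha> p) v \<longleftrightarrow> (\<Sum>i\<in>UNIV. of_real (\<alpha> p c $ i) * v c $ i) = 0"
proof -
  have "(\<Sum>i\<in>UNIV. of_real (\<alpha> p c' $ i) * v c' $ i) = (\<Sum>i\<in>UNIV. of_real (\<alpha> p c $ i) * v c $ i)"
    if c': "c' \<in> charts_at A p" for c'
  proof -
    have v': "v c' $ i = (\<Sum>j\<in>UNIV. of_real (pd c j (\<lambda>q. snd c' q $ i) p) * v c $ j)" for i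
      using v c c' by (simp add: tangent_space_def)
    have "(\<Sum>i\<in>UNIV. of_real (\<alpha> p c' $ i) * v c' $ i) =
        (\<Sum>i\<in>UNIV. \<Sum>j\<in>UNIV. of_real (pd c j (\<lambda>q. snd c' q $ i) p * \<alpha> p c' $ i) * v c $ j)"
      by (simp add: v' sum_distrib_left mult_ac)
    also have "\<dots> = (\<Sum>j\<in>UNIV. \<Sum>i\<in>UNIV. of_real (pd c j (\<lambda>q. snd c' q $ i) p * \<alpha> p c' $ i) * v c $ j)"
      by (rule sum.swap)
    also have "\<dots> = (\<Sum>j\<in>UNIV. of_real (\<alpha> p c $ j) * v c $ j)"
      unfolding cform_covariant_at[OF \<alpha> c c'] by (simp add: sum_distrib_right)
    finally show ?thesis .
  qed
  then show ?thesis unfolding annihilates_def using c by metis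
qed

lemma annihilates_comp_iff:
  assumes "cform U \<alpha>" "p \<in> U" "c \<in> charts_at A p" "v \<in> tangent_space A p"
  shows "annihilates A p (\<alpha> p) v \<longleftrightarrow> (\<Sum>i\<in>UNIV. form_comp \<alpha> c i p * v c $ i) = 0"
  using annihilates_iff[OF assms] by (simp add: form_comp_def)

lemma cform_top:
  assumes "cform U \<alpha>" "p \<in> U" "c \<in> charts_at A p"
  obtains v where "wedge 1 (2 * n) (form_at \<alpha> p c) (wedge_power2 n (ext_deriv_at \<alpha> p c)) v \<noteq> 0"
  using assms unfolding contact_form_on_def by blast

lemma cform_nonzero:
  assumes "cform U \<alpha>" "p \<in> U" "c \<in> charts_at A p"
  shows "\<alpha> p c \<noteq> 0"
  using cform_top[OF assms] contact_form_nonzero by metis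

text \<open>The components are real, so this is a squared Euclidean length although no conjugation
  appears. It is the denominator in the formulas that recover multipliers.\<close>

lemma comp_square_nonzero:
  assumes "cform U \<alpha>" "p \<in> U" "c \<in> charts_at A p"
  shows "(\<Sum>j\<in>UNIV. form_comp \<alpha> c j p * form_comp \<alpha> c j p) \<noteq> 0"
proof -
  have "(\<Sum>j\<in>UNIV. form_comp \<alpha> c j p * form_comp \<alpha> c j p) = of_real (\<alpha> p c \<bullet> \<alpha> p c)"
    by (simp add: form_comp_def inner_vec_def)
  then show ?thesis using cform_nonzero[OF assms] by simp
qed

text \<open>\<alpha> and d\<alpha> have real coefficients, so \<open>Re\<close> and
  \<open>Im\<close> of \<open>z\<close> satisfy the same equations, with the real and imaginary part
  of \<open>f\<close> as multipliers.\<close>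

lemma comp_nondegenerate:
  fixes z :: "complex^'m"
  assumes \<alpha>: "cform U \<alpha>" "p \<in> U" and c: "c \<in> charts_at A p"
    and z: "(\<Sum>i\<in>UNIV. form_comp \<alpha> c i p * z $ i) = 0"
      "\<And>j. (\<Sum>i\<in>UNIV. curl c (form_comp \<alpha> c) i j p * z $ i) = f * form_comp \<alpha> c j p"
  shows "z = 0"
proof -
  obtain v where v: "wedge 1 (2 * n) (form_at \<alpha> p c) (wedge_power2 n (ext_deriv_at \<alpha> p c)) v \<noteq> 0"
    by (rule cform_top[OF \<alpha> c])
  have curl: "curl c (form_comp \<alpha> c) i j p = of_real (dform \<alpha> p c i j)" for i j
    by (simp add: curl_def dform_def pd_comp[OF \<alpha> c])
  have "(\<chi> i. h (z $ i)) = (0 :: real^'m)"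
    if h: "bounded_linear h" "\<And>r w. h (of_real r * w) = r * h w" for h :: "complex \<Rightarrow> real"
  proof (rule contact_form_nondegenerate[OF card v])
    have "(\<Sum>i\<in>UNIV. \<alpha> p c $ i * h (z $ i)) = h (\<Sum>i\<in>UNIV. form_comp \<alpha> c i p * z $ i)"
      by (simp add: linear_sum[OF bounded_linear.linear[OF h(1)]] form_comp_def h(2))
    then show "(\<Sum>i\<in>UNIV. \<alpha> p c $ i * (\<chi> i. h (z $ i)) $ i) = 0"
      using z(1) linear_0[OF bounded_linear.linear[OF h(1)]] by simp
    fix j
    have "(\<Sum>i\<in>UNIV. dform \<alpha> p c i j * h (z $ i)) = h (\<Sum>i\<in>UNIV. curl c (form_comp \<alpha> c) i j p * z $ i)"
      by (simp add: linear_sum[OF bounded_linear.linear[OF h(1)]] curl h(2))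
    also have "\<dots> = h (of_real (\<alpha> p c $ j) * f)"
      by (subst z(2)) (simp add: form_comp_def mult.commute)
    finally show "(\<Sum>i\<in>UNIV. dform \<alpha> p c i j * (\<chi> i. h (z $ i)) $ i) = h f * \<alpha> p c $ j"
      by (simp add: h(2))
  qed
  from this[OF bounded_linear_Re] this[OF bounded_linear_Im] show ?thesis
    by (simp add: vec_eq_iff complex_eq_iff)
qed

lemma proportional:
  assumes \<alpha>: "cform U \<alpha>" "p \<in> U" and \<alpha>': "cform U' \<alpha>'" "p \<in> U'" and c: "c \<in> charts_at A p"
  obtains u where "smooth_at A p u" "u p \<noteq> 0"
    "\<And>j. \<forall>\<^sub>F q in nhds p. u q * form_comp \<alpha> c j q = form_comp \<alpha>' c j q"
proof -
  \<comment> \<open>The coefficient of the orthogonal projection of \<alpha>' onto \<alpha> for the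
    Euclidean product of components in \<open>c\<close>: an explicit quotient, hence smooth.\<close>
  define u where "u q = (\<Sum>j\<in>UNIV. form_comp \<alpha>' c j q * form_comp \<alpha> c j q) / (\<Sum>j\<in>UNIV. form_comp \<alpha> c j q * form_comp \<alpha> c j q)" for q
  have u: "u q * form_comp \<alpha> c j q = form_comp \<alpha>' c j q" if q: "q \<in> U" "q \<in> U'" "c \<in> charts_at A q" for q j
  proof -
    let ?a = "\<alpha> q c" and ?b = "\<alpha>' q c"
    \<comment> \<open>The two forms are related only through their common kernel
      \<open>\<xi> q\<close>, so \<open>w\<close> must first become a tangent vector.\<close>
    have "?b \<bullet> w = 0" if w: "?a \<bullet> w = 0" for w
    proof -
      note e = extend_vector[OF q(3), of w]
      have "annihilates A q (\<alpha> q) (extend_vector A q c w)"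
        using w unfolding annihilates_iff[OF \<alpha>(1) q(1,3) e(1)] by (simp add: e(2) inner_vec_def)
      then have "extend_vector A q c w \<in> \<xi> q"
        using \<alpha>(1) q(1) e(1) by (auto simp: contact_form_on_def)
      then have "annihilates A q (\<alpha>' q) (extend_vector A q c w)"
        using \<alpha>'(1) q(2) by (auto simp: contact_form_on_def)
      then show ?thesis
        unfolding annihilates_iff[OF \<alpha>'(1) q(2,3) e(1)] by (simp add: e(2) inner_vec_def)
    qed
    moreover have a0: "?a \<bullet> ?a \<noteq> 0" using cform_nonzero[OF \<alpha>(1) q(1,3)] by simp
    define r where "r = (?b \<bullet> ?a) / (?a \<bullet> ?a)"
    \<comment> \<open>The remainder of the projection lies in ker \<alpha>, hence also in ker
      \<alpha>', so it is orthogonal to itself.\<close>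
    define w where "w = ?b - r *\<^sub>R ?a"
    have aw: "?a \<bullet> w = 0"
      using a0 by (simp add: w_def r_def inner_diff_right inner_commute)
    ultimately have "?b \<bullet> w = 0" by blast
    then have "w \<bullet> w = 0" using aw by (simp add: w_def inner_diff_left)
    then have b: "?b = r *\<^sub>R ?a" by (simp add: w_def)
    have "u q = of_real r"
      by (simp add: u_def r_def form_comp_def inner_vec_def)
    then show ?thesis
      by (simp add: form_comp_def b)
  qed
  show thesis
  proof
    show "smooth_at A p u"
      unfolding u_def[abs_def]
      by (intro smooth_at_divide smooth_at_sum smooth_at_mult comp_smooth[OF \<alpha> c] comp_smooth[OF \<alpha>' c]
          comp_square_nonzero[OF \<alpha> c])
    show "\<forall>\<^sub>F q in nhds p. u q * form_comp \<alpha> c j q = form_comp \<alpha>' c j q" for j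
      using eventually_in_U[OF \<alpha>] eventually_in_U[OF \<alpha>'] eventually_charts_at[OF c]
      by eventually_elim (rule u)
    show "u p \<noteq> 0"
    proof
      assume "u p = 0"
      then have "form_comp \<alpha>' c j p = 0" for j using u[OF \<alpha>(2) \<alpha>'(2) c, of j] by simp
      then show False using comp_square_nonzero[OF \<alpha>' c] by simp
    qed
  qed
qed

section \<open>Independence of chart and contact form; uniqueness\<close>

lemma splits_chart:
  assumes X: "X \<in> Vect A" and \<alpha>: "cform U \<alpha>" "p \<in> U" and c: "c \<in> charts_at A p" and c': "c' \<in> charts_at A p"
    and t: "t \<in> tangent_space A p" and s: "splits \<alpha> c' X p t f"
  shows "splits \<alpha> c X p t f"
  unfolding splits_def
proof (intro conjI allI)
  show "(\<Sum>i\<in>UNIV. form_comp \<alpha> c i p * t c $ i) = 0"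
    using s annihilates_comp_iff[OF \<alpha> c t] annihilates_comp_iff[OF \<alpha> c' t] by (simp add: splits_def)
  fix j
  let ?J = "\<lambda>i. pd c j (coord c' i) p"
  note cov = comp_covariant[OF \<alpha> c c'] comp_smooth[OF \<alpha> c'] c c'
  have "Lder c X (form_comp \<alpha> c) j p - (\<Sum>i\<in>UNIV. curl c (form_comp \<alpha> c) i j p * t c $ i) =
      (\<Sum>l\<in>UNIV. ?J l * (Lder c' X (form_comp \<alpha> c') l p - (\<Sum>i\<in>UNIV. curl c' (form_comp \<alpha> c') i l p * t c' $ i)))"
    using Lder_covariant[OF X cov] curl_covariant[OF t cov]
    by (simp add: covariant_def right_diff_distrib sum_subtractf)
  also have "\<dots> = f * (\<Sum>l\<in>UNIV. ?J l * form_comp \<alpha> c' l p)"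
    using s by (simp add: splits_def sum_distrib_left mult_ac)
  also have "\<dots> = f * form_comp \<alpha> c j p"
    using comp_covariant_at[OF \<alpha> c c'] by (simp add: covariant_def)
  finally show "Lder c X (form_comp \<alpha> c) j p - (\<Sum>i\<in>UNIV. curl c (form_comp \<alpha> c) i j p * t c $ i) = f * form_comp \<alpha> c j p" .
qed

text \<open>For \<alpha>' = u\<alpha>, L_X contributes the extra term X(u) \<alpha>, and i_t d
  contributes t(u) \<alpha> because \<alpha>(t) = 0. Both are multiples of \<alpha>, so only the
  multiplier changes, to (X(u) + u f - t(u)) / u.\<close>

lemma splits_form:
  assumes X: "X \<in> Vect A" and \<alpha>: "cform U \<alpha>" "p \<in> U" and \<alpha>': "cform U' \<alpha>'" "p \<in> U'"
    and c: "c \<in> charts_at A p" and s: "splits \<alpha> c X p t f"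
  shows "\<exists>f'. splits \<alpha>' c X p t f'"
proof -
  obtain u where u: "smooth_at A p u" "u p \<noteq> 0" "\<And>j. \<forall>\<^sub>F q in nhds p. u q * form_comp \<alpha> c j q = form_comp \<alpha>' c j q"
    using proportional[OF \<alpha> \<alpha>' c] by blast
  have up: "form_comp \<alpha>' c j p = u p * form_comp \<alpha> c j p" for j
    using eventually_nhds_x_imp_x[OF u(3)[of j]] by simp
  let ?\<Omega> = "curl c (form_comp \<alpha> c)"
  have at: "(\<Sum>i\<in>UNIV. form_comp \<alpha> c i p * t c $ i) = 0"
    and st: "\<And>j. Lder c X (form_comp \<alpha> c) j p = f * form_comp \<alpha> c j p + (\<Sum>i\<in>UNIV. ?\<Omega> i j p * t c $ i)"
    using s by (auto simp: splits_def algebra_simps)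
  have L: "Lder c X (form_comp \<alpha>' c) j p = along X c u p * form_comp \<alpha> c j p + u p * Lder c X (form_comp \<alpha> c) j p" for j
  proof -
    have "Lder c X (form_comp \<alpha>' c) j p = Lder c X (\<lambda>j q. u q * form_comp \<alpha> c j q) j p"
      by (rule Lder_cong[OF _ c, symmetric]) (rule u(3))
    then show ?thesis using Lder_mult[OF u(1) comp_smooth[OF \<alpha> c] c] by simp
  qed
  have \<Omega>: "curl c (form_comp \<alpha>' c) i j p = u p * ?\<Omega> i j p + pd c i u p * form_comp \<alpha> c j p - pd c j u p * form_comp \<alpha> c i p" for i j
  proof -
    have "curl c (form_comp \<alpha>' c) i j p = curl c (\<lambda>j q. u q * form_comp \<alpha> c j q) i j p"
      unfolding curl_def pd_cong[OF u(3)[of i] c] pd_cong[OF u(3)[of j] c] ..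
    then show ?thesis using curl_mult[OF u(1) comp_smooth[OF \<alpha> c] c] by simp
  qed
  define d where "d = (\<Sum>i\<in>UNIV. pd c i u p * t c $ i)"
  have "(\<Sum>i\<in>UNIV. curl c (form_comp \<alpha>' c) i j p * t c $ i) =
      u p * (\<Sum>i\<in>UNIV. ?\<Omega> i j p * t c $ i) + d * form_comp \<alpha> c j p - pd c j u p * (\<Sum>i\<in>UNIV. form_comp \<alpha> c i p * t c $ i)" for j
    unfolding \<Omega> by (simp add: d_def algebra_simps sum_subtractf sum.distrib
        sum_distrib_left sum_distrib_right mult_ac)
  then have "Lder c X (form_comp \<alpha>' c) j p - (\<Sum>i\<in>UNIV. curl c (form_comp \<alpha>' c) i j p * t c $ i) =
      (along X c u p + u p * f - d) / u p * form_comp \<alpha>' c j p" for j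
    unfolding L st up at using u(2) by (simp add: field_simps)
  moreover have "(\<Sum>i\<in>UNIV. form_comp \<alpha>' c i p * t c $ i) = 0"
    using at by (simp add: up mult.assoc flip: sum_distrib_left)
  ultimately show ?thesis unfolding splits_def by blast
qed

lemma splits_all:
  assumes "X \<in> Vect A" "cform U \<alpha>" "p \<in> U" "c \<in> charts_at A p" "t \<in> tangent_space A p" "splits \<alpha> c X p t f"
  shows "\<And>U' \<alpha>'. cform U' \<alpha>' \<Longrightarrow> p \<in> U' \<Longrightarrow> \<exists>f'. \<forall>c'\<in>charts_at A p. splits \<alpha>' c' X p t f'"
  using splits_form[OF assms(1-3) _ _ assms(4,6)] splits_chart[OF assms(1) _ _ _ assms(4,5)] by metis

text \<open>The multipliers may differ too: the difference of the solutions satisfies the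
  homogeneous system with multiplier \<open>f' - f\<close>, which nondegeneracy still
  covers.\<close>

lemma splits_unique:
  assumes \<alpha>: "cform U \<alpha>" "p \<in> U" and c: "c \<in> charts_at A p"
    and s: "splits \<alpha> c X p t f" and s': "splits \<alpha> c X p t' f'"
  shows "t c = t' c"
proof -
  have "t c - t' c = 0"
  proof (rule comp_nondegenerate[OF \<alpha> c, where f = "f' - f"])
    show "(\<Sum>i\<in>UNIV. form_comp \<alpha> c i p * (t c - t' c) $ i) = 0"
      using s s' by (simp add: splits_def right_diff_distrib sum_subtractf)
    fix j
    have "(\<Sum>i\<in>UNIV. curl c (form_comp \<alpha> c) i j p * t c $ i) = Lder c X (form_comp \<alpha> c) j p - f * form_comp \<alpha> c j p"
      "(\<Sum>i\<in>UNIV. curl c (form_comp \<alpha> c) i j p * t' c $ i) = Lder c X (form_comp \<alpha> c) j p - f' * form_comp \<alpha> c j p"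
      using s s' by (simp_all add: splits_def algebra_simps)
    then show "(\<Sum>i\<in>UNIV. curl c (form_comp \<alpha> c) i j p * (t c - t' c) $ i) = (f' - f) * form_comp \<alpha> c j p"
      by (simp add: right_diff_distrib sum_subtractf left_diff_distrib)
  qed
  then show ?thesis by simp
qed

text \<open>\<open>CVect\<close> demands a smooth multiplier, while pointwise arguments give just
  some function. Contracting with the components of \<alpha> writes it as a quotient of smooth
  functions.\<close>

lemma smooth_factor:
  assumes \<alpha>: "cform U \<alpha>" "p \<in> U" and c: "c \<in> charts_at A p" and b: "\<And>j. smooth_at A p (b j)"
    and f: "\<forall>\<^sub>F q in nhds p. \<forall>j. b j q = f q * form_comp \<alpha> c j q"
  shows "smooth_at A p f"
proof (rule smooth_at_cong)
  let ?a = "form_comp \<alpha> c"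
  show "smooth_at A p (\<lambda>q. (\<Sum>j\<in>UNIV. b j q * ?a j q) / (\<Sum>j\<in>UNIV. ?a j q * ?a j q))"
    by (intro smooth_at_divide smooth_at_sum smooth_at_mult comp_smooth[OF \<alpha> c] b comp_square_nonzero[OF \<alpha> c])
  show "\<forall>\<^sub>F q in nhds p. (\<Sum>j\<in>UNIV. b j q * ?a j q) / (\<Sum>j\<in>UNIV. ?a j q * ?a j q) = f q"
    using f eventually_in_U[OF \<alpha>] eventually_charts_at[OF c]
  proof eventually_elim
    case (elim q)
    have "(\<Sum>j\<in>UNIV. b j q * ?a j q) = f q * (\<Sum>j\<in>UNIV. ?a j q * ?a j q)"
      using elim(1) by (simp add: sum_distrib_left mult.assoc)
    then show ?case using comp_square_nonzero[OF \<alpha>(1) elim(2,3)] by simp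
  qed
qed

section \<open>Contact fields and tangent fields\<close>

lemma splits_0_iff:
  "splits \<alpha> c X p 0 f \<longleftrightarrow> (\<forall>j. Lder c X (form_comp \<alpha> c) j p = f * form_comp \<alpha> c j p)"
  by (simp add: splits_def)

lemma zero_tangent: "0 \<in> tangent_space A p"
  by (simp add: tangent_space_def)

text \<open>By invariance of \<open>splits\<close>, one contact form and one chart at each point are
  enough, and smoothness of the multiplier comes for free.\<close>

lemma CVectI:
  assumes X: "X \<in> Vect A"
    and s: "\<And>p. \<exists>U \<alpha> c f. cform U \<alpha> \<and> p \<in> U \<and> c \<in> charts_at A p \<and> splits \<alpha> c X p 0 f"
  shows "X \<in> CVect A n \<xi>"
  unfolding CVect_def mem_Collect_eq
proof (intro conjI X allI impI)
  fix U \<alpha> assume \<alpha>: "cform U \<alpha>"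
  have "\<exists>f. \<forall>c\<in>charts_at A p. splits \<alpha> c X p 0 f" if "p \<in> U" for p
    using s[of p] splits_all[OF X _ _ _ zero_tangent] \<alpha> that by metis
  then obtain f where f: "\<And>p c. p \<in> U \<Longrightarrow> c \<in> charts_at A p \<Longrightarrow> splits \<alpha> c X p 0 (f p)"
    by metis
  have "smooth_at A p f" if p: "p \<in> U" for p
  proof -
    obtain c where c: "c \<in> charts_at A p" using ex_chart by blast
    show ?thesis
    proof (rule smooth_factor[OF \<alpha> p c])
      show "smooth_at A p (Lder c X (form_comp \<alpha> c) j)" for j
        by (rule smooth_at_Lder[OF X comp_smooth[OF \<alpha> p c] c])
      show "\<forall>\<^sub>F q in nhds p. \<forall>j. Lder c X (form_comp \<alpha> c) j q = f q * form_comp \<alpha> c j q"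
        using eventually_in_U[OF \<alpha> p] eventually_charts_at[OF c]
        by eventually_elim (use f in \<open>simp add: splits_0_iff\<close>)
    qed
  qed
  moreover have "open U" using \<alpha> by (simp add: contact_form_on_def)
  ultimately have "smooth_fun_on A U f" by (simp add: smooth_fun_on_iff)
  moreover have "lie_derivative X \<alpha> p c = f p *s (\<chi> i. of_real (\<alpha> p c $ i))"
    if "p \<in> U" "c \<in> charts_at A p" for p c
    using f[OF that] by (simp add: vec_eq_iff lie_derivative_nth[OF \<alpha> that] splits_0_iff form_comp_def)
  ultimately show "\<exists>f. smooth_fun_on A U f \<and> (\<forall>p\<in>U. \<forall>c\<in>charts_at A p.
      lie_derivative X \<alpha> p c = f p *s (\<chi> i. of_real (\<alpha> p c $ i)))" by blast
qed

lemma CVect_Vect: "X \<in> CVect A n \<xi> \<Longrightarrow> X \<in> Vect A"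
  by (simp add: CVect_def)

lemma TVect_Vect: "X \<in> TVect A n \<xi> \<Longrightarrow> X \<in> Vect A"
  by (simp add: TVect_def)

lemma CVectD:
  assumes X: "X \<in> CVect A n \<xi>" and \<alpha>: "cform U \<alpha>"
  obtains f where "\<And>p. p \<in> U \<Longrightarrow> smooth_at A p f"
    "\<And>p c j. p \<in> U \<Longrightarrow> c \<in> charts_at A p \<Longrightarrow> Lder c X (form_comp \<alpha> c) j p = f p * form_comp \<alpha> c j p"
proof -
  obtain f where f: "smooth_fun_on A U f" "\<And>p c. p \<in> U \<Longrightarrow> c \<in> charts_at A p \<Longrightarrow>
      lie_derivative X \<alpha> p c = f p *s (\<chi> i. of_real (\<alpha> p c $ i))"
    using X \<alpha> unfolding CVect_def by blast
  show thesis
  proof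
    show "smooth_at A p f" if "p \<in> U" for p
      using f(1) smooth_fun_on_iff[of U f] \<alpha> that by (simp add: contact_form_on_def)
    show "Lder c X (form_comp \<alpha> c) j p = f p * form_comp \<alpha> c j p" if "p \<in> U" "c \<in> charts_at A p" for p c j
      using f(2)[OF that] lie_derivative_nth[OF \<alpha> that, of X j] by (simp add: form_comp_def)
  qed
qed

lemma TVectD:
  assumes "X \<in> TVect A n \<xi>" "cform U \<alpha>" "p \<in> U" "c \<in> charts_at A p"
  shows "(\<Sum>i\<in>UNIV. form_comp \<alpha> c i p * X p c $ i) = 0"
  using assms(1-3) annihilates_comp_iff[OF assms(2-4) Vect_tangent[OF TVect_Vect[OF assms(1)]]]
  unfolding TVect_def by blast

lemma TVect_eventually:
  assumes "X \<in> TVect A n \<xi>" and \<alpha>: "cform U \<alpha>" "p \<in> U" and c: "c \<in> charts_at A p"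
  shows "\<forall>\<^sub>F q in nhds p. (\<Sum>i\<in>UNIV. form_comp \<alpha> c i q * X q c $ i) = 0"
  using eventually_in_U[OF \<alpha>] eventually_charts_at[OF c]
  by eventually_elim (rule TVectD[OF assms(1,2)])

lemma TVectI:
  assumes X: "X \<in> Vect A"
    and "\<And>U \<alpha> p. cform U \<alpha> \<Longrightarrow> p \<in> U \<Longrightarrow> \<exists>c\<in>charts_at A p. (\<Sum>i\<in>UNIV. form_comp \<alpha> c i p * X p c $ i) = 0"
  shows "X \<in> TVect A n \<xi>"
  unfolding TVect_def using assms annihilates_comp_iff[OF _ _ _ Vect_tangent[OF X]] by blast

text \<open>If L_X \<alpha> = f \<alpha> and L_Y \<alpha> = g \<alpha>, then L_X (g \<alpha>) - L_Y
  (f \<alpha>) is X(g) - Y(f) times \<alpha>, as the terms f g \<alpha> cancel.\<close>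

lemma CVect_bracket:
  assumes X: "X \<in> CVect A n \<xi>" and Y: "Y \<in> CVect A n \<xi>"
  shows "lie_bracket X Y \<in> CVect A n \<xi>"
proof (rule CVectI)
  note XV = CVect_Vect[OF X] and YV = CVect_Vect[OF Y]
  show "lie_bracket X Y \<in> Vect A" by (rule Vect_bracket[OF XV YV])
  fix p
  obtain U \<alpha> c where \<alpha>: "cform U \<alpha>" "p \<in> U" and c: "c \<in> charts_at A p" by (rule ex_cform)
  \<comment> \<open>The second Lie derivative differentiates the multiplier, so the equation for
    \<open>W\<close> is used on a neighbourhood of \<open>p\<close>.\<close>
  have LL: "\<exists>g. smooth_at A p g \<and> (\<forall>j. Lder c W (form_comp \<alpha> c) j p = g p * form_comp \<alpha> c j p) \<and>
      (\<forall>Z j. Lder c Z (Lder c W (form_comp \<alpha> c)) j p = along Z c g p * form_comp \<alpha> c j p + g p * Lder c Z (form_comp \<alpha> c) j p)"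
    if W: "W \<in> CVect A n \<xi>" for W
  proof -
    obtain g where g: "\<And>p. p \<in> U \<Longrightarrow> smooth_at A p g"
      "\<And>p c j. p \<in> U \<Longrightarrow> c \<in> charts_at A p \<Longrightarrow> Lder c W (form_comp \<alpha> c) j p = g p * form_comp \<alpha> c j p"
      using CVectD[OF W \<alpha>(1)] by blast
    have "\<forall>\<^sub>F q in nhds p. Lder c W (form_comp \<alpha> c) j q = g q * form_comp \<alpha> c j q" for j
      using eventually_in_U[OF \<alpha>] eventually_charts_at[OF c] by eventually_elim (rule g(2))
    then have "Lder c Z (Lder c W (form_comp \<alpha> c)) j p = Lder c Z (\<lambda>j q. g q * form_comp \<alpha> c j q) j p" for Z j
      by (rule Lder_cong[OF _ c])
    then have "Lder c Z (Lder c W (form_comp \<alpha> c)) j p =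
        along Z c g p * form_comp \<alpha> c j p + g p * Lder c Z (form_comp \<alpha> c) j p" for Z j
      by (simp only: Lder_mult[OF g(1)[OF \<alpha>(2)] comp_smooth[OF \<alpha> c] c])
    with g(1)[OF \<alpha>(2)] g(2)[OF \<alpha>(2) c] show ?thesis by blast
  qed
  obtain f where f: "\<And>j. Lder c X (form_comp \<alpha> c) j p = f p * form_comp \<alpha> c j p"
    "\<And>Z j. Lder c Z (Lder c X (form_comp \<alpha> c)) j p = along Z c f p * form_comp \<alpha> c j p + f p * Lder c Z (form_comp \<alpha> c) j p"
    using LL[OF X] by blast
  obtain g where g: "\<And>j. Lder c Y (form_comp \<alpha> c) j p = g p * form_comp \<alpha> c j p"
    "\<And>Z j. Lder c Z (Lder c Y (form_comp \<alpha> c)) j p = along Z c g p * form_comp \<alpha> c j p + g p * Lder c Z (form_comp \<alpha> c) j p"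
    using LL[OF Y] by blast
  have "splits \<alpha> c (lie_bracket X Y) p 0 (along X c g p - along Y c f p)"
    unfolding splits_0_iff Lder_bracket[OF XV YV comp_smooth[OF \<alpha> c] c] f(2) g(2) f(1) g(1)
    by (simp add: algebra_simps)
  then show "\<exists>U \<alpha> c f. cform U \<alpha> \<and> p \<in> U \<and> c \<in> charts_at A p \<and> splits \<alpha> c (lie_bracket X Y) p 0 f"
    using \<alpha> c by blast
qed

lemma TVect_bracket:
  assumes X: "X \<in> CVect A n \<xi>" and Y: "Y \<in> TVect A n \<xi>"
  shows "lie_bracket X Y \<in> TVect A n \<xi>"
proof (rule TVectI)
  note XV = CVect_Vect[OF X] and YV = TVect_Vect[OF Y]
  show "lie_bracket X Y \<in> Vect A" by (rule Vect_bracket[OF XV YV])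
  fix U \<alpha> p assume \<alpha>: "cform U \<alpha>" "p \<in> U"
  obtain c where c: "c \<in> charts_at A p" using ex_chart by blast
  obtain f where f: "\<And>j. Lder c X (form_comp \<alpha> c) j p = f p * form_comp \<alpha> c j p"
    using CVectD[OF X \<alpha>(1)] \<alpha>(2) c by metis
  have "0 = along X c (\<lambda>q. \<Sum>i\<in>UNIV. form_comp \<alpha> c i q * Y q c $ i) p"
    using along_cong[OF TVect_eventually[OF Y \<alpha> c] c, of X] by (simp add: along_const)
  also have "\<dots> = f p * (\<Sum>i\<in>UNIV. form_comp \<alpha> c i p * Y p c $ i) + (\<Sum>i\<in>UNIV. form_comp \<alpha> c i p * lie_bracket X Y p c $ i)"
    unfolding along_pairing[OF YV comp_smooth[OF \<alpha> c] c] f by (simp add: sum_distrib_left mult.assoc)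
  finally show "\<exists>c\<in>charts_at A p. (\<Sum>i\<in>UNIV. form_comp \<alpha> c i p * lie_bracket X Y p c $ i) = 0"
    using c by (auto simp: TVectD[OF Y \<alpha> c])
qed

lemma CVect_TVect_disjoint:
  assumes X: "X \<in> CVect A n \<xi>" "X \<in> TVect A n \<xi>"
  shows "X = 0"
proof (rule Vect_eqI[OF CVect_Vect[OF X(1)] Vect_zero])
  fix p c i assume c: "c \<in> charts_at A p"
  obtain U \<alpha> where \<alpha>: "cform U \<alpha>" "p \<in> U" by (rule ex_cform)
  obtain f where f: "\<And>j. Lder c X (form_comp \<alpha> c) j p = f p * form_comp \<alpha> c j p"
    using CVectD[OF X(1) \<alpha>(1)] \<alpha>(2) c by metis
  have "X p c = 0"
  proof (rule comp_nondegenerate[OF \<alpha> c TVectD[OF X(2) \<alpha> c]])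
    show "(\<Sum>i\<in>UNIV. curl c (form_comp \<alpha> c) i j p * X p c $ i) = f p * form_comp \<alpha> c j p" for j
      using Lder_tangent[OF CVect_Vect[OF X(1)] comp_smooth[OF \<alpha> c] c TVect_eventually[OF X(2) \<alpha> c]] f
      by simp
  qed
  then show "X p c $ i = 0 p c $ i" by simp
qed

text \<open>\<open>w\<close> is one closed formula in the components of a single form in a single
  chart. It solves the system at \<open>p\<close> and is smooth there, which links pointwise
  solvability with smoothness.\<close>

lemma splits_solution:
  assumes X: "X \<in> Vect A" and \<alpha>: "cform U \<alpha>" "p \<in> U" and c: "c \<in> charts_at A p"
  defines "w \<equiv> \<lambda>q. tangent_solution (\<lambda>i j. curl c (form_comp \<alpha> c) i j q) (\<lambda>j. form_comp \<alpha> c j q)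
    (\<lambda>j. Lder c X (form_comp \<alpha> c) j q)"
  shows "\<exists>t f. t \<in> tangent_space A p \<and> t c = w p \<and> splits \<alpha> c X p t f"
    and "smooth_at A p (\<lambda>q. w q $ k)"
proof -
  obtain k where k: "form_comp \<alpha> c k p \<noteq> 0"
    using comp_square_nonzero[OF \<alpha> c] by (metis (no_types, lifting) mult_zero_left sum.neutral)
  have anti: "curl c (form_comp \<alpha> c) i j p = - curl c (form_comp \<alpha> c) j i p" for i j
    by (simp add: curl_def)
  have "\<forall>z f. (\<Sum>i\<in>UNIV. form_comp \<alpha> c i p * z $ i) = 0 \<longrightarrow>
      (\<forall>j. (\<Sum>i\<in>UNIV. curl c (form_comp \<alpha> c) i j p * z $ i) = f * form_comp \<alpha> c j p) \<longrightarrow> z = 0"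
    using comp_nondegenerate[OF \<alpha> c] by blast
  note sol = tangent_solution[of "\<lambda>i j. curl c (form_comp \<alpha> c) i j p" "\<lambda>j. form_comp \<alpha> c j p", OF anti this k]
  obtain f where "\<forall>j. Lder c X (form_comp \<alpha> c) j p - (\<Sum>i\<in>UNIV. curl c (form_comp \<alpha> c) i j p * w p $ i) = f * form_comp \<alpha> c j p"
    using sol(3)[of "\<lambda>j. Lder c X (form_comp \<alpha> c) j p"] unfolding w_def by blast
  then have "splits \<alpha> c X p (extend_vector A p c (w p)) f"
    using sol(2)[of "\<lambda>j. Lder c X (form_comp \<alpha> c) j p"]
    unfolding splits_def extend_vector(2)[OF c] w_def by blast
  then show "\<exists>t f. t \<in> tangent_space A p \<and> t c = w p \<and> splits \<alpha> c X p t f"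
    using extend_vector[OF c, of "w p"] by blast
  show "smooth_at A p (\<lambda>q. w q $ k)" for k
    unfolding w_def curl_def
    by (rule smooth_at_tangent_solution)
      (use sol(1) in \<open>simp_all add: curl_def smooth_at_diff smooth_at_pd comp_smooth[OF \<alpha> c] smooth_at_Lder X c\<close>)
qed

lemma splitting:
  assumes X: "X \<in> Vect A"
  obtains Y T where "Y \<in> CVect A n \<xi>" "T \<in> TVect A n \<xi>" "X = Y + T"
proof -
  have "\<exists>t. t \<in> tangent_space A p \<and> (\<forall>U \<alpha>. cform U \<alpha> \<longrightarrow> p \<in> U \<longrightarrow>
      (\<exists>f. \<forall>c\<in>charts_at A p. splits \<alpha> c X p t f))" for p
  proof -
    obtain U \<alpha> c where \<alpha>: "cform U \<alpha>" "p \<in> U" and c: "c \<in> charts_at A p" by (rule ex_cform)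
    show ?thesis using splits_solution(1)[OF X \<alpha> c] splits_all[OF X \<alpha> c] by blast
  qed
  then obtain T where T: "\<And>p. T p \<in> tangent_space A p"
    "\<And>p U \<alpha>. cform U \<alpha> \<Longrightarrow> p \<in> U \<Longrightarrow> \<exists>f. \<forall>c\<in>charts_at A p. splits \<alpha> c X p (T p) f"
    by metis
  have TV: "T \<in> Vect A"
    unfolding Vect_iff
  proof (intro conjI allI ballI T(1))
    fix p c k assume c: "c \<in> charts_at A p"
    obtain U \<alpha> where \<alpha>: "cform U \<alpha>" "p \<in> U" by (rule ex_cform)
    let ?w = "\<lambda>q. tangent_solution (\<lambda>i j. curl c (form_comp \<alpha> c) i j q) (\<lambda>j. form_comp \<alpha> c j q)
      (\<lambda>j. Lder c X (form_comp \<alpha> c) j q)"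
    \<comment> \<open>\<open>T\<close> was chosen separately at each point. Uniqueness identifies it
      with the formula \<open>?w\<close> near \<open>p\<close>, which makes it smooth.\<close>
    have wT: "?w q = T q c" if q: "q \<in> U" "c \<in> charts_at A q" for q
    proof -
      obtain t f where t: "t c = ?w q" "splits \<alpha> c X q t f"
        using splits_solution(1)[OF X \<alpha>(1) q] by blast
      obtain f' where "splits \<alpha> c X q (T q) f'" using T(2)[OF \<alpha>(1) q(1)] q(2) by blast
      then show ?thesis using splits_unique[OF \<alpha>(1) q t(2)] t(1) by simp
    qed
    have "\<forall>\<^sub>F q in nhds p. ?w q $ k = T q c $ k"
      using eventually_in_U[OF \<alpha>] eventually_charts_at[OF c] by eventually_elim (simp add: wT)
    then show "smooth_at A p (\<lambda>q. T q c $ k)"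
      by (rule smooth_at_cong) (rule splits_solution(2)[OF X \<alpha> c])
  qed
  have TT: "T \<in> TVect A n \<xi>"
  proof (rule TVectI[OF TV])
    fix U \<alpha> p assume \<alpha>: "cform U \<alpha>" "p \<in> U"
    obtain c where c: "c \<in> charts_at A p" using ex_chart by blast
    then show "\<exists>c\<in>charts_at A p. (\<Sum>i\<in>UNIV. form_comp \<alpha> c i p * T p c $ i) = 0"
      using T(2)[OF \<alpha>] by (auto simp: splits_def)
  qed
  have "X - T \<in> CVect A n \<xi>"
  proof (rule CVectI[OF Vect_minus[OF X TV]])
    fix p
    obtain U \<alpha> c where \<alpha>: "cform U \<alpha>" "p \<in> U" and c: "c \<in> charts_at A p" by (rule ex_cform)
    obtain f where f: "splits \<alpha> c X p (T p) f" using T(2)[OF \<alpha>] c by blast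
    have "Lder c (X - T) (form_comp \<alpha> c) j p = Lder c X (form_comp \<alpha> c) j p - Lder c T (form_comp \<alpha> c) j p" for j
      using Lder_plus_field[OF Vect_minus[OF X TV] TV c, of "form_comp \<alpha> c" j] by simp
    moreover have "Lder c T (form_comp \<alpha> c) j p = (\<Sum>i\<in>UNIV. curl c (form_comp \<alpha> c) i j p * T p c $ i)" for j
      by (rule Lder_tangent[OF TV comp_smooth[OF \<alpha> c] c TVect_eventually[OF TT \<alpha> c]])
    ultimately have "splits \<alpha> c (X - T) p 0 f"
      using f unfolding splits_0_iff splits_def by simp
    then show "\<exists>U \<alpha> c f. cform U \<alpha> \<and> p \<in> U \<and> c \<in> charts_at A p \<and> splits \<alpha> c (X - T) p 0 f"
      using \<alpha> c by blast
  qed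
  then show thesis using that[of "X - T" T] TT by simp
qed

section \<open>Module structures and the direct sum\<close>

sublocale vf: vector_space vf_scale
  by (rule vector_space_vf_scale)

lemma subspace_Vect: "vf.subspace (Vect A)"
  unfolding vf.subspace_def by (simp add: Vect_zero Vect_plus Vect_scale)

lemma subspace_CVect: "vf.subspace (CVect A n \<xi>)"
  unfolding vf.subspace_def
proof (intro conjI ballI allI)
  show "0 \<in> CVect A n \<xi>"
  proof (rule CVectI[OF Vect_zero])
    fix p
    obtain U \<alpha> c where \<alpha>: "cform U \<alpha>" "p \<in> U" and c: "c \<in> charts_at A p" by (rule ex_cform)
    have "splits \<alpha> c 0 p 0 0" by (simp add: splits_0_iff Lder_def along_def pd_const)
    then show "\<exists>U \<alpha> c f. cform U \<alpha> \<and> p \<in> U \<and> c \<in> charts_at A p \<and> splits \<alpha> c 0 p 0 f"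
      using \<alpha> c by blast
  qed
  fix X assume X: "X \<in> CVect A n \<xi>"
  note XV = CVect_Vect[OF X]
  show "vf_scale s X \<in> CVect A n \<xi>" for s
  proof (rule CVectI[OF Vect_scale[OF XV]])
    fix p
    obtain U \<alpha> c where \<alpha>: "cform U \<alpha>" "p \<in> U" and c: "c \<in> charts_at A p" by (rule ex_cform)
    obtain f where f: "\<And>j. Lder c X (form_comp \<alpha> c) j p = f p * form_comp \<alpha> c j p"
      using CVectD[OF X \<alpha>(1)] \<alpha>(2) c by metis
    have "splits \<alpha> c (vf_scale s X) p 0 (s * f p)"
      by (simp add: splits_0_iff Lder_scale_field[OF XV c] f)
    then show "\<exists>U \<alpha> c f. cform U \<alpha> \<and> p \<in> U \<and> c \<in> charts_at A p \<and> splits \<alpha> c (vf_scale s X) p 0 f"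
      using \<alpha> c by blast
  qed
  fix Y assume Y: "Y \<in> CVect A n \<xi>"
  note YV = CVect_Vect[OF Y]
  show "X + Y \<in> CVect A n \<xi>"
  proof (rule CVectI[OF Vect_plus[OF XV YV]])
    fix p
    obtain U \<alpha> c where \<alpha>: "cform U \<alpha>" "p \<in> U" and c: "c \<in> charts_at A p" by (rule ex_cform)
    obtain f where f: "\<And>j. Lder c X (form_comp \<alpha> c) j p = f p * form_comp \<alpha> c j p"
      using CVectD[OF X \<alpha>(1)] \<alpha>(2) c by metis
    obtain g where g: "\<And>j. Lder c Y (form_comp \<alpha> c) j p = g p * form_comp \<alpha> c j p"
      using CVectD[OF Y \<alpha>(1)] \<alpha>(2) c by metis
    have "splits \<alpha> c (X + Y) p 0 (f p + g p)"
      by (simp add: splits_0_iff Lder_plus_field[OF XV YV c] f g distrib_right)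
    then show "\<exists>U \<alpha> c f. cform U \<alpha> \<and> p \<in> U \<and> c \<in> charts_at A p \<and> splits \<alpha> c (X + Y) p 0 f"
      using \<alpha> c by blast
  qed
qed

lemma subspace_TVect: "vf.subspace (TVect A n \<xi>)"
  unfolding vf.subspace_def
proof (intro conjI ballI allI)
  show "0 \<in> TVect A n \<xi>"
    by (rule TVectI[OF Vect_zero]) (use ex_chart in auto)
  fix X assume X: "X \<in> TVect A n \<xi>"
  note XV = TVect_Vect[OF X]
  show "vf_scale s X \<in> TVect A n \<xi>" for s
  proof (rule TVectI[OF Vect_scale[OF XV]])
    fix U \<alpha> p assume \<alpha>: "cform U \<alpha>" "p \<in> U"
    obtain c where c: "c \<in> charts_at A p" using ex_chart by blast
    have "(\<Sum>i\<in>UNIV. form_comp \<alpha> c i p * vf_scale s X p c $ i) = s * (\<Sum>i\<in>UNIV. form_comp \<alpha> c i p * X p c $ i)"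
      by (simp add: vf_scale_nth sum_distrib_left mult_ac)
    then show "\<exists>c\<in>charts_at A p. (\<Sum>i\<in>UNIV. form_comp \<alpha> c i p * vf_scale s X p c $ i) = 0"
      using TVectD[OF X \<alpha> c] c by auto
  qed
  fix Y assume Y: "Y \<in> TVect A n \<xi>"
  note YV = TVect_Vect[OF Y]
  show "X + Y \<in> TVect A n \<xi>"
  proof (rule TVectI[OF Vect_plus[OF XV YV]])
    fix U \<alpha> p assume \<alpha>: "cform U \<alpha>" "p \<in> U"
    obtain c where c: "c \<in> charts_at A p" using ex_chart by blast
    then show "\<exists>c\<in>charts_at A p. (\<Sum>i\<in>UNIV. form_comp \<alpha> c i p * (X + Y) p c $ i) = 0"
      using TVectD[OF X \<alpha> c] TVectD[OF Y \<alpha> c]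
      by (intro bexI[of _ c]) (simp_all add: distrib_left sum.distrib)
  qed
qed

lemma lie_algebra_CVect: "lie_algebra_on vf_scale (CVect A n \<xi>) lie_bracket"
  by unfold_locales
    (simp_all add: subspace_CVect CVect_bracket CVect_Vect bracket_add_left bracket_add_right
      bracket_scale_left bracket_scale_right bracket_jacobi bracket_self)

text \<open>The module axioms are identities of the bracket on \<open>Vect A\<close>, so each
  subspace stable under contact fields inherits them; all three modules arise in this way.\<close>

lemma lie_module_subspace:
  assumes "vf.subspace V" "V \<subseteq> Vect A" "\<And>X Y. X \<in> CVect A n \<xi> \<Longrightarrow> Y \<in> V \<Longrightarrow> lie_bracket X Y \<in> V"
  shows "lie_module_on vf_scale (CVect A n \<xi>) lie_bracket vf_scale V lie_bracket"
proof -
  interpret lie_algebra_on vf_scale "CVect A n \<xi>" lie_bracket by (rule lie_algebra_CVect)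
  have V: "Y \<in> V \<Longrightarrow> Y \<in> Vect A" for Y using assms(2) by blast
  show ?thesis
    by unfold_locales
      (simp_all add: assms(1,3) CVect_Vect V bracket_add_left bracket_add_right
      bracket_scale_left bracket_scale_right bracket_bracket)
qed

lemma lie_module_CVect: "lie_module_on vf_scale (CVect A n \<xi>) lie_bracket vf_scale (CVect A n \<xi>) lie_bracket"
  by (rule lie_module_subspace[OF subspace_CVect]) (auto intro: CVect_Vect CVect_bracket)

lemma lie_module_TVect: "lie_module_on vf_scale (CVect A n \<xi>) lie_bracket vf_scale (TVect A n \<xi>) lie_bracket"
  by (rule lie_module_subspace[OF subspace_TVect]) (auto intro: TVect_Vect TVect_bracket)

lemma lie_module_Vect: "lie_module_on vf_scale (CVect A n \<xi>) lie_bracket vf_scale (Vect A) lie_bracket"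
  by (rule lie_module_subspace[OF subspace_Vect]) (auto intro: Vect_bracket CVect_Vect)

lemma bij_betw_sum: "bij_betw (\<lambda>(X, Y). X + Y) (CVect A n \<xi> \<times> TVect A n \<xi>) (Vect A)"
  unfolding bij_betw_def
proof
  show "inj_on (\<lambda>(X, Y). X + Y) (CVect A n \<xi> \<times> TVect A n \<xi>)"
  proof (rule inj_onI, clarsimp)
    fix X Y X' Y' assume *: "X \<in> CVect A n \<xi>" "X' \<in> CVect A n \<xi>" "Y \<in> TVect A n \<xi>" "Y' \<in> TVect A n \<xi>"
      and eq: "X + Y = X' + Y'"
    \<comment> \<open>The left side is a contact field and the right side a tangent one, so both lie
      in the intersection.\<close>
    have d: "X - X' = Y' - Y" using eq by (simp add: algebra_simps)
    have "X - X' \<in> CVect A n \<xi>" "X - X' \<in> TVect A n \<xi>"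
      using * vf.subspace_diff[OF subspace_CVect] vf.subspace_diff[OF subspace_TVect] unfolding d[symmetric]
      by (simp, metis d)
    then have "X - X' = 0" by (rule CVect_TVect_disjoint)
    then show "X = X' \<and> Y = Y'" using d by simp
  qed
  show "(\<lambda>(X, Y). X + Y) ` (CVect A n \<xi> \<times> TVect A n \<xi>) = Vect A"
  proof (intro equalityI subsetI)
    fix X assume "X \<in> Vect A"
    then obtain Y T where "Y \<in> CVect A n \<xi>" "T \<in> TVect A n \<xi>" "X = Y + T" by (rule splitting)
    then show "X \<in> (\<lambda>(X, Y). X + Y) ` (CVect A n \<xi> \<times> TVect A n \<xi>)" by force
  qed (auto intro: Vect_plus CVect_Vect TVect_Vect)
qed

end

lemma lie_module_sum:
  assumes "lie_module_on scaleL L br sV V actV" "lie_module_on scaleL L br sW W actW"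
  shows "lie_module_on scaleL L br (sum_map sV sW) (V \<times> W) (sum_map actV actW)"
proof -
  interpret V: lie_module_on scaleL L br sV V actV by fact
  interpret W: lie_module_on scaleL L br sW W actW by fact
  interpret VW: vector_space "sum_map sV sW"
    by unfold_locales
      (auto simp: sum_map_def V.V.scale_right_distrib V.V.scale_left_distrib W.V.scale_right_distrib
        W.V.scale_left_distrib)
  show ?thesis
  proof unfold_locales
    show "VW.subspace (V \<times> W)"
      using V.subspace_V W.subspace_V
      by (auto simp: VW.subspace_def V.V.subspace_def W.V.subspace_def sum_map_def zero_prod_def)
  qed (auto simp: sum_map_def V.act_closed W.act_closed V.act_add_left W.act_add_left V.act_add_right
      W.act_add_right V.act_scale_left W.act_scale_left V.act_scale_right W.act_scale_right V.act_br W.act_br)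
qed

theorem proposition2p1:
  fixes A :: "('a::{t2_space, second_countable_topology}, 'm::finite) chart set"
    and \<xi> :: "'a \<Rightarrow> (('a, 'm) chart \<Rightarrow> real^'m) set"
    and n :: nat
  assumes "n \<ge> 1"
    and "CARD('m) = 2 * n + 1"
    and "smooth_atlas A"
    and "contact_structure A n \<xi>"
  shows "lie_module_on vf_scale (CVect A n \<xi>) lie_bracket vf_scale (CVect A n \<xi>) lie_bracket
    \<and> lie_module_on vf_scale (CVect A n \<xi>) lie_bracket vf_scale (TVect A n \<xi>) lie_bracket
    \<and> lie_module_on vf_scale (CVect A n \<xi>) lie_bracket vf_scale (Vect A) lie_bracket
    \<and> lie_module_iso_on vf_scale (CVect A n \<xi>) lie_bracket
           (sum_map vf_scale vf_scale) (CVect A n \<xi> \<times> TVect A n \<xi>) (sum_map lie_bracket lie_bracket)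
           vf_scale (Vect A) lie_bracket
           (\<lambda>(X, Y). X + Y)"
proof -
  interpret contact A n \<xi>
    using assms by (simp add: contact_def atlas_def contact_axioms_def)
  \<comment> \<open>Equivariance of the sum map is additivity of the bracket in its second
    argument.\<close>
  have "lie_module_iso_on vf_scale (CVect A n \<xi>) lie_bracket
      (sum_map vf_scale vf_scale) (CVect A n \<xi> \<times> TVect A n \<xi>) (sum_map lie_bracket lie_bracket)
      vf_scale (Vect A) lie_bracket (\<lambda>(X, Y). X + Y)"
    by (intro lie_module_iso_on.intro lie_module_sum lie_module_CVect lie_module_TVect lie_module_Vect
        lie_module_iso_on_axioms.intro)
      (auto simp: bij_betw_sum sum_map_def vf.scale_right_distrib bracket_add_right CVect_Vect TVect_Vect)
  then show ?thesis
    using lie_module_CVect lie_module_TVect lie_module_Vect by blast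
qed

end
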